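(* Let $0<s<1$ and $1\le p<\infty$. Suppose that $\Omega\subset\mathbb{R}^d$ is a nonempty, bounded, open, $\kappa$-plump set (for some $\kappa\in(0,1)$). If $\overline{\mathrm{co\,dim}}_A(\partial\Omega)<sp$, then $$W^{s,p}_0(\Omega)=\left\{f\in W^{s,p}(\Omega):\int_\Omega\frac{|f(x)|^p}{\mathrm{dist}(x,\partial\Omega)^{sp}}\,dx<\infty\right\}.$$
   Context: All functions are real-valued; $|A|$ denotes the Lebesgue measure of $A\subset\mathbb{R}^d$; $B(x,R)$ is the ball with center $x$ and radius $R$, $\overline B(x,R)$ the closed ball; $\mathrm{dist}(x,E)=\inf_{y\in E}|x-y|$. Fractional Sobolev space: $W^{s,p}(\Omega)=\{f\in L^p(\Omega): [f]_{W^{s,p}(\Omega)}<\infty\}$, where $[f]_{W^{s,p}(\Omega)}=\left(\int_\Omega\int_\Omega\frac{|f(x)-f(y)|^p}{|x-y|^{d+sp}}\,dy\,dx\right)^{1/p}$, with norm $\|f\|_{W^{s,p}(\Omega)}=\|f\|_{L^p(\Omega)}+[f]_{W^{s,p}(\Omega)}$. $W^{s,p}_0(\Omega)$ is the closure of $C_c^\infty(\Omega)$ (smooth functions with compact support in $\Omega$) in $W^{s,p}(\Omega)$ with respect to this norm. For $E\subset\mathbb{R}^d$ and $r>0$ put $\widetilde E_r=\{x\in\mathbb{R}^d:\mathrm{dist}(x,E)\le r\}$. The upper Assouad codimension $\overline{\mathrm{co\,dim}}_A(E)$ is the infimum of all $q\ge0$ for which there is a constant $c=c(q)>0$ such that $|\widetilde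 E_r\cap B(x,R)|\ge c|B(x,R)|(r/R)^q$ for all $x\in E$ and $0<r<R<\mathrm{diam}\,E$. A set $E\subset\mathbb{R}^d$ is $\kappa$-plump, with $\kappa\in(0,1)$, if for each $0<r<\mathrm{diam}(E)$ and each $x\in\overline E$ there is $z\in\overline B(x,r)$ such that $B(z,\kappa r)\subset E$. *)

theory Defs
  imports "HOL-Analysis.Analysis"
begin

(* The p-th root on [0, \<infinity>], sending \<infinity> to \<infinity>; enn2real alone would send it to 0. *)
definition ennroot :: "real \<Rightarrow> ennreal \<Rightarrow> ennreal" where
  "ennroot p I = (if I = \<infinity> then \<infinity> else ennreal (enn2real I powr (1 / p)))"

(* Elements of the function spaces are represented by functions on the whole space. Only their
   values on \<Omega> matter, and the spaces are closed under changes on null sets, so that equality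
   of sets of functions expresses equality of the spaces of equivalence classes.
   Norms are ennreal-valued: they are \<infinity> when the integrals diverge. *)

definition lp_norm :: "real \<Rightarrow> 'a::euclidean_space set \<Rightarrow> ('a \<Rightarrow> real) \<Rightarrow> ennreal" where
  "lp_norm p \<Omega> f = ennroot p (\<integral>\<^sup>+ x. ennreal (\<bar>f x\<bar> powr p) \<partial>lebesgue_on \<Omega>)"

definition lp_space :: "real \<Rightarrow> 'a::euclidean_space set \<Rightarrow> ('a \<Rightarrow> real) set" where
  "lp_space p \<Omega> = {f. f \<in> borel_measurable (lebesgue_on \<Omega>) \<and> lp_norm p \<Omega> f < \<infinity>}"

(* On the diagonal x = y the integrand is 0 by the convention t / 0 = 0. *)
definition gagliardo :: "real \<Rightarrow> real \<Rightarrow> 'a::euclidean_space set \<Rightarrow> ('a \<Rightarrow> real) \<Rightarrow> ennreal" where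
  "gagliardo s p \<Omega> f = ennroot p
     (\<integral>\<^sup>+ x. (\<integral>\<^sup>+ y. ennreal (\<bar>f x - f y\<bar> powr p / norm (x - y) powr (real DIM('a) + s * p))
        \<partial>lebesgue_on \<Omega>) \<partial>lebesgue_on \<Omega>)"

definition frac_sobolev :: "real \<Rightarrow> real \<Rightarrow> 'a::euclidean_space set \<Rightarrow> ('a \<Rightarrow> real) set" where
  "frac_sobolev s p \<Omega> = {f \<in> lp_space p \<Omega>. gagliardo s p \<Omega> f < \<infinity>}"

definition frac_sobolev_norm ::
  "real \<Rightarrow> real \<Rightarrow> 'a::euclidean_space set \<Rightarrow> ('a \<Rightarrow> real) \<Rightarrow> ennreal" where
  "frac_sobolev_norm s p \<Omega> f = lp_norm p \<Omega> f + gagliardo s p \<Omega> f"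

(* C^k on the whole space, through iterated directional derivatives. *)
primrec cont_diff :: "nat \<Rightarrow> ('a::euclidean_space \<Rightarrow> real) \<Rightarrow> bool" where
  "cont_diff 0 f \<longleftrightarrow> continuous_on UNIV f"
| "cont_diff (Suc k) f \<longleftrightarrow> (\<forall>x. f differentiable (at x)) \<and>
     (\<forall>v. cont_diff k (\<lambda>x. frechet_derivative f (at x) v))"

definition test_functions :: "'a::euclidean_space set \<Rightarrow> ('a \<Rightarrow> real) set" where
  "test_functions \<Omega> = {\<phi>. (\<forall>k. cont_diff k \<phi>) \<and>
     compact (closure {x. \<phi> x \<noteq> 0}) \<and> closure {x. \<phi> x \<noteq> 0} \<subseteq> \<Omega>}"

definition frac_sobolev_0 :: "real \<Rightarrow> real \<Rightarrow> 'a::euclidean_space set \<Rightarrow> ('a \<Rightarrow> real) set" where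
  "frac_sobolev_0 s p \<Omega> = {f \<in> frac_sobolev s p \<Omega>.
     \<forall>\<epsilon>>0. \<exists>\<phi>\<in>test_functions \<Omega>. frac_sobolev_norm s p \<Omega> (\<lambda>x. f x - \<phi> x) < ennreal \<epsilon>}"

(* r < diam E, where diam E is infinite for unbounded E; the library's diameter is
   unspecified there. *)
definition less_diam :: "real \<Rightarrow> 'a::metric_space set \<Rightarrow> bool" where
  "less_diam r E \<longleftrightarrow> (bounded E \<longrightarrow> r < diameter E)"

(* Used for nonempty E only: infdist x {} = 0. *)
definition closed_nbhd :: "'a::metric_space set \<Rightarrow> real \<Rightarrow> 'a set" where
  "closed_nbhd E r = {x. infdist x E \<le> r}"

definition upper_assouad_codim :: "'a::euclidean_space set \<Rightarrow> ereal" where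
  "upper_assouad_codim E = Inf {ereal q |q. 0 \<le> q \<and>
     (\<exists>c>0. \<forall>x\<in>E. \<forall>r R. 0 < r \<and> r < R \<and> less_diam R E \<longrightarrow>
        measure lebesgue (closed_nbhd E r \<inter> ball x R)
          \<ge> c * measure lebesgue (ball x R) * (r / R) powr q)}"

definition plump :: "real \<Rightarrow> 'a::metric_space set \<Rightarrow> bool" where
  "plump \<kappa> E \<longleftrightarrow> 0 < \<kappa> \<and> \<kappa> < 1 \<and>
     (\<forall>r x. 0 < r \<and> less_diam r E \<and> x \<in> closure E \<longrightarrow> (\<exists>z\<in>cball x r. ball z (\<kappa> * r) \<subseteq> E))"

end

theory Submission
  imports Defs
begin

text \<open>Write \<open>\<delta>(x)\<close> for the distance of \<open>x\<close> to the boundary of \<open>\<Omega>\<close>, and \<open>d\<close> for the dimension.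

  \<^bold>\<open>Limits of test functions have finite Hardy integral.\<close> Such a limit inherits the
  bound from a Hardy inequality \<open>\<integral> |u|\<^sup>p \<delta>\<^sup>-\<^sup>s\<^sup>p \<le> C [u]\<^sup>p\<close>, valid for every \<open>u\<close> whose left-hand
  side is finite, hence for test functions. The inequality is an absorption argument. Fix a small \<open>\<theta>\<close>
  and compare \<open>u(x)\<close> with the values of \<open>u\<close> on the part of the layer \<open>\<delta> \<approx> \<theta> \<delta>(x)\<close> that lies
  within distance \<open>5 \<delta>(x)\<close> of \<open>x\<close>. The thickness of the boundary together with plumpness shows that
  this part has measure at least \<open>c \<theta>\<^sup>q \<delta>(x)\<^sup>d\<close> with \<open>c\<close> independent of \<open>\<theta>\<close>
  (\<open>visible_layer_large\<close>). Averaging \<open>|u(x)|\<^sup>p \<le> 2\<^sup>p (|u(x) - u(y)|\<^sup>p + |u(y)|\<^sup>p)\<close> over it, the first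
  term is controlled by the seminorm, while the second returns the Hardy integral itself with a factor
  of order \<open>\<theta>\<close> to the power \<open>sp - q\<close> (\<open>hardy_energy_recursion\<close>). Since \<open>q < sp\<close>, this factor is at most one
  half for small \<open>\<theta>\<close>, and a finite Hardy integral can be absorbed.

  \<^bold>\<open>Functions with finite Hardy integral are limits of test functions.\<close> Multiply
  \<open>f\<close> by the cutoffs \<open>\<eta>\<^sub>n\<close> that vanish where \<open>\<delta> \<le> 1/n\<close> and are \<open>1\<close> where \<open>\<delta> \<ge> 2/n\<close>. They satisfy
  \<open>|\<eta>\<^sub>n(x) - \<eta>\<^sub>n(y)| \<le> min 1 (4|x - y| / \<delta>(y))\<close> uniformly in \<open>n\<close>, and integrating the right-hand side
  against the kernel in \<open>x\<close> yields a multiple of \<open>\<delta>(y)\<^sup>-\<^sup>s\<^sup>p\<close> (\<open>truncated_kernel_integral\<close>).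
  The finite Hardy integral is therefore what provides an integrable majorant,
  and \<open>f \<eta>\<^sub>n\<close> tends to \<open>f\<close> by dominated convergence (\<open>cutoff_gagliardo_tendsto_0\<close>).
  A function \<open>g\<close> supported away from the boundary is then mollified
  (\<open>mollification_approximates\<close>). With \<open>D(k) = \<integral> |g(x + k) - g(x)|\<^sup>p dx\<close>, the part of the seminorm of
  \<open>g\<close> over pairs at distance less than \<open>\<tau>\<close> is the integral of \<open>|k|\<^sup>-\<^sup>d\<^sup>-\<^sup>s\<^sup>p D(k)\<close> over \<open>|k| < \<tau>\<close>, which is
  small for small \<open>\<tau>\<close> and does not increase under mollification; the part over pairs at distance at
  least \<open>\<tau>\<close> is controlled by the \<open>L\<^sup>p\<close> distance between \<open>g\<close> and its mollification. That distance is
  again bounded through \<open>D\<close>, so that it tends to zero because the seminorm is finite.\<close>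

section \<open>The p-th powers of the norms\<close>

text \<open>From \<open>|a + b| \<le> 2 max |a| |b|\<close>.\<close>
lemma abs_add_powr_le:
  fixes a b p :: real
  assumes "0 \<le> p"
  shows "\<bar>a + b\<bar> powr p \<le> 2 powr p * (\<bar>a\<bar> powr p + \<bar>b\<bar> powr p)"
proof -
  have "\<bar>a + b\<bar> powr p \<le> (2 * max \<bar>a\<bar> \<bar>b\<bar>) powr p"
    using assms by (intro powr_mono2) auto
  also have "\<dots> = 2 powr p * max \<bar>a\<bar> \<bar>b\<bar> powr p"
    by (simp add: powr_mult)
  also have "max \<bar>a\<bar> \<bar>b\<bar> powr p \<le> \<bar>a\<bar> powr p + \<bar>b\<bar> powr p"
    by (auto simp: max_def)
  finally show ?thesis by simp
qed

text \<open>The three energies are the integrals without the \<open>p\<close>-th root, to which exchange of integrals and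
  dominated convergence apply directly; finiteness and smallness carry over to the norms.\<close>
definition lp_energy :: "real \<Rightarrow> 'a::euclidean_space set \<Rightarrow> ('a \<Rightarrow> real) \<Rightarrow> ennreal" where
  "lp_energy p \<Omega> f = (\<integral>\<^sup>+ x. ennreal (\<bar>f x\<bar> powr p) \<partial>lebesgue_on \<Omega>)"

definition gagliardo_energy :: "real \<Rightarrow> real \<Rightarrow> 'a::euclidean_space set \<Rightarrow> ('a \<Rightarrow> real) \<Rightarrow> ennreal" where
  "gagliardo_energy s p \<Omega> f =
     (\<integral>\<^sup>+ x. (\<integral>\<^sup>+ y. ennreal (\<bar>f x - f y\<bar> powr p / norm (x - y) powr (real DIM('a) + s * p))
        \<partial>lebesgue_on \<Omega>) \<partial>lebesgue_on \<Omega>)"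

definition hardy_energy :: "real \<Rightarrow> real \<Rightarrow> 'a::euclidean_space set \<Rightarrow> ('a \<Rightarrow> real) \<Rightarrow> ennreal" where
  "hardy_energy s p \<Omega> f =
     (\<integral>\<^sup>+ x. ennreal (\<bar>f x\<bar> powr p / infdist x (frontier \<Omega>) powr (s * p)) \<partial>lebesgue_on \<Omega>)"

lemma ennroot_less:
  assumes "0 < p" "0 < e" "I < ennreal (e powr p)"
  shows "ennroot p I < ennreal e"
proof -
  obtain i where i: "0 \<le> i" "I = ennreal i"
    using assms(3) by (cases I) auto
  with assms have "i < e powr p"
    by (simp add: ennreal_less_iff)
  then have "i powr (1 / p) < (e powr p) powr (1 / p)"
    using assms i by (intro powr_less_mono2) auto
  then show ?thesis
    using assms i by (simp add: ennroot_def powr_powr ennreal_less_iff)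
qed

lemma less_ennroot:
  assumes "0 < p" "0 < e" "ennroot p I < ennreal e"
  shows "I < ennreal (e powr p)"
proof -
  have I: "I \<noteq> \<infinity>" and *: "ennreal (enn2real I powr (1 / p)) < ennreal e"
    using assms(3) by (auto simp: ennroot_def split: if_splits)
  then obtain i where i: "0 \<le> i" "I = ennreal i"
    by (cases I) auto
  with * have "i powr (1 / p) < e"
    by (simp add: ennreal_less_iff)
  then have "(i powr (1 / p)) powr p < e powr p"
    using assms i by (intro powr_less_mono2) auto
  then show ?thesis
    using assms i by (simp add: powr_powr ennreal_less_iff)
qed

lemma ennroot_finite_iff: "ennroot p I < \<infinity> \<longleftrightarrow> I < \<infinity>"
  by (auto simp: ennroot_def less_top)

lemma frac_sobolev_iff:
  "f \<in> frac_sobolev s p \<Omega> \<longleftrightarrow> f \<in> borel_measurable (lebesgue_on \<Omega>) \<and>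
     lp_energy p \<Omega> f < \<infinity> \<and> gagliardo_energy s p \<Omega> f < \<infinity>"
  by (simp only: frac_sobolev_def lp_space_def lp_norm_def gagliardo_def mem_Collect_eq
      ennroot_finite_iff lp_energy_def gagliardo_energy_def conj_assoc)

lemma frac_sobolev_norm_less:
  assumes "0 < p" "0 < e" "lp_energy p \<Omega> f < ennreal ((e / 2) powr p)" "gagliardo_energy s p \<Omega> f < ennreal ((e / 2) powr p)"
  shows "frac_sobolev_norm s p \<Omega> f < ennreal e"
proof -
  have "frac_sobolev_norm s p \<Omega> f < ennreal (e / 2) + ennreal (e / 2)"
    unfolding frac_sobolev_norm_def lp_norm_def gagliardo_def using assms
    by (intro add_strict_mono ennroot_less) (auto simp: lp_energy_def gagliardo_energy_def)
  also have "\<dots> = ennreal e"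
    using assms by (subst ennreal_plus[symmetric]) auto
  finally show ?thesis .
qed

lemma less_frac_sobolev_norm:
  assumes "0 < p" "0 < e" "frac_sobolev_norm s p \<Omega> f < ennreal e"
  shows "lp_energy p \<Omega> f < ennreal (e powr p)" "gagliardo_energy s p \<Omega> f < ennreal (e powr p)"
proof -
  have "lp_norm p \<Omega> f \<le> frac_sobolev_norm s p \<Omega> f" "gagliardo s p \<Omega> f \<le> frac_sobolev_norm s p \<Omega> f"
    by (simp_all add: frac_sobolev_norm_def)
  then have "lp_norm p \<Omega> f < ennreal e" "gagliardo s p \<Omega> f < ennreal e"
    using assms(3) by (auto intro: le_less_trans)
  then show "lp_energy p \<Omega> f < ennreal (e powr p)" "gagliardo_energy s p \<Omega> f < ennreal (e powr p)"
    using less_ennroot[OF assms(1,2)] by (auto simp: lp_norm_def gagliardo_def lp_energy_def gagliardo_energy_def)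
qed

text \<open>The completion of \<open>lborel\<close> has the same nonnegative integrals, for arbitrary integrands; this reduces
  everything over \<open>\<Omega>\<close> to translation-invariant integrals on the whole space.\<close>
lemma nn_integral_lebesgue_on:
  fixes \<Omega> :: "'a::euclidean_space set"
  assumes "open \<Omega>"
  shows "(\<integral>\<^sup>+ x. F x \<partial>lebesgue_on \<Omega>) = (\<integral>\<^sup>+ x. F x * indicator \<Omega> x \<partial>lborel)"
  using assms by (subst nn_integral_restrict_space) (auto simp: nn_integral_completion)

lemma sigma_finite_lebesgue_on:
  fixes \<Omega> :: "'a::euclidean_space set"
  assumes "bounded \<Omega>" "open \<Omega>"
  shows "sigma_finite_measure (lebesgue_on \<Omega>)"
  using finite_measure_lebesgue_on[OF lmeasurable_open[OF assms]] by (simp add: finite_measure_def)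

lemma measurable_lebesgue_on_continuous:
  fixes f :: "'a::euclidean_space \<Rightarrow> 'b::topological_space"
  assumes "continuous_on UNIV f"
  shows "f \<in> borel_measurable (lebesgue_on \<Omega>)"
  using assms by (intro measurable_restrict_space1 measurable_completion) (simp add: borel_measurable_continuous_onI)

text \<open>A product of completed measures is not complete, but it makes Borel functions of the pair
  measurable, in particular kernels built from distances.\<close>
lemma measurable_pair_lebesgue_on:
  fixes F :: "'a::euclidean_space \<times> 'a \<Rightarrow> 'b::topological_space"
  assumes "F \<in> borel_measurable borel"
  shows "F \<in> borel_measurable (lebesgue_on \<Omega> \<Otimes>\<^sub>M lebesgue_on \<Omega>)"
proof -
  have *: "(\<lambda>x. x) \<in> lebesgue_on \<Omega> \<rightarrow>\<^sub>M (borel :: 'a measure)"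
    by (intro measurable_restrict_space1 measurable_completion) auto
  have "(\<lambda>z. (fst z, snd z)) \<in> lebesgue_on \<Omega> \<Otimes>\<^sub>M lebesgue_on \<Omega> \<rightarrow>\<^sub>M (borel \<Otimes>\<^sub>M borel :: ('a \<times> 'a) measure)"
    by (intro measurable_Pair measurable_compose[OF measurable_fst *] measurable_compose[OF measurable_snd *])
  then have "(\<lambda>z. z) \<in> lebesgue_on \<Omega> \<Otimes>\<^sub>M lebesgue_on \<Omega> \<rightarrow>\<^sub>M (borel :: ('a \<times> 'a) measure)"
    by (simp add: borel_prod)
  from measurable_compose[OF this assms] show ?thesis .
qed

lemma gagliardo_integrand_measurable:
  fixes f :: "'a::euclidean_space \<Rightarrow> real"
  assumes [measurable]: "f \<in> borel_measurable (lebesgue_on \<Omega>)"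
  shows "(\<lambda>z. ennreal (\<bar>f (fst z) - f (snd z)\<bar> powr p / norm (fst z - snd z) powr a))
    \<in> borel_measurable (lebesgue_on \<Omega> \<Otimes>\<^sub>M lebesgue_on \<Omega>)"
proof -
  have [measurable]: "(\<lambda>z. norm (fst z - snd z :: 'a)) \<in> borel_measurable (lebesgue_on \<Omega> \<Otimes>\<^sub>M lebesgue_on \<Omega>)"
    by (intro measurable_pair_lebesgue_on borel_measurable_continuous_onI continuous_intros)
  show ?thesis by measurable
qed

lemma iterated_nn_integral_add:
  fixes F G :: "'a \<Rightarrow> 'a \<Rightarrow> ennreal"
  assumes M: "sigma_finite_measure M" and F: "case_prod F \<in> borel_measurable (M \<Otimes>\<^sub>M M)"
    and G: "case_prod G \<in> borel_measurable (M \<Otimes>\<^sub>M M)"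
  shows "(\<integral>\<^sup>+ x. \<integral>\<^sup>+ y. a * (F x y + G x y) \<partial>M \<partial>M)
    = a * ((\<integral>\<^sup>+ x. \<integral>\<^sup>+ y. F x y \<partial>M \<partial>M) + (\<integral>\<^sup>+ x. \<integral>\<^sup>+ y. G x y \<partial>M \<partial>M))"
proof -
  interpret sigma_finite_measure M by fact
  have "(\<integral>\<^sup>+ x. \<integral>\<^sup>+ y. a * (F x y + G x y) \<partial>M \<partial>M) = (\<integral>\<^sup>+ x. a * ((\<integral>\<^sup>+ y. F x y \<partial>M) + (\<integral>\<^sup>+ y. G x y \<partial>M)) \<partial>M)"
    using measurable_Pair2[OF F] measurable_Pair2[OF G]
    by (intro nn_integral_cong) (simp add: nn_integral_cmult nn_integral_add)
  also have "\<dots> = a * ((\<integral>\<^sup>+ x. \<integral>\<^sup>+ y. F x y \<partial>M \<partial>M) + (\<integral>\<^sup>+ x. \<integral>\<^sup>+ y. G x y \<partial>M \<partial>M))"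
    using borel_measurable_nn_integral[OF F] borel_measurable_nn_integral[OF G]
    by (simp add: nn_integral_cmult nn_integral_add)
  finally show ?thesis .
qed

lemma gagliardo_energy_add_le:
  fixes f g :: "'a::euclidean_space \<Rightarrow> real"
  assumes \<Omega>: "bounded \<Omega>" "open \<Omega>" and f: "f \<in> borel_measurable (lebesgue_on \<Omega>)" and g: "g \<in> borel_measurable (lebesgue_on \<Omega>)"
    and p: "0 \<le> p"
  shows "gagliardo_energy s p \<Omega> (\<lambda>x. f x + g x)
    \<le> ennreal (2 powr p) * (gagliardo_energy s p \<Omega> f + gagliardo_energy s p \<Omega> g)"
proof -
  let ?M = "lebesgue_on \<Omega>" and ?\<alpha> = "real DIM('a) + s * p"
  define F where "F h x y = ennreal (\<bar>h x - h y\<bar> powr p / norm (x - y) powr ?\<alpha>)" for h :: "'a \<Rightarrow> real" and x y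
  have F: "case_prod (F h) \<in> borel_measurable (?M \<Otimes>\<^sub>M ?M)" if "h \<in> borel_measurable ?M" for h
    unfolding case_prod_beta F_def by (rule gagliardo_integrand_measurable[OF that])
  have energy: "gagliardo_energy s p \<Omega> h = (\<integral>\<^sup>+ x. \<integral>\<^sup>+ y. F h x y \<partial>?M \<partial>?M)" for h
    by (simp add: gagliardo_energy_def F_def)
  have "F (\<lambda>x. f x + g x) x y \<le> ennreal (2 powr p) * (F f x y + F g x y)" for x y
  proof -
    let ?n = "norm (x - y) powr ?\<alpha>" and ?a = "f x - f y" and ?b = "g x - g y"
    have "\<bar>?a + ?b\<bar> powr p / ?n \<le> 2 powr p * (\<bar>?a\<bar> powr p + \<bar>?b\<bar> powr p) / ?n"
      by (intro divide_right_mono abs_add_powr_le p) simp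
    also have "\<dots> = 2 powr p * (\<bar>?a\<bar> powr p / ?n + \<bar>?b\<bar> powr p / ?n)"
      by (simp only: add_divide_distrib times_divide_eq_right distrib_left)
    finally have "ennreal (\<bar>?a + ?b\<bar> powr p / ?n) \<le> ennreal (2 powr p * (\<bar>?a\<bar> powr p / ?n + \<bar>?b\<bar> powr p / ?n))"
      by (rule ennreal_leI)
    then show ?thesis
      by (simp add: F_def ennreal_mult' ennreal_plus add_diff_add)
  qed
  then have "gagliardo_energy s p \<Omega> (\<lambda>x. f x + g x) \<le> (\<integral>\<^sup>+ x. \<integral>\<^sup>+ y. ennreal (2 powr p) * (F f x y + F g x y) \<partial>?M \<partial>?M)"
    unfolding energy by (intro nn_integral_mono)
  also have "\<dots> = ennreal (2 powr p) * (gagliardo_energy s p \<Omega> f + gagliardo_energy s p \<Omega> g)"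
    unfolding energy by (intro iterated_nn_integral_add sigma_finite_lebesgue_on \<Omega> F f g)
  finally show ?thesis .
qed

lemma lp_energy_add_le:
  fixes f g :: "'a::euclidean_space \<Rightarrow> real"
  assumes [measurable]: "f \<in> borel_measurable (lebesgue_on \<Omega>)" "g \<in> borel_measurable (lebesgue_on \<Omega>)"
    and p: "0 \<le> p"
  shows "lp_energy p \<Omega> (\<lambda>x. f x + g x) \<le> ennreal (2 powr p) * (lp_energy p \<Omega> f + lp_energy p \<Omega> g)"
proof -
  have "lp_energy p \<Omega> (\<lambda>x. f x + g x) \<le>
    (\<integral>\<^sup>+ x. ennreal (2 powr p) * (ennreal (\<bar>f x\<bar> powr p) + ennreal (\<bar>g x\<bar> powr p)) \<partial>lebesgue_on \<Omega>)"
    unfolding lp_energy_def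
    by (intro nn_integral_mono) (simp add: ennreal_leI abs_add_powr_le p flip: ennreal_mult' ennreal_plus)
  also have "\<dots> = ennreal (2 powr p) * (lp_energy p \<Omega> f + lp_energy p \<Omega> g)"
    by (simp add: lp_energy_def nn_integral_cmult nn_integral_add)
  finally show ?thesis .
qed

lemma gagliardo_energy_minus_commute:
  "gagliardo_energy s p \<Omega> (\<lambda>x. g x - f x) = gagliardo_energy s p \<Omega> (\<lambda>x. f x - g x)"
proof -
  have "\<bar>(g x - f x) - (g y - f y)\<bar> = \<bar>(f x - g x) - (f y - g y)\<bar>" for x y
    by simp
  then show ?thesis
    by (simp only: gagliardo_energy_def)
qed

lemma energy_cong_AE:
  fixes f g :: "'a::euclidean_space \<Rightarrow> real"
  assumes \<Omega>: "open \<Omega>" and eq: "AE x in lborel. x \<in> \<Omega> \<longrightarrow> f x = g x"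
  shows "lp_energy p \<Omega> f = lp_energy p \<Omega> g" "gagliardo_energy s p \<Omega> f = gagliardo_energy s p \<Omega> g"
proof -
  show "lp_energy p \<Omega> f = lp_energy p \<Omega> g"
    unfolding lp_energy_def nn_integral_lebesgue_on[OF \<Omega>] using eq
    by (intro nn_integral_cong_AE) (auto simp: indicator_def)
  have inner: "(\<integral>\<^sup>+ y. ennreal (\<bar>c - f y\<bar> powr p / norm (x - y) powr (real DIM('a) + s * p)) * indicator \<Omega> y \<partial>lborel)
      = (\<integral>\<^sup>+ y. ennreal (\<bar>c - g y\<bar> powr p / norm (x - y) powr (real DIM('a) + s * p)) * indicator \<Omega> y \<partial>lborel)" for c x
    using eq by (intro nn_integral_cong_AE) (auto simp: indicator_def)
  show "gagliardo_energy s p \<Omega> f = gagliardo_energy s p \<Omega> g"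
    unfolding gagliardo_energy_def nn_integral_lebesgue_on[OF \<Omega>] inner using eq
    by (intro nn_integral_cong_AE) (auto simp: indicator_def)
qed

section \<open>Distance to the boundary\<close>

lemma infdist_frontier_pos:
  fixes \<Omega> :: "'a::euclidean_space set"
  assumes "bounded \<Omega>" "open \<Omega>" "x \<in> \<Omega>"
  shows "0 < infdist x (frontier \<Omega>)"
proof -
  have "frontier \<Omega> \<noteq> {}"
    using assms frontier_eq_empty not_bounded_UNIV by blast
  moreover have "x \<notin> frontier \<Omega>"
    using assms by (simp add: frontier_def interior_open)
  ultimately show ?thesis
    using in_closed_iff_infdist_zero[OF frontier_closed] infdist_nonneg by (metis less_le)
qed

text \<open>The two ends of a chord of \<open>\<Omega>\<close> through \<open>x\<close> lie on the boundary, and each is at distance at least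
  \<open>infdist x (frontier \<Omega>)\<close> from \<open>x\<close>. This makes the radius \<open>infdist x (frontier \<Omega>)\<close> admissible in the
  thickness condition for every \<open>x\<close>, however far from the boundary.\<close>
lemma infdist_less_diameter_frontier:
  fixes \<Omega> :: "'a::euclidean_space set"
  assumes "bounded \<Omega>" "open \<Omega>" "x \<in> \<Omega>"
  shows "infdist x (frontier \<Omega>) < diameter (frontier \<Omega>)"
proof -
  obtain b :: 'a where b: "b \<in> Basis"
    using nonempty_Basis by blast
  have x: "x \<in> interior \<Omega>"
    using assms by (simp add: interior_open)
  obtain t where t: "0 < t" "x + t *\<^sub>R b \<in> frontier \<Omega>"
    using ray_to_frontier[OF assms(1) x, of b] nonzero_Basis[OF b] by metis
  obtain t' where t': "0 < t'" "x + t' *\<^sub>R (- b) \<in> frontier \<Omega>"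
    using ray_to_frontier[OF assms(1) x, of "- b"] nonzero_Basis[OF b] neg_equal_0_iff_equal by metis
  have "infdist x (frontier \<Omega>) \<le> dist x (x + t *\<^sub>R b)"
    using t by (intro infdist_le)
  also have "\<dots> = t"
    using t b by (simp add: dist_norm)
  also have "t < t + t'"
    using t' by simp
  also have "\<dots> = norm ((t + t') *\<^sub>R b)"
    using t t' b by simp
  also have "\<dots> = dist (x + t *\<^sub>R b) (x + t' *\<^sub>R (- b))"
    by (simp add: dist_norm algebra_simps)
  also have "\<dots> \<le> diameter (frontier \<Omega>)"
    using t t' assms compact_imp_bounded[OF compact_frontier_bounded] by (intro diameter_bounded_bound) auto
  finally show ?thesis .
qed

lemma diameter_frontier_le:
  fixes \<Omega> :: "'a::euclidean_space set"
  assumes "bounded \<Omega>"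
  shows "diameter (frontier \<Omega>) \<le> diameter \<Omega>"
proof -
  have "diameter (frontier \<Omega>) \<le> diameter (closure \<Omega>)"
    using assms by (intro diameter_subset) (auto simp: frontier_def)
  then show ?thesis
    using assms by (simp add: diameter_closure)
qed

lemma infdist_frontier_ge:
  fixes y :: "'a::euclidean_space"
  assumes "ball y \<rho> \<subseteq> \<Omega>" "open \<Omega>" "frontier \<Omega> \<noteq> {}"
  shows "\<rho> \<le> infdist y (frontier \<Omega>)"
proof -
  have "\<rho> \<le> dist y w" if "w \<in> frontier \<Omega>" for w
  proof (rule ccontr)
    assume "\<not> \<rho> \<le> dist y w"
    then have "w \<in> ball y \<rho>"
      by simp
    then have "w \<in> \<Omega>"
      using assms(1) by blast
    then show False
      using that assms by (simp add: frontier_def interior_open)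
  qed
  then show ?thesis
    using assms(3) by (simp add: infdist_def cINF_greatest)
qed

text \<open>The segment from a point of \<open>\<Omega>\<close> to a point outside it meets the boundary.\<close>
lemma mem_of_infdist_frontier_gt:
  fixes x y :: "'a::euclidean_space"
  assumes "open \<Omega>" "y \<in> \<Omega>" "dist x y < infdist y (frontier \<Omega>)"
  shows "x \<in> \<Omega>"
proof (rule ccontr)
  assume x: "x \<notin> \<Omega>"
  have "connected (closed_segment y x)" by simp
  moreover have "closed_segment y x \<inter> \<Omega> \<noteq> {}" "closed_segment y x - \<Omega> \<noteq> {}"
    using assms(2) x by auto
  ultimately obtain z where z: "z \<in> closed_segment y x" "z \<in> frontier \<Omega>"
    using connected_Int_frontier by blast
  have "infdist y (frontier \<Omega>) \<le> dist y z"
    using z(2) by (rule infdist_le)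
  also have "\<dots> \<le> dist x y"
    using z(1) by (metis dist_commute dist_in_closed_segment(1))
  finally show False using assms(3) by simp
qed

lemma closed_inner_region:
  fixes \<Omega> :: "'a::euclidean_space set"
  assumes \<Omega>: "open \<Omega>" and a: "0 < a"
  shows "closed {x\<in>\<Omega>. a \<le> infdist x (frontier \<Omega>)}"
proof -
  have "{x\<in>\<Omega>. a \<le> infdist x (frontier \<Omega>)} = closure \<Omega> \<inter> {x. a \<le> infdist x (frontier \<Omega>)}"
  proof (intro equalityI subsetI)
    fix x assume x: "x \<in> closure \<Omega> \<inter> {x. a \<le> infdist x (frontier \<Omega>)}"
    then have "x \<notin> frontier \<Omega>"
      using a infdist_zero[of x "frontier \<Omega>"] by auto
    then show "x \<in> {x\<in>\<Omega>. a \<le> infdist x (frontier \<Omega>)}"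
      using x \<Omega> by (auto simp: frontier_def interior_open)
  qed (use closure_subset in auto)
  moreover have "closed {x. a \<le> infdist x (frontier \<Omega>)}"
    by (intro closed_Collect_le continuous_intros)
  ultimately show ?thesis by auto
qed

section \<open>Thick boundaries and the layers seen from a point\<close>

text \<open>The volume condition whose exponents \<open>q\<close> define the upper Assouad codimension, with its constant made
  explicit.\<close>
definition thick :: "real \<Rightarrow> real \<Rightarrow> 'a::euclidean_space set \<Rightarrow> bool" where
  "thick c q E \<longleftrightarrow> (\<forall>x\<in>E. \<forall>r R. 0 < r \<and> r < R \<and> less_diam R E \<longrightarrow>
     c * measure lebesgue (ball x R) * (r / R) powr q \<le> measure lebesgue (closed_nbhd E r \<inter> ball x R))"

lemma thick_of_upper_assouad_codim_less:
  assumes "upper_assouad_codim E < ereal b"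
  obtains c q where "0 < c" "q < b" "thick c q E"
proof -
  obtain q where "ereal q < ereal b" "\<exists>c>0. thick c q E"
    using assms unfolding upper_assouad_codim_def Inf_less_iff thick_def by blast
  then show ?thesis using that by auto
qed

text \<open>Integrate the measure of \<open>S \<inter> ball v t\<close> over \<open>v \<in> A\<close> and
  exchange the integrals: the \<open>v\<close> for which a given point of \<open>S\<close> counts form at most a ball of radius \<open>t\<close>.\<close>
lemma emeasure_le_of_locally_large:
  fixes A S :: "'a::euclidean_space set"
  assumes A: "A \<in> sets borel" and S: "S \<in> sets borel" and t: "0 \<le> t"
    and large: "\<And>v. v \<in> A \<Longrightarrow> m \<le> emeasure lborel (S \<inter> ball v t)"
  shows "m * emeasure lborel A \<le> ennreal (unit_ball_vol (real DIM('a)) * t ^ DIM('a)) * emeasure lborel S"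
proof -
  have [measurable]: "A \<in> sets lborel" "S \<in> sets lborel" using A S by auto
  have "m * emeasure lborel A = (\<integral>\<^sup>+ v. m * indicator A v \<partial>lborel)"
    using A by (intro nn_integral_cmult_indicator[symmetric]) simp
  also have "\<dots> \<le> (\<integral>\<^sup>+ v. (\<integral>\<^sup>+ y. indicator S y * indicator {z. dist (fst z) (snd z) < t} (v, y) \<partial>lborel) \<partial>lborel)"
  proof (rule nn_integral_mono)
    fix v
    have "emeasure lborel (S \<inter> ball v t) = (\<integral>\<^sup>+ y. indicator (S \<inter> ball v t) y \<partial>lborel)"
      using S by (subst nn_integral_indicator) auto
    also have "\<dots> = (\<integral>\<^sup>+ y. indicator S y * indicator {z. dist (fst z) (snd z) < t} (v, y) \<partial>lborel)"
      by (intro nn_integral_cong) (auto simp: indicator_def)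
    finally show "m * indicator A v \<le> (\<integral>\<^sup>+ y. indicator S y * indicator {z. dist (fst z) (snd z) < t} (v, y) \<partial>lborel)"
      using large[of v] by (auto simp: indicator_def split: if_splits)
  qed
  also have "\<dots> = (\<integral>\<^sup>+ y. (\<integral>\<^sup>+ v. indicator S y * indicator {z. dist (fst z) (snd z) < t} (v, y) \<partial>lborel) \<partial>lborel)"
    by (rule lborel_pair.Fubini') measurable
  also have "\<dots> = (\<integral>\<^sup>+ y. ennreal (unit_ball_vol (real DIM('a)) * t ^ DIM('a)) * indicator S y \<partial>lborel)"
  proof (rule nn_integral_cong)
    fix y
    have "(\<integral>\<^sup>+ v. indicator S y * indicator {z. dist (fst z) (snd z) < t} (v, y) \<partial>lborel)
        = (\<integral>\<^sup>+ v. indicator S y * indicator (ball y t) v \<partial>lborel)"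
      by (intro nn_integral_cong) (auto simp: indicator_def dist_commute)
    also have "\<dots> = indicator S y * emeasure lborel (ball y t)"
      by (subst nn_integral_cmult) (auto intro: borel_measurable_indicator)
    finally show "(\<integral>\<^sup>+ v. indicator S y * indicator {z. dist (fst z) (snd z) < t} (v, y) \<partial>lborel)
        = ennreal (unit_ball_vol (real DIM('a)) * t ^ DIM('a)) * indicator S y"
      using t by (simp add: emeasure_ball mult.commute)
  qed
  also have "\<dots> = ennreal (unit_ball_vol (real DIM('a)) * t ^ DIM('a)) * emeasure lborel S"
    using S by (intro nn_integral_cmult_indicator) simp
  finally show ?thesis .
qed

text \<open>The points near \<open>x\<close> whose distance to the boundary is comparable to \<open>\<theta>\<close> times that of \<open>x\<close>. The
  constants leave room for a plump ball of radius \<open>\<kappa> \<theta> \<delta>(x) / 2\<close> attached to any boundary point within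
  reach of \<open>x\<close>.\<close>
definition visible_layer :: "real \<Rightarrow> real \<Rightarrow> 'a::euclidean_space set \<Rightarrow> 'a \<Rightarrow> 'a set" where
  "visible_layer \<kappa> \<theta> \<Omega> x = {y. dist x y \<le> 5 * infdist x (frontier \<Omega>) \<and>
     \<kappa> * \<theta> / 2 * infdist x (frontier \<Omega>) \<le> infdist y (frontier \<Omega>) \<and>
     infdist y (frontier \<Omega>) \<le> 2 * \<theta> * infdist x (frontier \<Omega>)}"

lemma visible_layer_measurable:
  fixes \<Omega> :: "'a::euclidean_space set"
  shows "(\<lambda>z. indicator (visible_layer \<kappa> \<theta> \<Omega> (fst z)) (snd z) :: ennreal)
    \<in> borel_measurable (lebesgue_on \<Omega> \<Otimes>\<^sub>M lebesgue_on \<Omega>)"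
proof (intro measurable_pair_lebesgue_on)
  let ?S = "{z :: 'a \<times> 'a. dist (fst z) (snd z) \<le> 5 * infdist (fst z) (frontier \<Omega>) \<and>
     \<kappa> * \<theta> / 2 * infdist (fst z) (frontier \<Omega>) \<le> infdist (snd z) (frontier \<Omega>) \<and>
     infdist (snd z) (frontier \<Omega>) \<le> 2 * \<theta> * infdist (fst z) (frontier \<Omega>)}"
  have "closed ?S"
    by (intro closed_Collect_conj closed_Collect_le continuous_intros)
  then have "indicator ?S \<in> borel_measurable borel"
    by simp
  moreover have "(\<lambda>z. indicator (visible_layer \<kappa> \<theta> \<Omega> (fst z)) (snd z)) = (indicator ?S :: 'a \<times> 'a \<Rightarrow> ennreal)"
    by (auto simp: fun_eq_iff indicator_def visible_layer_def)
  ultimately show "(\<lambda>z. indicator (visible_layer \<kappa> \<theta> \<Omega> (fst z)) (snd z) :: ennreal) \<in> borel_measurable borel"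
    by simp
qed

text \<open>Let \<open>w\<close> be a boundary point closest to \<open>x\<close>, at distance \<open>R\<close>, and let \<open>r = \<theta> R\<close>. By thickness the
  \<open>r\<close>-neighbourhood of the boundary fills at least the fraction \<open>c \<theta>\<^sup>q\<close> of the ball around \<open>w\<close> of radius
  \<open>R\<close>. By plumpness the ball of radius \<open>3 r\<close> around each point of that set contains a ball of
  radius \<open>\<kappa> r / 2\<close> lying in the layer, so the layer has at least a fixed proportion of that measure.\<close>
lemma visible_layer_large:
  fixes \<Omega> :: "'a::euclidean_space set"
  assumes \<Omega>: "bounded \<Omega>" "open \<Omega>" "plump \<kappa> \<Omega>" and thick: "thick c q (frontier \<Omega>)" and c: "0 < c"
    and x: "x \<in> \<Omega>" and \<theta>: "0 < \<theta>" "\<theta> < 1"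
  shows "ennreal (c * unit_ball_vol (real DIM('a)) * (\<kappa> / 6) ^ DIM('a) * \<theta> powr q * infdist x (frontier \<Omega>) powr real DIM('a))
    \<le> emeasure lborel (visible_layer \<kappa> \<theta> \<Omega> x \<inter> \<Omega>)"
proof -
  let ?E = "frontier \<Omega>" and ?V = "unit_ball_vol (real DIM('a))"
  define R where "R = infdist x ?E"
  define r where "r = \<theta> * R"
  have E: "?E \<noteq> {}"
    using \<Omega> x frontier_eq_empty not_bounded_UNIV by blast
  have \<kappa>: "0 < \<kappa>" "\<kappa> < 1"
    using \<Omega>(3) by (auto simp: plump_def)
  have R: "0 < R" "R < diameter ?E"
    using infdist_frontier_pos[OF \<Omega>(1,2) x] infdist_less_diameter_frontier[OF \<Omega>(1,2) x]
    by (auto simp: R_def)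
  have r: "0 < r" "r < R" "r < diameter \<Omega>"
    using R \<theta> diameter_frontier_le[OF \<Omega>(1)] by (auto simp: r_def)
      (smt (verit) mult_less_cancel_right2)
  obtain w where w: "w \<in> ?E" "R = dist x w"
    using infdist_attains_inf[OF frontier_closed E] R_def by metis
  define A where "A = closed_nbhd ?E r \<inter> ball w R"
  define S where "S = visible_layer \<kappa> \<theta> \<Omega> x \<inter> \<Omega>"
  have nbhd: "closed (closed_nbhd ?E r)"
    unfolding closed_nbhd_def by (intro closed_Collect_le continuous_intros)
  have A: "A \<in> sets borel"
    unfolding A_def using nbhd by auto
  have "closed (visible_layer \<kappa> \<theta> \<Omega> x)"
    unfolding visible_layer_def by (intro closed_Collect_conj closed_Collect_le continuous_intros)
  then have S: "S \<in> sets borel"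
    unfolding S_def using \<Omega>(2) by auto
  \<comment> \<open>The layer contains the ball of half the radius inside the plump ball attached to a boundary point near \<open>v\<close>.\<close>
  have large: "ennreal (?V * (\<kappa> * r / 2) ^ DIM('a)) \<le> emeasure lborel (S \<inter> ball v (3 * r))"
    if v: "v \<in> A" for v
  proof -
    obtain \<xi> where \<xi>: "\<xi> \<in> ?E" "infdist v ?E = dist v \<xi>"
      using infdist_attains_inf[OF frontier_closed E] by metis
    have v\<xi>: "dist v \<xi> \<le> r" and vw: "dist v w \<le> R"
      using v \<xi> by (auto simp: A_def closed_nbhd_def dist_commute)
    have "\<xi> \<in> closure \<Omega>"
      using \<xi> by (simp add: frontier_def)
    then obtain z where z: "dist \<xi> z \<le> r" "ball z (\<kappa> * r) \<subseteq> \<Omega>"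
      using \<Omega>(1,3) r unfolding plump_def less_diam_def by (metis mem_cball)
    have "ball z (\<kappa> * r / 2) \<subseteq> S \<inter> ball v (3 * r)"
    proof
      fix y assume "y \<in> ball z (\<kappa> * r / 2)"
      then have zy: "dist z y < \<kappa> * r / 2" by simp
      have \<kappa>r: "0 < \<kappa> * r" "\<kappa> * r < r"
        using \<kappa> r by auto
      have ball: "ball y (\<kappa> * r / 2) \<subseteq> ball z (\<kappa> * r)"
      proof
        fix u assume "u \<in> ball y (\<kappa> * r / 2)"
        then show "u \<in> ball z (\<kappa> * r)"
          using zy dist_triangle[of z u y] by simp
      qed
      have "y \<in> \<Omega>"
        using z zy \<kappa>r by (intro subsetD[OF z(2)]) simp
      moreover have "\<kappa> * r / 2 \<le> infdist y ?E"
        using ball z \<Omega> E by (intro infdist_frontier_ge) auto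
      moreover have "infdist y ?E \<le> 2 * r"
      proof -
        have "infdist y ?E \<le> dist y \<xi>"
          by (rule infdist_le[OF \<xi>(1)])
        also have "\<dots> \<le> dist z y + dist \<xi> z"
          using dist_triangle[of y \<xi> z] by (simp add: dist_commute)
        finally show ?thesis using zy z \<kappa>r by simp
      qed
      moreover have vy: "dist v y < 3 * r"
        using dist_triangle[of v y \<xi>] dist_triangle[of \<xi> y z] zy z v\<xi> \<kappa>r by simp
      moreover have "dist x y \<le> 5 * R"
        using dist_triangle[of x y w] dist_triangle[of w y v] vy vw w r by (simp add: dist_commute)
      ultimately show "y \<in> S \<inter> ball v (3 * r)"
        by (simp add: S_def visible_layer_def flip: R_def) (simp add: r_def algebra_simps)
    qed
    then have "emeasure lborel (ball z (\<kappa> * r / 2)) \<le> emeasure lborel (S \<inter> ball v (3 * r))"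
      using S by (intro emeasure_mono) auto
    then show ?thesis
      using \<kappa> r by (simp add: emeasure_ball)
  qed
  have fin: "emeasure lborel S < \<infinity>"
    using \<Omega>(1) by (intro emeasure_bounded_finite bounded_subset[OF \<Omega>(1)]) (auto simp: S_def)
  have finA: "emeasure lborel A < \<infinity>"
    by (intro emeasure_bounded_finite bounded_subset[OF bounded_ball]) (auto simp: A_def)
  define mA where "mA = measure lborel A"
  define mS where "mS = measure lborel S"
  have "ennreal (?V * (\<kappa> * r / 2) ^ DIM('a)) * emeasure lborel A
    \<le> ennreal (?V * (3 * r) ^ DIM('a)) * emeasure lborel S"
    using r by (intro emeasure_le_of_locally_large[OF A S] large) auto
  then have "ennreal (?V * (\<kappa> * r / 2) ^ DIM('a) * mA) \<le> ennreal (?V * (3 * r) ^ DIM('a) * mS)"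
    using fin finA r \<kappa> by (simp add: emeasure_eq_ennreal_measure less_top mA_def mS_def ennreal_mult')
  then have "?V * (\<kappa> * r / 2) ^ DIM('a) * mA \<le> ?V * (3 * r) ^ DIM('a) * mS"
    using r by (subst (asm) ennreal_le_iff) (auto simp: mS_def)
  then have "(\<kappa> * r / 2) ^ DIM('a) * mA \<le> (3 * r) ^ DIM('a) * mS"
    by (simp add: mult.assoc)
  moreover have "(\<kappa> * r / 2) ^ DIM('a) = (3 * r) ^ DIM('a) * (\<kappa> / 6) ^ DIM('a)"
    by (simp only: power_mult_distrib[symmetric]) (simp add: field_simps)
  ultimately have mS: "(\<kappa> / 6) ^ DIM('a) * mA \<le> mS"
    using r by (simp add: mult.assoc)
  have "less_diam R ?E"
    using R by (simp add: less_diam_def)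
  then have "c * measure lebesgue (ball w R) * (r / R) powr q \<le> measure lebesgue A"
    using thick w r by (auto simp: thick_def A_def)
  moreover have "measure lebesgue A = mA" "measure lebesgue (ball w R) = ?V * R ^ DIM('a)"
    using A R by (simp_all add: mA_def content_ball)
  moreover have "r / R = \<theta>"
    using R by (simp add: r_def)
  ultimately have "c * (?V * R ^ DIM('a)) * \<theta> powr q \<le> mA"
    by simp
  then have "(\<kappa> / 6) ^ DIM('a) * (c * (?V * R ^ DIM('a)) * \<theta> powr q) \<le> (\<kappa> / 6) ^ DIM('a) * mA"
    using \<kappa> by (intro mult_left_mono) auto
  with mS have "c * ?V * (\<kappa> / 6) ^ DIM('a) * \<theta> powr q * R powr real DIM('a) \<le> mS"
    using R by (simp add: powr_realpow mult_ac)
  then have "ennreal (c * ?V * (\<kappa> / 6) ^ DIM('a) * \<theta> powr q * R powr real DIM('a)) \<le> emeasure lborel S"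
    using fin by (simp add: emeasure_eq_ennreal_measure less_top mS_def)
  then show ?thesis
    by (simp add: S_def R_def)
qed

text \<open>If \<open>y\<close> lies in the layer seen from \<open>x\<close>, then \<open>\<delta>(x) \<ge> \<delta>(y) / (2 \<theta>)\<close> and \<open>x\<close> lies in a ball around \<open>y\<close> of
  radius a multiple of \<open>\<delta>(y) / \<theta>\<close>. The powers of \<open>\<theta>\<close> are recorded exactly, since it is their sum that
  decides whether the Hardy integral can be absorbed.\<close>
lemma visible_layer_dual_bound:
  fixes \<Omega> :: "'a::euclidean_space set"
  assumes \<Omega>: "bounded \<Omega>" "open \<Omega>" and y: "y \<in> \<Omega>" and \<kappa>: "0 < \<kappa>" and \<theta>: "0 < \<theta>" and \<alpha>: "0 \<le> \<alpha>"
  shows "(\<integral>\<^sup>+ x. ennreal (infdist x (frontier \<Omega>) powr - \<alpha>) * indicator (visible_layer \<kappa> \<theta> \<Omega> x) y \<partial>lebesgue_on \<Omega>)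
    \<le> ennreal ((2 * \<theta>) powr \<alpha> * unit_ball_vol (real DIM('a)) * (10 / \<kappa>) ^ DIM('a) *
        \<theta> powr - real DIM('a) * infdist y (frontier \<Omega>) powr (real DIM('a) - \<alpha>))"
proof -
  let ?\<delta> = "\<lambda>x. infdist x (frontier \<Omega>)"
  define \<rho> where "\<rho> = 10 / \<kappa> * (?\<delta> y / \<theta>)"
  have \<delta>y: "0 < ?\<delta> y" using infdist_frontier_pos[OF \<Omega> y] .
  have \<rho>: "0 < \<rho>" using \<delta>y \<theta> \<kappa> by (simp add: \<rho>_def)
  have "(\<integral>\<^sup>+ x. ennreal (?\<delta> x powr - \<alpha>) * indicator (visible_layer \<kappa> \<theta> \<Omega> x) y \<partial>lebesgue_on \<Omega>)
    = (\<integral>\<^sup>+ x. ennreal (?\<delta> x powr - \<alpha>) * indicator (visible_layer \<kappa> \<theta> \<Omega> x) y * indicator \<Omega> x \<partial>lborel)"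
    by (rule nn_integral_lebesgue_on[OF \<Omega>(2)])
  also have "\<dots> \<le> (\<integral>\<^sup>+ x. ennreal ((?\<delta> y / (2 * \<theta>)) powr - \<alpha>) * indicator (cball y \<rho>) x \<partial>lborel)"
  proof (rule nn_integral_mono)
    fix x
    show "ennreal (?\<delta> x powr - \<alpha>) * indicator (visible_layer \<kappa> \<theta> \<Omega> x) y * indicator \<Omega> x
      \<le> ennreal ((?\<delta> y / (2 * \<theta>)) powr - \<alpha>) * indicator (cball y \<rho>) x"
    proof (cases "x \<in> \<Omega> \<and> y \<in> visible_layer \<kappa> \<theta> \<Omega> x")
      case True
      then have l: "dist x y \<le> 5 * ?\<delta> x" "\<kappa> * \<theta> / 2 * ?\<delta> x \<le> ?\<delta> y" "?\<delta> y \<le> 2 * \<theta> * ?\<delta> x"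
        by (auto simp: visible_layer_def)
      have "?\<delta> x \<le> 2 * ?\<delta> y / (\<kappa> * \<theta>)"
        using l(2) \<kappa> \<theta> by (simp add: field_simps)
      then have "x \<in> cball y \<rho>"
        using l(1) by (simp add: \<rho>_def dist_commute)
      moreover have "?\<delta> x powr - \<alpha> \<le> (?\<delta> y / (2 * \<theta>)) powr - \<alpha>"
        using l(3) \<theta> \<delta>y \<alpha> by (intro powr_mono2') (auto simp: field_simps)
      ultimately show ?thesis
        using True by (simp add: ennreal_leI)
    qed auto
  qed
  also have "\<dots> = ennreal ((?\<delta> y / (2 * \<theta>)) powr - \<alpha>) * emeasure lborel (cball y \<rho>)"
    by (intro nn_integral_cmult_indicator) simp
  also have "\<dots> = ennreal ((?\<delta> y / (2 * \<theta>)) powr - \<alpha> * (unit_ball_vol (real DIM('a)) * \<rho> ^ DIM('a)))"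
    using \<rho> by (simp add: emeasure_cball ennreal_mult')
  also have "(?\<delta> y / (2 * \<theta>)) powr - \<alpha> = (2 * \<theta>) powr \<alpha> * ?\<delta> y powr - \<alpha>"
    using \<theta> \<delta>y by (simp add: powr_divide powr_minus field_simps)
  also have "\<rho> ^ DIM('a) = (10 / \<kappa>) ^ DIM('a) * (\<theta> powr - real DIM('a) * ?\<delta> y powr real DIM('a))"
    using \<theta> \<delta>y by (simp add: \<rho>_def power_mult_distrib power_divide powr_minus powr_realpow field_simps)
  also have "(2 * \<theta>) powr \<alpha> * ?\<delta> y powr - \<alpha> * (unit_ball_vol (real DIM('a)) * ((10 / \<kappa>) ^ DIM('a) * (\<theta> powr - real DIM('a) * ?\<delta> y powr real DIM('a))))
    = (2 * \<theta>) powr \<alpha> * unit_ball_vol (real DIM('a)) * (10 / \<kappa>) ^ DIM('a) *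
        \<theta> powr - real DIM('a) * (?\<delta> y powr real DIM('a) * ?\<delta> y powr - \<alpha>)"
    by (simp only: mult_ac)
  also have "?\<delta> y powr real DIM('a) * ?\<delta> y powr - \<alpha> = ?\<delta> y powr (real DIM('a) - \<alpha>)"
    by (simp add: powr_add[symmetric])
  finally show ?thesis .
qed

section \<open>The fractional Hardy inequality\<close>

text \<open>Average \<open>|u(x)|\<^sup>p \<le> 2\<^sup>p (|u(x) - u(y)|\<^sup>p + |u(y)|\<^sup>p)\<close> over the \<open>y\<close> in the layer seen from \<open>x\<close>. The average
  costs a factor \<open>\<theta>\<close> to the power \<open>-q\<close> in both terms. In the second, the exchange of the integrals
  gains \<open>\<theta>\<close> to the power \<open>sp\<close>, because \<open>y\<close> is much closer to the boundary than \<open>x\<close>.\<close>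
lemma hardy_energy_recursion:
  fixes \<Omega> :: "'a::euclidean_space set"
  assumes \<Omega>: "bounded \<Omega>" "open \<Omega>" "plump \<kappa> \<Omega>" and thick: "thick c q (frontier \<Omega>)" and c: "0 < c"
    and \<theta>: "0 < \<theta>" "\<theta> < 1" and sp: "0 < s" "0 < p"
    and u[measurable]: "u \<in> borel_measurable (lebesgue_on \<Omega>)"
    and c1: "c1 = c * unit_ball_vol (real DIM('a)) * (\<kappa> / 6) ^ DIM('a)"
    and \<alpha>: "\<alpha> = real DIM('a) + s * p"
  shows "hardy_energy s p \<Omega> u
    \<le> ennreal (2 powr p * 5 powr \<alpha> / (c1 * \<theta> powr q)) * gagliardo_energy s p \<Omega> u
      + ennreal (2 powr p * 2 powr \<alpha> * unit_ball_vol (real DIM('a)) * (10 / \<kappa>) ^ DIM('a) / c1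
                  * \<theta> powr (s * p - q)) * hardy_energy s p \<Omega> u"
proof -
  let ?M = "lebesgue_on \<Omega>" and ?\<delta> = "\<lambda>x. infdist x (frontier \<Omega>)" and ?V = "unit_ball_vol (real DIM('a))"
  let ?L = "\<lambda>x y. indicator (visible_layer \<kappa> \<theta> \<Omega> x) y :: ennreal"
  interpret M: sigma_finite_measure ?M by (rule sigma_finite_lebesgue_on[OF \<Omega>(1,2)])
  interpret MM: pair_sigma_finite ?M ?M ..
  have \<kappa>: "0 < \<kappa>" using \<Omega>(3) by (simp add: plump_def)
  have c1_pos: "0 < c1" using c \<kappa> by (simp add: c1)
  have \<alpha>_pos: "0 < \<alpha>" using sp by (simp add: \<alpha> add_pos_pos)
  define K where "K = c1 * \<theta> powr q"
  have K: "0 < K" using c1_pos \<theta> by (simp add: K_def)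
  have L[measurable]: "(\<lambda>z. ?L (fst z) (snd z)) \<in> borel_measurable (?M \<Otimes>\<^sub>M ?M)"
    by (rule visible_layer_measurable)
  have \<delta>1[measurable]: "(\<lambda>z. ?\<delta> (fst z)) \<in> borel_measurable (?M \<Otimes>\<^sub>M ?M)"
    by (intro measurable_pair_lebesgue_on borel_measurable_continuous_onI continuous_intros)
  have \<delta>2[measurable]: "(\<lambda>z. ?\<delta> (snd z)) \<in> borel_measurable (?M \<Otimes>\<^sub>M ?M)"
    by (intro measurable_pair_lebesgue_on borel_measurable_continuous_onI continuous_intros)
  note G[measurable] = gagliardo_integrand_measurable[OF u, of p \<alpha>]
  \<comment> \<open>\<open>K \<delta>(x)\<^sup>d\<close> is the lower bound for the measure of the layer; it replaces the measure in the mean value.\<close>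
  have average: "ennreal (\<bar>u x\<bar> powr p / ?\<delta> x powr (s * p))
      \<le> (\<integral>\<^sup>+ y. ennreal (\<bar>u x\<bar> powr p * ?\<delta> x powr - \<alpha> / K) * ?L x y \<partial>?M)" if x: "x \<in> \<Omega>" for x
  proof -
    have \<delta>x: "0 < ?\<delta> x" using infdist_frontier_pos[OF \<Omega>(1,2) x] .
    have "closed (visible_layer \<kappa> \<theta> \<Omega> x)"
      unfolding visible_layer_def by (intro closed_Collect_conj closed_Collect_le continuous_intros)
    then have S: "visible_layer \<kappa> \<theta> \<Omega> x \<inter> \<Omega> \<in> sets lborel"
      using \<Omega>(2) by auto
    have "(\<integral>\<^sup>+ y. ennreal (\<bar>u x\<bar> powr p * ?\<delta> x powr - \<alpha> / K) * ?L x y \<partial>?M)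
      = (\<integral>\<^sup>+ y. ennreal (\<bar>u x\<bar> powr p * ?\<delta> x powr - \<alpha> / K) * indicator (visible_layer \<kappa> \<theta> \<Omega> x \<inter> \<Omega>) y \<partial>lborel)"
      by (subst nn_integral_lebesgue_on[OF \<Omega>(2)]) (auto intro!: nn_integral_cong simp: indicator_def)
    also have "\<dots> = ennreal (\<bar>u x\<bar> powr p * ?\<delta> x powr - \<alpha> / K) * emeasure lborel (visible_layer \<kappa> \<theta> \<Omega> x \<inter> \<Omega>)"
      using S by (rule nn_integral_cmult_indicator)
    also have "\<dots> \<ge> ennreal (\<bar>u x\<bar> powr p * ?\<delta> x powr - \<alpha> / K) * ennreal (K * ?\<delta> x powr real DIM('a))"
      using visible_layer_large[OF \<Omega> thick c x \<theta>] by (intro mult_left_mono) (auto simp: K_def c1)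
    also have "ennreal (\<bar>u x\<bar> powr p * ?\<delta> x powr - \<alpha> / K) * ennreal (K * ?\<delta> x powr real DIM('a))
      = ennreal (\<bar>u x\<bar> powr p * (?\<delta> x powr - \<alpha> * ?\<delta> x powr real DIM('a)))"
      using K by (subst ennreal_mult'[symmetric]) auto
    also have "?\<delta> x powr - \<alpha> * ?\<delta> x powr real DIM('a) = 1 / ?\<delta> x powr (s * p)"
      by (simp add: powr_add[symmetric] \<alpha> powr_minus_divide)
    finally show ?thesis by simp
  qed
  \<comment> \<open>On the layer \<open>|x - y| \<le> 5 \<delta>(x)\<close>, so the weight is bounded by the kernel of the seminorm.\<close>
  have split: "ennreal (\<bar>u x\<bar> powr p * ?\<delta> x powr - \<alpha> / K) * ?L x y
      \<le> ennreal (2 powr p * 5 powr \<alpha> / K) * ennreal (\<bar>u x - u y\<bar> powr p / norm (x - y) powr \<alpha>)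
        + ennreal (2 powr p / K * \<bar>u y\<bar> powr p) * (ennreal (?\<delta> x powr - \<alpha>) * ?L x y)"
    if x: "x \<in> \<Omega>" for x y
  proof (cases "y \<in> visible_layer \<kappa> \<theta> \<Omega> x")
    case True
    have \<delta>x: "0 < ?\<delta> x" using infdist_frontier_pos[OF \<Omega>(1,2) x] .
    have xy: "norm (x - y) \<le> 5 * ?\<delta> x"
      using True by (simp add: visible_layer_def dist_norm)
    have "\<bar>u x\<bar> powr p \<le> 2 powr p * (\<bar>u x - u y\<bar> powr p + \<bar>u y\<bar> powr p)"
      using abs_add_powr_le[of p "u x - u y" "u y"] sp by simp
    then have "\<bar>u x\<bar> powr p * ?\<delta> x powr - \<alpha> / K \<le> 2 powr p * (\<bar>u x - u y\<bar> powr p + \<bar>u y\<bar> powr p) * ?\<delta> x powr - \<alpha> / K"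
      using K by (intro divide_right_mono mult_right_mono) auto
    also have "\<dots> = 2 powr p / K * (\<bar>u x - u y\<bar> powr p * ?\<delta> x powr - \<alpha>) + 2 powr p / K * \<bar>u y\<bar> powr p * ?\<delta> x powr - \<alpha>"
      by (simp add: algebra_simps add_divide_distrib)
    also have "\<bar>u x - u y\<bar> powr p * ?\<delta> x powr - \<alpha> \<le> 5 powr \<alpha> * (\<bar>u x - u y\<bar> powr p / norm (x - y) powr \<alpha>)"
    proof (cases "x = y")
      case False
      then have "?\<delta> x powr - \<alpha> \<le> (norm (x - y) / 5) powr - \<alpha>"
        using xy \<alpha>_pos by (intro powr_mono2') auto
      also have "\<dots> = 5 powr \<alpha> / norm (x - y) powr \<alpha>"
        by (simp add: powr_divide powr_minus field_simps)
      finally show ?thesis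
        by (metis mult.commute mult_left_mono powr_ge_zero times_divide_eq_right)
    qed simp
    finally have "\<bar>u x\<bar> powr p * ?\<delta> x powr - \<alpha> / K
      \<le> 2 powr p * 5 powr \<alpha> / K * (\<bar>u x - u y\<bar> powr p / norm (x - y) powr \<alpha>) + 2 powr p / K * \<bar>u y\<bar> powr p * ?\<delta> x powr - \<alpha>"
      using K by (simp add: mult_left_mono divide_right_mono mult.assoc)
    then have "ennreal (\<bar>u x\<bar> powr p * ?\<delta> x powr - \<alpha> / K)
      \<le> ennreal (2 powr p * 5 powr \<alpha> / K * (\<bar>u x - u y\<bar> powr p / norm (x - y) powr \<alpha>) + 2 powr p / K * \<bar>u y\<bar> powr p * ?\<delta> x powr - \<alpha>)"
      by (rule ennreal_leI)
    also have "\<dots> = ennreal (2 powr p * 5 powr \<alpha> / K) * ennreal (\<bar>u x - u y\<bar> powr p / norm (x - y) powr \<alpha>)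
        + ennreal (2 powr p / K * \<bar>u y\<bar> powr p) * ennreal (?\<delta> x powr - \<alpha>)"
      using K by (subst ennreal_plus) (auto simp: ennreal_mult'[symmetric])
    finally show ?thesis
      using True by simp
  qed simp
  have dual: "(\<integral>\<^sup>+ x. ennreal (2 powr p / K * \<bar>u y\<bar> powr p) * (ennreal (?\<delta> x powr - \<alpha>) * ?L x y) \<partial>?M)
      \<le> ennreal (2 powr p * 2 powr \<alpha> * ?V * (10 / \<kappa>) ^ DIM('a) / c1 * \<theta> powr (s * p - q)) *
        ennreal (\<bar>u y\<bar> powr p / ?\<delta> y powr (s * p))" if y: "y \<in> \<Omega>" for y
  proof -
    have "(\<lambda>z. ennreal (?\<delta> (fst z) powr - \<alpha>) * ?L (fst z) (snd z)) \<in> borel_measurable (?M \<Otimes>\<^sub>M ?M)"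
      by measurable
    moreover have "y \<in> space ?M"
      using y by (simp add: space_restrict_space)
    ultimately have "(\<lambda>x. (\<lambda>z. ennreal (?\<delta> (fst z) powr - \<alpha>) * ?L (fst z) (snd z)) (x, y)) \<in> borel_measurable ?M"
      by (rule measurable_Pair1)
    then have "(\<lambda>x. ennreal (?\<delta> x powr - \<alpha>) * ?L x y) \<in> borel_measurable ?M"
      unfolding fst_conv snd_conv .
    then have "(\<integral>\<^sup>+ x. ennreal (2 powr p / K * \<bar>u y\<bar> powr p) * (ennreal (?\<delta> x powr - \<alpha>) * ?L x y) \<partial>?M)
      = ennreal (2 powr p / K * \<bar>u y\<bar> powr p) * (\<integral>\<^sup>+ x. ennreal (?\<delta> x powr - \<alpha>) * ?L x y \<partial>?M)"
      by (rule nn_integral_cmult)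
    also have "\<dots> \<le> ennreal (2 powr p / K * \<bar>u y\<bar> powr p) *
       ennreal ((2 * \<theta>) powr \<alpha> * ?V * (10 / \<kappa>) ^ DIM('a) * \<theta> powr - real DIM('a) * ?\<delta> y powr (real DIM('a) - \<alpha>))"
      using \<alpha>_pos by (intro mult_left_mono visible_layer_dual_bound[OF \<Omega>(1,2) y \<kappa> \<theta>(1)]) auto
    also have "\<dots> = ennreal (2 powr p / K * \<bar>u y\<bar> powr p *
       ((2 * \<theta>) powr \<alpha> * ?V * (10 / \<kappa>) ^ DIM('a) * \<theta> powr - real DIM('a) * ?\<delta> y powr (real DIM('a) - \<alpha>)))"
      using K by (subst ennreal_mult') auto
    also have "?\<delta> y powr (real DIM('a) - \<alpha>) = 1 / ?\<delta> y powr (s * p)"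
      by (simp add: \<alpha> powr_minus_divide)
    also have "2 powr p / K * \<bar>u y\<bar> powr p *
       ((2 * \<theta>) powr \<alpha> * ?V * (10 / \<kappa>) ^ DIM('a) * \<theta> powr - real DIM('a) * (1 / ?\<delta> y powr (s * p)))
      = 2 powr p * 2 powr \<alpha> * ?V * (10 / \<kappa>) ^ DIM('a) / c1 * (\<theta> powr \<alpha> * \<theta> powr - real DIM('a) * \<theta> powr - q) *
          (\<bar>u y\<bar> powr p / ?\<delta> y powr (s * p))"
      unfolding K_def powr_mult powr_minus using c1_pos \<theta> by (simp add: field_simps)
    also have "\<theta> powr \<alpha> * \<theta> powr - real DIM('a) * \<theta> powr - q = \<theta> powr (s * p - q)"
      by (simp add: powr_add[symmetric] \<alpha>)
    finally show ?thesis
      using c1_pos \<kappa> by (subst ennreal_mult'[symmetric]) auto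
  qed
  define F1 where "F1 x y = ennreal (2 powr p * 5 powr \<alpha> / K) * ennreal (\<bar>u x - u y\<bar> powr p / norm (x - y) powr \<alpha>)" for x y
  define F2 where "F2 x y = ennreal (2 powr p / K * \<bar>u y\<bar> powr p) * (ennreal (?\<delta> x powr - \<alpha>) * ?L x y)" for x y
  have F1: "case_prod F1 \<in> borel_measurable (?M \<Otimes>\<^sub>M ?M)"
    unfolding F1_def case_prod_beta by measurable
  have F2: "case_prod F2 \<in> borel_measurable (?M \<Otimes>\<^sub>M ?M)"
    unfolding F2_def case_prod_beta by measurable
  have "hardy_energy s p \<Omega> u \<le> (\<integral>\<^sup>+ x. \<integral>\<^sup>+ y. ennreal (\<bar>u x\<bar> powr p * ?\<delta> x powr - \<alpha> / K) * ?L x y \<partial>?M \<partial>?M)"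
    unfolding hardy_energy_def by (intro nn_integral_mono average) simp
  also have "\<dots> \<le> (\<integral>\<^sup>+ x. \<integral>\<^sup>+ y. (F1 x y + F2 x y) \<partial>?M \<partial>?M)"
    unfolding F1_def F2_def by (intro nn_integral_mono split) simp
  also have "\<dots> = (\<integral>\<^sup>+ x. (\<integral>\<^sup>+ y. F1 x y \<partial>?M) + (\<integral>\<^sup>+ y. F2 x y \<partial>?M) \<partial>?M)"
    using measurable_Pair2[OF F1] measurable_Pair2[OF F2] by (intro nn_integral_cong nn_integral_add) simp_all
  also have "\<dots> = (\<integral>\<^sup>+ x. \<integral>\<^sup>+ y. F1 x y \<partial>?M \<partial>?M) + (\<integral>\<^sup>+ x. \<integral>\<^sup>+ y. F2 x y \<partial>?M \<partial>?M)"
    by (intro nn_integral_add M.borel_measurable_nn_integral F1 F2)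
  also have "(\<integral>\<^sup>+ x. \<integral>\<^sup>+ y. F1 x y \<partial>?M \<partial>?M) = ennreal (2 powr p * 5 powr \<alpha> / K) * gagliardo_energy s p \<Omega> u"
  proof -
    let ?g = "\<lambda>x y. ennreal (\<bar>u x - u y\<bar> powr p / norm (x - y) powr \<alpha>)"
    have g: "case_prod ?g \<in> borel_measurable (?M \<Otimes>\<^sub>M ?M)"
      unfolding case_prod_beta by (rule G)
    have "(\<integral>\<^sup>+ x. \<integral>\<^sup>+ y. F1 x y \<partial>?M \<partial>?M) = (\<integral>\<^sup>+ x. ennreal (2 powr p * 5 powr \<alpha> / K) * (\<integral>\<^sup>+ y. ?g x y \<partial>?M) \<partial>?M)"
      unfolding F1_def using measurable_Pair2[OF g] by (intro nn_integral_cong nn_integral_cmult) (simp only: case_prod_conv)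
    also have "\<dots> = ennreal (2 powr p * 5 powr \<alpha> / K) * gagliardo_energy s p \<Omega> u"
      unfolding gagliardo_energy_def \<alpha>[symmetric] by (intro nn_integral_cmult M.borel_measurable_nn_integral g)
    finally show ?thesis .
  qed
  also have "(\<integral>\<^sup>+ x. \<integral>\<^sup>+ y. F2 x y \<partial>?M \<partial>?M) = (\<integral>\<^sup>+ y. \<integral>\<^sup>+ x. F2 x y \<partial>?M \<partial>?M)"
    by (rule MM.Fubini'[OF F2, symmetric])
  also have "\<dots> \<le> (\<integral>\<^sup>+ y. ennreal (2 powr p * 2 powr \<alpha> * ?V * (10 / \<kappa>) ^ DIM('a) / c1 * \<theta> powr (s * p - q)) *
        ennreal (\<bar>u y\<bar> powr p / ?\<delta> y powr (s * p)) \<partial>?M)"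
    unfolding F2_def by (intro nn_integral_mono dual) simp
  also have "\<dots> = ennreal (2 powr p * 2 powr \<alpha> * ?V * (10 / \<kappa>) ^ DIM('a) / c1 * \<theta> powr (s * p - q)) * hardy_energy s p \<Omega> u"
    unfolding hardy_energy_def
  proof (rule nn_integral_cmult)
    have [measurable]: "(\<lambda>y. ?\<delta> y) \<in> borel_measurable ?M"
      by (intro measurable_restrict_space1 measurable_completion) (simp add: borel_measurable_continuous_onI continuous_on_infdist)
    show "(\<lambda>y. ennreal (\<bar>u y\<bar> powr p / ?\<delta> y powr (s * p))) \<in> borel_measurable ?M" by measurable
  qed
  finally show ?thesis
    by (simp add: K_def add_left_mono)
qed

lemma ennreal_absorb_half:
  fixes g h :: ennreal
  assumes "h < \<infinity>" "h \<le> g + ennreal (1 / 2) * h"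
  shows "h \<le> 2 * g"
proof (cases g)
  case (real b)
  obtain a where a: "0 \<le> a" "h = ennreal a"
    using assms(1) by (cases h) auto
  have "ennreal (b + 1 / 2 * a) = ennreal b + ennreal (1 / 2) * ennreal a"
    using a real by (subst ennreal_plus) (auto simp only: ennreal_mult' zero_le_mult_iff)
  then have "ennreal a \<le> ennreal (b + 1 / 2 * a)"
    using assms(2) a real by simp
  then have "a \<le> 2 * b"
    using a real by (subst (asm) ennreal_le_iff) auto
  then have "ennreal a \<le> ennreal (2 * b)"
    by (rule ennreal_leI)
  then show ?thesis
    using a real by (simp add: ennreal_mult)
qed (simp add: ennreal_mult_top)

lemma hardy_inequality:
  fixes \<Omega> :: "'a::euclidean_space set"
  assumes \<Omega>: "bounded \<Omega>" "open \<Omega>" "plump \<kappa> \<Omega>" and thick: "thick c q (frontier \<Omega>)" and c: "0 < c"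
    and sp: "0 < s" "0 < p" "q < s * p"
  obtains C where "0 \<le> C"
    "\<And>u. u \<in> borel_measurable (lebesgue_on \<Omega>) \<Longrightarrow> hardy_energy s p \<Omega> u < \<infinity> \<Longrightarrow>
       hardy_energy s p \<Omega> u \<le> ennreal C * gagliardo_energy s p \<Omega> u"
proof -
  have \<kappa>: "0 < \<kappa>" using \<Omega>(3) by (simp add: plump_def)
  define \<alpha> where "\<alpha> = real DIM('a) + s * p"
  define c1 where "c1 = c * unit_ball_vol (real DIM('a)) * (\<kappa> / 6) ^ DIM('a)"
  have c1: "0 < c1" using c \<kappa> by (simp add: c1_def)
  define B where "B = 2 powr p * 2 powr \<alpha> * unit_ball_vol (real DIM('a)) * (10 / \<kappa>) ^ DIM('a) / c1"
  have B: "0 < B" using c1 \<kappa> by (simp add: B_def)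
  have "((\<lambda>\<theta>. B * \<theta> powr (s * p - q)) \<longlongrightarrow> B * 0) (at_right 0)"
    using sp by (intro tendsto_intros tendsto_zero_powrI[where b = "s * p - q"])
      (auto simp: eventually_at_right_less intro: eventually_mono[OF eventually_at_right_less])
  then have "eventually (\<lambda>\<theta>. B * \<theta> powr (s * p - q) < 1 / 2) (at_right 0)"
    by (rule order_tendstoD) simp
  moreover have "eventually (\<lambda>\<theta>::real. \<theta> \<in> {0<..<1}) (at_right 0)"
    by (rule eventually_at_right_real) simp
  ultimately have "eventually (\<lambda>\<theta>. B * \<theta> powr (s * p - q) < 1 / 2 \<and> \<theta> \<in> {0<..<1}) (at_right 0)"
    by (rule eventually_conj)
  then obtain \<theta> where \<theta>: "B * \<theta> powr (s * p - q) < 1 / 2" "0 < \<theta>" "\<theta> < 1"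
    using eventually_happens'[OF trivial_limit_at_right_real] by fastforce
  define A where "A = 2 powr p * 5 powr \<alpha> / (c1 * \<theta> powr q)"
  have A: "0 \<le> A" using c1 by (simp add: A_def)
  show ?thesis
  proof (rule that[of "2 * A"])
    fix u :: "'a \<Rightarrow> real"
    assume u: "u \<in> borel_measurable (lebesgue_on \<Omega>)" and fin: "hardy_energy s p \<Omega> u < \<infinity>"
    let ?H = "hardy_energy s p \<Omega> u" and ?G = "gagliardo_energy s p \<Omega> u"
    have "?H \<le> ennreal A * ?G + ennreal (B * \<theta> powr (s * p - q)) * ?H"
      using hardy_energy_recursion[OF \<Omega> thick c \<theta>(2,3) sp(1,2) u c1_def \<alpha>_def] by (simp add: A_def B_def)
    also have "\<dots> \<le> ennreal A * ?G + ennreal (1 / 2) * ?H"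
      using \<theta>(1) by (intro add_left_mono mult_right_mono ennreal_leI) auto
    finally have H: "?H \<le> ennreal A * ?G + ennreal (1 / 2) * ?H" .
    show "?H \<le> ennreal (2 * A) * ?G"
      using ennreal_absorb_half[OF fin H] A by (simp add: ennreal_mult' mult.assoc)
  qed (use A in simp)
qed

section \<open>Limits of test functions\<close>

lemma test_functions_continuous:
  "\<phi> \<in> test_functions \<Omega> \<Longrightarrow> continuous_on UNIV \<phi>"
  unfolding test_functions_def using cont_diff.simps(1) by blast

lemma hardy_energy_test_function_finite:
  fixes \<Omega> :: "'a::euclidean_space set"
  assumes \<Omega>: "bounded \<Omega>" "open \<Omega>" and \<phi>: "\<phi> \<in> test_functions \<Omega>" and sp: "0 < s" "0 < p"
  shows "hardy_energy s p \<Omega> \<phi> < \<infinity>"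
proof -
  let ?K = "closure {x. \<phi> x \<noteq> 0}" and ?\<delta> = "\<lambda>x. infdist x (frontier \<Omega>)"
  have K: "compact ?K" "?K \<subseteq> \<Omega>"
    using \<phi> by (auto simp: test_functions_def)
  have pos: "0 < ?\<delta> x" if "x \<in> ?K" for x
    using K that infdist_frontier_pos[OF \<Omega>] by blast
  have "continuous_on ?K (\<lambda>x. \<bar>\<phi> x\<bar> powr p / ?\<delta> x powr (s * p))"
    using continuous_on_subset[OF test_functions_continuous[OF \<phi>]] pos sp
    by (intro continuous_intros continuous_on_powr') (auto simp: less_imp_neq less_imp_neq[symmetric])
  then have "bounded ((\<lambda>x. \<bar>\<phi> x\<bar> powr p / ?\<delta> x powr (s * p)) ` ?K)"
    by (intro compact_imp_bounded compact_continuous_image K)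
  then obtain b where b: "\<And>x. x \<in> ?K \<Longrightarrow> \<bar>\<bar>\<phi> x\<bar> powr p / ?\<delta> x powr (s * p)\<bar> \<le> b"
    unfolding bounded_iff by auto
  have "\<bar>\<phi> x\<bar> powr p / ?\<delta> x powr (s * p) \<le> max b 0" for x
  proof (cases "x \<in> ?K")
    case True
    then show ?thesis using b[of x] by simp
  next
    case False
    then have "\<phi> x = 0" using closure_subset[of "{x. \<phi> x \<noteq> 0}"] by auto
    then show ?thesis by simp
  qed
  then have "hardy_energy s p \<Omega> \<phi> \<le> (\<integral>\<^sup>+ x. ennreal (max b 0) \<partial>lebesgue_on \<Omega>)"
    unfolding hardy_energy_def by (intro nn_integral_mono ennreal_leI)
  also have "\<dots> < \<infinity>"
    using finite_measure.emeasure_finite[OF finite_measure_lebesgue_on[OF lmeasurable_open[OF \<Omega>]], of \<Omega>]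
    by (simp add: ennreal_mult_less_top less_top space_restrict_space)
  finally show ?thesis .
qed

text \<open>The Hardy weight is bounded where \<open>\<delta> \<ge> t\<close>, so there the integral of \<open>f\<close> differs from that of a
  test function by a multiple of the \<open>L\<^sup>p\<close> distance. Choosing the test function according to \<open>t\<close>
  gives a bound independent of \<open>t\<close>, which passes to the limit by monotone convergence.\<close>
lemma hardy_energy_finite_of_approximable:
  fixes \<Omega> :: "'a::euclidean_space set"
  assumes \<Omega>: "bounded \<Omega>" "open \<Omega>" and sp: "0 < s" "0 < p"
    and hardy: "\<And>\<phi>. \<phi> \<in> test_functions \<Omega> \<Longrightarrow> hardy_energy s p \<Omega> \<phi> \<le> ennreal C * gagliardo_energy s p \<Omega> \<phi>"
    and f: "f \<in> frac_sobolev_0 s p \<Omega>"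
  shows "hardy_energy s p \<Omega> f < \<infinity>"
proof -
  let ?\<delta> = "\<lambda>x. infdist x (frontier \<Omega>)" and ?M = "lebesgue_on \<Omega>"
  have f_meas[measurable]: "f \<in> borel_measurable ?M" and gag: "gagliardo_energy s p \<Omega> f < \<infinity>"
    using f by (auto simp: frac_sobolev_0_def frac_sobolev_iff)
  have [measurable]: "?\<delta> \<in> borel_measurable ?M"
    by (intro measurable_lebesgue_on_continuous continuous_intros)
  define B where "B = ennreal (2 powr p) * (1 + ennreal C * (ennreal (2 powr p) * (gagliardo_energy s p \<Omega> f + 1)))"
  have B: "B < \<infinity>"
    using gag by (simp add: B_def ennreal_mult_less_top)
  define F where "F n x = (if 1 / real (Suc n) \<le> ?\<delta> x then ennreal (\<bar>f x\<bar> powr p / ?\<delta> x powr (s * p)) else 0)" for n x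
  have F_meas[measurable]: "F n \<in> borel_measurable ?M" for n
    unfolding F_def by measurable
  have F_bound: "(\<integral>\<^sup>+ x. F n x \<partial>?M) \<le> B" for n
  proof -
    define t where "t = 1 / real (Suc n)"
    have t: "0 < t" by (simp add: t_def)
    \<comment> \<open>This \<open>e\<close> offsets the bound \<open>t\<^sup>-\<^sup>s\<^sup>p\<close> of the Hardy weight, and keeps the seminorm of the error at most one.\<close>
    define e where "e = min 1 (t powr s)"
    have e: "0 < e" "e powr p \<le> 1" "e powr p \<le> t powr (s * p)"
    proof -
      show "0 < e" using t by (simp add: e_def)
      then show "e powr p \<le> 1" using sp by (simp add: e_def powr_le1)
      have "e powr p \<le> (t powr s) powr p"
        using sp t by (intro powr_mono2) (auto simp: e_def)
      then show "e powr p \<le> t powr (s * p)" by (simp add: powr_powr)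
    qed
    obtain \<phi> where \<phi>: "\<phi> \<in> test_functions \<Omega>" "frac_sobolev_norm s p \<Omega> (\<lambda>x. f x - \<phi> x) < ennreal e"
      using f e(1) unfolding frac_sobolev_0_def by blast
    have \<phi>_meas[measurable]: "\<phi> \<in> borel_measurable ?M"
      using test_functions_continuous[OF \<phi>(1)] by (rule measurable_lebesgue_on_continuous)
    have lp: "lp_energy p \<Omega> (\<lambda>x. f x - \<phi> x) \<le> ennreal (t powr (s * p))"
      using less_frac_sobolev_norm(1)[OF sp(2) e(1) \<phi>(2)] e(3) by (meson ennreal_leI less_imp_le order_trans)
    have "gagliardo_energy s p \<Omega> (\<lambda>x. f x - \<phi> x) \<le> ennreal 1"
      using less_frac_sobolev_norm(2)[OF sp(2) e(1) \<phi>(2)] e(2) by (meson ennreal_leI less_imp_le order_trans)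
    then have gag': "gagliardo_energy s p \<Omega> (\<lambda>x. \<phi> x - f x) \<le> 1"
      by (simp add: gagliardo_energy_minus_commute[of s p \<Omega> \<phi> f])
    have "gagliardo_energy s p \<Omega> (\<lambda>x. f x + (\<phi> x - f x)) \<le> ennreal (2 powr p) * (gagliardo_energy s p \<Omega> f + gagliardo_energy s p \<Omega> (\<lambda>x. \<phi> x - f x))"
      using sp by (intro gagliardo_energy_add_le \<Omega>) auto
    also have "\<dots> \<le> ennreal (2 powr p) * (gagliardo_energy s p \<Omega> f + 1)"
      using gag' by (intro mult_left_mono add_left_mono) auto
    finally have gag_\<phi>: "gagliardo_energy s p \<Omega> \<phi> \<le> ennreal (2 powr p) * (gagliardo_energy s p \<Omega> f + 1)"
      by simp
    have "F n x \<le> ennreal (2 powr p) * (ennreal (t powr - (s * p)) * ennreal (\<bar>f x - \<phi> x\<bar> powr p) + ennreal (\<bar>\<phi> x\<bar> powr p / ?\<delta> x powr (s * p)))" for x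
    proof (cases "t \<le> ?\<delta> x")
      case True
      have "\<bar>f x\<bar> powr p \<le> 2 powr p * (\<bar>f x - \<phi> x\<bar> powr p + \<bar>\<phi> x\<bar> powr p)"
        using abs_add_powr_le[of p "f x - \<phi> x" "\<phi> x"] sp by simp
      then have "\<bar>f x\<bar> powr p / ?\<delta> x powr (s * p) \<le> 2 powr p * (\<bar>f x - \<phi> x\<bar> powr p + \<bar>\<phi> x\<bar> powr p) / ?\<delta> x powr (s * p)"
        by (intro divide_right_mono) auto
      also have "\<dots> = 2 powr p * (?\<delta> x powr - (s * p) * \<bar>f x - \<phi> x\<bar> powr p + \<bar>\<phi> x\<bar> powr p / ?\<delta> x powr (s * p))"
        by (simp add: powr_minus_divide add_divide_distrib distrib_left)
      also have "?\<delta> x powr - (s * p) \<le> t powr - (s * p)"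
        using True t sp by (intro powr_mono2') auto
      finally have "\<bar>f x\<bar> powr p / ?\<delta> x powr (s * p) \<le> 2 powr p * (t powr - (s * p) * \<bar>f x - \<phi> x\<bar> powr p + \<bar>\<phi> x\<bar> powr p / ?\<delta> x powr (s * p))"
        by (simp add: mult_right_mono)
      then have "ennreal (\<bar>f x\<bar> powr p / ?\<delta> x powr (s * p)) \<le> ennreal (2 powr p * (t powr - (s * p) * \<bar>f x - \<phi> x\<bar> powr p + \<bar>\<phi> x\<bar> powr p / ?\<delta> x powr (s * p)))"
        by (rule ennreal_leI)
      then show ?thesis
        using True by (simp add: F_def t_def ennreal_mult' ennreal_plus)
    qed (simp add: F_def t_def)
    then have "(\<integral>\<^sup>+ x. F n x \<partial>?M) \<le> (\<integral>\<^sup>+ x. ennreal (2 powr p) * (ennreal (t powr - (s * p)) * ennreal (\<bar>f x - \<phi> x\<bar> powr p) + ennreal (\<bar>\<phi> x\<bar> powr p / ?\<delta> x powr (s * p))) \<partial>?M)"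
      by (intro nn_integral_mono)
    also have "\<dots> = ennreal (2 powr p) * (ennreal (t powr - (s * p)) * lp_energy p \<Omega> (\<lambda>x. f x - \<phi> x) + hardy_energy s p \<Omega> \<phi>)"
      by (simp add: nn_integral_cmult nn_integral_add lp_energy_def hardy_energy_def)
    also have "\<dots> \<le> ennreal (2 powr p) * (ennreal (t powr - (s * p)) * ennreal (t powr (s * p)) + ennreal C * (ennreal (2 powr p) * (gagliardo_energy s p \<Omega> f + 1)))"
      using lp order_trans[OF hardy[OF \<phi>(1)] mult_left_mono[OF gag_\<phi>]] by (intro mult_left_mono add_mono) auto
    also have "ennreal (t powr - (s * p)) * ennreal (t powr (s * p)) = 1"
      using t by (simp add: ennreal_mult'[symmetric] powr_minus)
    finally show ?thesis by (simp add: B_def)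
  qed
  have "hardy_energy s p \<Omega> f \<le> (\<integral>\<^sup>+ x. (SUP n. F n x) \<partial>?M)"
    unfolding hardy_energy_def
  proof (rule nn_integral_mono)
    fix x assume "x \<in> space ?M"
    then have "0 < ?\<delta> x"
      using infdist_frontier_pos[OF \<Omega>] by simp
    then obtain n where "inverse (real (Suc n)) < ?\<delta> x"
      using reals_Archimedean by blast
    then have "ennreal (\<bar>f x\<bar> powr p / ?\<delta> x powr (s * p)) = F n x"
      by (simp add: F_def inverse_eq_divide)
    also have "\<dots> \<le> (SUP n. F n x)"
      by (rule SUP_upper) simp
    finally show "ennreal (\<bar>f x\<bar> powr p / ?\<delta> x powr (s * p)) \<le> (SUP n. F n x)" .
  qed
  also have "\<dots> = (SUP n. \<integral>\<^sup>+ x. F n x \<partial>?M)"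
  proof (rule nn_integral_monotone_convergence_SUP)
    have "F n x \<le> F (Suc n) x" for n x
    proof -
      have "1 / real (Suc (Suc n)) \<le> 1 / real (Suc n)"
        by (intro divide_left_mono) auto
      then show ?thesis by (auto simp: F_def)
    qed
    then show "incseq F"
      by (intro incseq_SucI le_funI)
  qed measurable
  also have "\<dots> \<le> B"
    by (rule SUP_least) (rule F_bound)
  finally show ?thesis
    using B by (rule le_less_trans)
qed

section \<open>Smooth bumps\<close>

text \<open>The functions \<open>exp (-1/t) / t\<^sup>n\<close> extended by zero: their span is closed under differentiation,
  which makes \<open>exp (-1/t)\<close> smooth across \<open>0\<close>.\<close>
definition flat_exp :: "nat \<Rightarrow> real \<Rightarrow> real" where
  "flat_exp n t = (if 0 < t then exp (- (1 / t)) / t ^ n else 0)"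

lemma flat_exp_tendsto_0: "((\<lambda>t. flat_exp n t) \<longlongrightarrow> 0) (at 0)"
proof -
  have "((\<lambda>u::real. u ^ n / exp u) \<longlongrightarrow> 0) at_top"
    by (rule tendsto_power_div_exp_0)
  then have "((\<lambda>t::real. (inverse t) ^ n / exp (inverse t)) \<longlongrightarrow> 0) (at_right 0)"
    by (rule filterlim_compose[OF _ filterlim_inverse_at_top_right])
  moreover have "eventually (\<lambda>t::real. (inverse t) ^ n / exp (inverse t) = flat_exp n t) (at_right 0)"
    using eventually_at_right_less[of "0::real"]
    by eventually_elim (simp add: flat_exp_def exp_minus field_simps)
  ultimately have "(flat_exp n \<longlongrightarrow> 0) (at_right 0)"
    by (rule Lim_transform_eventually)
  moreover have "(flat_exp n \<longlongrightarrow> 0) (at_left 0)"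
  proof (rule Lim_transform_eventually[OF tendsto_const])
    show "eventually (\<lambda>t. 0 = flat_exp n t) (at_left 0)"
      by (auto simp: eventually_at_filter flat_exp_def intro!: always_eventually)
  qed
  ultimately show ?thesis
    by (simp add: filterlim_split_at)
qed

text \<open>At \<open>0\<close> the difference quotient of the function with index \<open>n\<close> is the function with index \<open>n + 1\<close>.\<close>
lemma flat_exp_deriv:
  "(flat_exp n has_real_derivative (flat_exp (n + 2) t - real n * flat_exp (n + 1) t)) (at t)"
proof -
  consider "0 < t" | "t < 0" | "t = 0" by linarith
  then show ?thesis
  proof cases
    case 1
    have "((\<lambda>t. exp (- (1 / t)) / t ^ n) has_real_derivative
        (exp (- (1 / t)) * (1 / t\<^sup>2) * t ^ n - exp (- (1 / t)) * (real n * t ^ (n - 1))) / (t ^ n * t ^ n)) (at t)"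
      using 1 by (auto intro!: derivative_eq_intros simp: power2_eq_square)
    also have "(exp (- (1 / t)) * (1 / t\<^sup>2) * t ^ n - exp (- (1 / t)) * (real n * t ^ (n - 1))) / (t ^ n * t ^ n)
      = flat_exp (n + 2) t - real n * flat_exp (n + 1) t"
      using 1 by (cases n) (simp_all add: flat_exp_def field_simps power2_eq_square)
    finally show ?thesis
      by (rule has_field_derivative_transform_within_open[where S = "{0<..}"]) (use 1 in \<open>auto simp: flat_exp_def\<close>)
  next
    case 2
    have "((\<lambda>t. 0) has_real_derivative 0) (at t)" by simp
    then have "(flat_exp n has_real_derivative 0) (at t)"
      by (rule has_field_derivative_transform_within_open[where S = "{..<0}"]) (use 2 in \<open>auto simp: flat_exp_def\<close>)
    then show ?thesis using 2 by (simp add: flat_exp_def)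
  next
    case 3
    have "flat_exp (n + 1) t = (flat_exp n t - flat_exp n 0) / (t - 0)" for t
      by (simp add: flat_exp_def)
    with flat_exp_tendsto_0[of "n + 1"] have "(flat_exp n has_real_derivative 0) (at 0)"
      by (simp add: has_field_derivative_iff)
    then show ?thesis using 3 by (simp add: flat_exp_def)
  qed
qed

text \<open>An algebra of functions that contains the bump \<open>exp (-1 / (1 - a |x|\<^sup>2))\<close> and is closed under
  directional derivatives; the remaining generators are those that the chain and product rules produce.\<close>
inductive_set bump_algebra :: "real \<Rightarrow> ('a::euclidean_space \<Rightarrow> real) set" for a where
  flat: "(\<lambda>x. flat_exp n (1 - a * (x \<bullet> x))) \<in> bump_algebra a"
| coord: "(\<lambda>x. x \<bullet> v) \<in> bump_algebra a"
| const: "(\<lambda>x. c) \<in> bump_algebra a"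
| add: "f \<in> bump_algebra a \<Longrightarrow> g \<in> bump_algebra a \<Longrightarrow> (\<lambda>x. f x + g x) \<in> bump_algebra a"
| mult: "f \<in> bump_algebra a \<Longrightarrow> g \<in> bump_algebra a \<Longrightarrow> (\<lambda>x. f x * g x) \<in> bump_algebra a"

lemma bump_algebra_derivative:
  assumes "f \<in> bump_algebra a"
  shows "\<exists>D. (\<forall>x. (f has_derivative (\<lambda>v. D v x)) (at x)) \<and> (\<forall>v. D v \<in> bump_algebra a)"
  using assms
proof induction
  case (flat n)
  let ?t = "\<lambda>x :: 'a. 1 - a * (x \<bullet> x)"
  let ?D = "\<lambda>v (x :: 'a). (flat_exp (n + 2) (?t x) + (- real n) * flat_exp (n + 1) (?t x)) * ((- 2 * a) * (x \<bullet> v))"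
  have "((\<lambda>x. flat_exp n (?t x)) has_derivative (\<lambda>v. ?D v x)) (at x)" for x
  proof -
    have "(?t has_derivative (\<lambda>v. (- 2 * a) * (x \<bullet> v))) (at x)"
      by (auto intro!: derivative_eq_intros simp: inner_commute algebra_simps)
    then have "((\<lambda>x. flat_exp n (?t x)) has_derivative (\<lambda>v. (flat_exp (n + 2) (?t x) - real n * flat_exp (n + 1) (?t x)) * ((- 2 * a) * (x \<bullet> v)))) (at x)"
      using flat_exp_deriv[unfolded has_field_derivative_def] by (rule has_derivative_compose)
    then show ?thesis by simp
  qed
  moreover have "?D v \<in> bump_algebra a" for v
    by (intro bump_algebra.intros)
  ultimately show ?case by (intro exI[of _ ?D]) blast
next
  case (coord v)
  show ?case
    by (rule exI[of _ "\<lambda>w x. w \<bullet> v"]) (auto intro!: derivative_eq_intros bump_algebra.intros)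
next
  case (const c)
  show ?case
    by (rule exI[of _ "\<lambda>w x. 0"]) (auto intro!: derivative_eq_intros bump_algebra.intros)
next
  case (add f g)
  then obtain D E where D: "\<And>x. (f has_derivative (\<lambda>v. D v x)) (at x)" "\<And>v. D v \<in> bump_algebra a"
    and E: "\<And>x. (g has_derivative (\<lambda>v. E v x)) (at x)" "\<And>v. E v \<in> bump_algebra a"
    by blast
  show ?case
    by (rule exI[of _ "\<lambda>v x. D v x + E v x"]) (auto intro!: derivative_intros D E bump_algebra.intros)
next
  case (mult f g)
  then obtain D E where D: "\<And>x. (f has_derivative (\<lambda>v. D v x)) (at x)" "\<And>v. D v \<in> bump_algebra a"
    and E: "\<And>x. (g has_derivative (\<lambda>v. E v x)) (at x)" "\<And>v. E v \<in> bump_algebra a"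
    by blast
  show ?case
    by (rule exI[of _ "\<lambda>v x. f x * E v x + D v x * g x"])
      (auto intro!: has_derivative_mult D E bump_algebra.intros mult)
qed

text \<open>Closure under directional derivatives turns differentiability into smoothness of every order.\<close>
lemma bump_algebra_cont_diff:
  "f \<in> bump_algebra a \<Longrightarrow> cont_diff k f"
proof (induction k arbitrary: f)
  case 0
  obtain D where D: "\<And>x. (f has_derivative (\<lambda>v. D v x)) (at x)"
    using bump_algebra_derivative[OF 0] by blast
  then show ?case
    by (auto intro: has_derivative_continuous continuous_at_imp_continuous_on)
next
  case (Suc k)
  obtain D where D: "\<And>x. (f has_derivative (\<lambda>v. D v x)) (at x)" "\<And>v. D v \<in> bump_algebra a"
    using bump_algebra_derivative[OF Suc.prems] by blast
  have "frechet_derivative f (at x) = (\<lambda>v. D v x)" for x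
    using frechet_derivative_at[OF D(1)] by simp
  then have "(\<lambda>x. frechet_derivative f (at x) v) = D v" for v
    by simp
  with Suc.IH[OF D(2)] D(1) show ?case
    by (auto simp: differentiable_def)
qed

section \<open>Convolution with a smooth kernel\<close>

definition smooth_kernel :: "real \<Rightarrow> ('a::euclidean_space \<Rightarrow> real) set" where
  "smooth_kernel r = {\<psi>. (\<forall>k. cont_diff k \<psi>) \<and> (\<forall>x. r < norm x \<longrightarrow> \<psi> x = 0)}"

lemma smooth_kernel_continuous: "\<psi> \<in> smooth_kernel r \<Longrightarrow> continuous_on UNIV \<psi>"
  unfolding smooth_kernel_def using cont_diff.simps(1) by blast

lemma smooth_kernel_has_derivative:
  assumes "\<psi> \<in> smooth_kernel r"
  shows "(\<psi> has_derivative frechet_derivative \<psi> (at x)) (at x)"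
proof -
  have "cont_diff (Suc 0) \<psi>"
    using assms by (simp add: smooth_kernel_def)
  then show ?thesis
    by (simp add: frechet_derivative_works)
qed

lemma smooth_kernel_directional_derivative:
  assumes "\<psi> \<in> smooth_kernel r"
  shows "(\<lambda>x. frechet_derivative \<psi> (at x) v) \<in> smooth_kernel r"
proof -
  have "cont_diff k (\<lambda>x. frechet_derivative \<psi> (at x) v)" for k
  proof -
    have "cont_diff (Suc k) \<psi>"
      using assms by (simp only: smooth_kernel_def mem_Collect_eq)
    then show ?thesis by simp
  qed
  moreover have "frechet_derivative \<psi> (at x) v = 0" if x: "r < norm x" for x
  proof -
    have "open {x :: 'a. r < norm x}"
      by (intro open_Collect_less continuous_intros)
    moreover have "((\<lambda>x :: 'a. 0) has_derivative (\<lambda>v. 0 :: real)) (at x)"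
      by simp
    ultimately have "(\<psi> has_derivative (\<lambda>v. 0)) (at x)"
      using assms x by (elim has_derivative_transform_within_open) (auto simp: smooth_kernel_def)
    then show ?thesis
      using frechet_derivative_at by metis
  qed
  ultimately show ?thesis
    by (simp add: smooth_kernel_def)
qed

lemma smooth_kernel_uniformly_continuous:
  assumes \<psi>: "\<psi> \<in> smooth_kernel r"
  shows "uniformly_continuous_on UNIV \<psi>"
  unfolding uniformly_continuous_on_def
proof (intro allI impI)
  fix e :: real assume e: "0 < e"
  have "uniformly_continuous_on (cball 0 (r + 1)) \<psi>"
    by (intro compact_uniformly_continuous continuous_on_subset[OF smooth_kernel_continuous[OF \<psi>]]) auto
  then obtain d where d: "0 < d" "\<And>x y. x \<in> cball 0 (r + 1) \<Longrightarrow> y \<in> cball 0 (r + 1) \<Longrightarrow> dist y x < d \<Longrightarrow> dist (\<psi> y) (\<psi> x) < e"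
    using e unfolding uniformly_continuous_on_def by metis
  have "dist (\<psi> y) (\<psi> x) < e" if yx: "dist y x < min d 1" for x y
  proof (cases "norm x \<le> r \<or> norm y \<le> r")
    case True
    moreover have "norm x \<le> norm y + 1" "norm y \<le> norm x + 1"
      using yx norm_triangle_ineq2[of x y] norm_triangle_ineq2[of y x] by (auto simp: dist_norm norm_minus_commute)
    ultimately show ?thesis
      using yx by (intro d) auto
  next
    case False
    then show ?thesis using \<psi> e by (simp add: smooth_kernel_def)
  qed
  then show "\<exists>d>0. \<forall>x\<in>UNIV. \<forall>x'\<in>UNIV. dist x' x < d \<longrightarrow> dist (\<psi> x') (\<psi> x) < e"
    using d(1) by (intro exI[of _ "min d 1"]) auto
qed

lemma smooth_kernel_bounded:
  assumes \<psi>: "\<psi> \<in> smooth_kernel r"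
  obtains b where "0 \<le> b" "\<And>x. \<bar>\<psi> x\<bar> \<le> b"
proof -
  have "bounded (\<psi> ` cball 0 r)"
    by (intro compact_imp_bounded compact_continuous_image continuous_on_subset[OF smooth_kernel_continuous[OF \<psi>]]) auto
  then obtain b where "\<forall>v\<in>\<psi> ` cball 0 r. norm v \<le> b"
    unfolding bounded_iff by blast
  then have b: "\<bar>\<psi> x\<bar> \<le> b" if "x \<in> cball 0 r" for x
    using that by fastforce
  have "\<bar>\<psi> x\<bar> \<le> max b 0" for x
    using b[of x] \<psi> by (cases "norm x \<le> r") (auto simp: smooth_kernel_def)
  then show ?thesis by (intro that[of "max b 0"]) auto
qed

text \<open>The directional derivatives are continuous with compact support, hence uniformly continuous; the
  mean value inequality applied to \<open>\<psi>\<close> minus its linearization at \<open>z\<close> carries this over to \<open>\<psi>\<close>. Uniformity in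
  \<open>z\<close> is what allows differentiation under the integral against a merely integrable function.\<close>
lemma smooth_kernel_uniformly_differentiable:
  fixes \<psi> :: "'a::euclidean_space \<Rightarrow> real"
  assumes \<psi>: "\<psi> \<in> smooth_kernel r" and e: "0 < e"
  obtains d where "0 < d"
    "\<And>z h. norm h < d \<Longrightarrow> \<bar>\<psi> (z + h) - \<psi> z - frechet_derivative \<psi> (at z) h\<bar> \<le> e * norm h"
proof -
  let ?D = "\<lambda>b x. frechet_derivative \<psi> (at x) b"
  define e' where "e' = e / real DIM('a)"
  have e': "0 < e'" using e by (simp add: e'_def)
  have "\<exists>d>0. \<forall>x y. dist x y < d \<longrightarrow> \<bar>?D b x - ?D b y\<bar> < e'" if "b \<in> Basis" for b
    using smooth_kernel_uniformly_continuous[OF smooth_kernel_directional_derivative[OF \<psi>, of b]] e'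
    unfolding uniformly_continuous_on_def dist_real_def by (metis UNIV_I)
  then obtain d where d: "\<And>b. b \<in> Basis \<Longrightarrow> 0 < d b"
    "\<And>b x y. b \<in> Basis \<Longrightarrow> dist x y < d b \<Longrightarrow> \<bar>?D b x - ?D b y\<bar> < e'"
    by metis
  define d0 where "d0 = Min (d ` Basis)"
  have d0: "0 < d0" "\<And>b. b \<in> Basis \<Longrightarrow> d0 \<le> d b"
    using d(1) by (auto simp: d0_def)
  show ?thesis
  proof (rule that[OF d0(1)])
    fix z h :: 'a assume h: "norm h < d0"
    let ?g = "\<lambda>w. \<psi> w - frechet_derivative \<psi> (at z) w"
    have lin: "linear (frechet_derivative \<psi> (at w))" for w
      using smooth_kernel_has_derivative[OF \<psi>] has_derivative_linear by blast
    have "norm (?g (z + h) - ?g z) \<le> e * norm (z + h - z)"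
    proof (rule differentiable_bound[where S = "ball z d0" and f' = "\<lambda>w v. frechet_derivative \<psi> (at w) v - frechet_derivative \<psi> (at z) v"])
      fix w assume w: "w \<in> ball z d0"
      have "bounded_linear (frechet_derivative \<psi> (at z))"
        using lin linear_conv_bounded_linear by blast
      then show "(?g has_derivative (\<lambda>v. frechet_derivative \<psi> (at w) v - frechet_derivative \<psi> (at z) v)) (at w within ball z d0)"
        by (intro has_derivative_at_withinI[OF has_derivative_diff] smooth_kernel_has_derivative[OF \<psi>] bounded_linear_imp_has_derivative)
      show "onorm (\<lambda>v. frechet_derivative \<psi> (at w) v - frechet_derivative \<psi> (at z) v) \<le> e"
      proof (rule onorm_bound)
        fix v :: 'a
        have "frechet_derivative \<psi> (at u) v = (\<Sum>b\<in>Basis. (v \<bullet> b) * ?D b u)" for u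
        proof -
          have "frechet_derivative \<psi> (at u) v = frechet_derivative \<psi> (at u) (\<Sum>b\<in>Basis. (v \<bullet> b) *\<^sub>R b)"
            by (simp add: euclidean_representation)
          also have "\<dots> = (\<Sum>b\<in>Basis. (v \<bullet> b) * ?D b u)"
            by (simp add: linear_sum[OF lin] linear_cmul[OF lin])
          finally show ?thesis .
        qed
        then have "norm (frechet_derivative \<psi> (at w) v - frechet_derivative \<psi> (at z) v)
          = \<bar>\<Sum>b\<in>Basis. (v \<bullet> b) * (?D b w - ?D b z)\<bar>"
          by (simp add: sum_subtractf right_diff_distrib)
        also have "\<dots> \<le> (\<Sum>b\<in>Basis. \<bar>(v \<bullet> b) * (?D b w - ?D b z)\<bar>)"
          by (rule sum_abs)
        also have "\<dots> \<le> (\<Sum>b\<in>(Basis :: 'a set). norm v * e')"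
        proof (rule sum_mono)
          fix b :: 'a assume b: "b \<in> Basis"
          have "dist w z < d b"
            using w d0(2)[OF b] by (simp add: dist_commute)
          then have "\<bar>?D b w - ?D b z\<bar> \<le> e'"
            using d(2)[OF b] by (meson less_imp_le)
          then show "\<bar>(v \<bullet> b) * (?D b w - ?D b z)\<bar> \<le> norm v * e'"
            unfolding abs_mult using Basis_le_norm[OF b] by (intro mult_mono) auto
        qed
        also have "\<dots> = e * norm v"
          by (simp add: e'_def)
        finally show "norm (frechet_derivative \<psi> (at w) v - frechet_derivative \<psi> (at z) v) \<le> e * norm v" .
      qed (use e in simp)
    qed (use h d0 in \<open>auto simp: dist_norm\<close>)
    then show "\<bar>\<psi> (z + h) - \<psi> z - frechet_derivative \<psi> (at z) h\<bar> \<le> e * norm h"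
      by (simp add: linear_add[OF lin])
  qed
qed

definition mollify :: "('a::euclidean_space \<Rightarrow> real) \<Rightarrow> ('a \<Rightarrow> real) \<Rightarrow> 'a \<Rightarrow> real" where
  "mollify \<psi> g x = (\<integral>y. \<psi> (x - y) * g y \<partial>lborel)"

lemma mollify_integrable:
  fixes \<psi> :: "'a::euclidean_space \<Rightarrow> real"
  assumes \<psi>: "\<psi> \<in> smooth_kernel r" and g: "integrable lborel g"
  shows "integrable lborel (\<lambda>y. \<psi> (x - y) * g y)"
proof -
  obtain b where b: "0 \<le> b" "\<And>x. \<bar>\<psi> x\<bar> \<le> b"
    using smooth_kernel_bounded[OF \<psi>] by blast
  have [measurable]: "\<psi> \<in> borel_measurable borel"
    using smooth_kernel_continuous[OF \<psi>] by (rule borel_measurable_continuous_onI)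
  have [measurable]: "g \<in> borel_measurable borel"
    using g by auto
  show ?thesis
  proof (rule Bochner_Integration.integrable_bound)
    show "integrable lborel (\<lambda>y. b * g y)" using g by simp
    show "AE y in lborel. norm (\<psi> (x - y) * g y) \<le> norm (b * g y)"
      using b by (auto simp: abs_mult intro!: mult_right_mono)
  qed measurable
qed

lemma mollify_has_derivative:
  fixes \<psi> :: "'a::euclidean_space \<Rightarrow> real"
  assumes \<psi>: "\<psi> \<in> smooth_kernel r" and g: "integrable lborel g"
  shows "(mollify \<psi> g has_derivative (\<lambda>v. mollify (\<lambda>x. frechet_derivative \<psi> (at x) v) g x)) (at x)"
proof -
  let ?D = "\<lambda>z v. frechet_derivative \<psi> (at z) v"
  have lin: "linear (frechet_derivative \<psi> (at w))" for w
    using smooth_kernel_has_derivative[OF \<psi>] has_derivative_linear by blast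
  note int = mollify_integrable[OF \<psi> g]
  have intD: "integrable lborel (\<lambda>y. ?D (x - y) v * g y)" for v
    using mollify_integrable[OF smooth_kernel_directional_derivative[OF \<psi>] g] .
  have "linear (\<lambda>v. mollify (\<lambda>x. ?D x v) g x)"
  proof (rule linearI)
    fix v w c
    show "mollify (\<lambda>x. ?D x (v + w)) g x = mollify (\<lambda>x. ?D x v) g x + mollify (\<lambda>x. ?D x w) g x"
      unfolding mollify_def using intD
      by (subst Bochner_Integration.integral_add[symmetric]) (auto simp: linear_add[OF lin] distrib_right)
    show "mollify (\<lambda>x. ?D x (c *\<^sub>R v)) g x = c *\<^sub>R mollify (\<lambda>x. ?D x v) g x"
      unfolding mollify_def by (simp add: linear_cmul[OF lin] mult.assoc)
  qed
  then have bl: "bounded_linear (\<lambda>v. mollify (\<lambda>x. ?D x v) g x)"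
    by (simp add: linear_conv_bounded_linear)
  define I where "I = (\<integral>y. \<bar>g y\<bar> \<partial>lborel)"
  have I: "0 \<le> I" by (simp add: I_def)
  show ?thesis
    unfolding has_derivative_at_alt
  proof (intro conjI bl allI impI)
    fix e :: real assume e: "0 < e"
    define e' where "e' = e / (I + 1)"
    have e': "0 < e'" "e' * I \<le> e"
      using e I by (auto simp: e'_def field_simps)
    obtain d where d: "0 < d" "\<And>z h. norm h < d \<Longrightarrow> \<bar>\<psi> (z + h) - \<psi> z - ?D z h\<bar> \<le> e' * norm h"
      using smooth_kernel_uniformly_differentiable[OF \<psi> e'(1)] by blast
    have "norm (mollify \<psi> g y - mollify \<psi> g x - mollify (\<lambda>z. ?D z (y - x)) g x) \<le> e * norm (y - x)"
      if y: "norm (y - x) < d" for y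
    proof -
      let ?R = "\<lambda>t. \<psi> ((x - t) + (y - x)) - \<psi> (x - t) - ?D (x - t) (y - x)"
      have "mollify \<psi> g y - mollify \<psi> g x - mollify (\<lambda>z. ?D z (y - x)) g x
        = (\<integral>t. \<psi> (y - t) * g t - \<psi> (x - t) * g t - ?D (x - t) (y - x) * g t \<partial>lborel)"
        unfolding mollify_def using int intD by simp
      also have "\<dots> = (\<integral>t. ?R t * g t \<partial>lborel)"
        by (intro Bochner_Integration.integral_cong) (auto simp: algebra_simps)
      finally have eq: "mollify \<psi> g y - mollify \<psi> g x - mollify (\<lambda>z. ?D z (y - x)) g x = (\<integral>t. ?R t * g t \<partial>lborel)" .
      have "norm (\<integral>t. ?R t * g t \<partial>lborel) \<le> (\<integral>t. norm (?R t * g t) \<partial>lborel)"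
        by simp
      also have "\<dots> \<le> (\<integral>t. e' * norm (y - x) * \<bar>g t\<bar> \<partial>lborel)"
      proof (rule integral_mono)
        have "integrable lborel (\<lambda>t. \<psi> (y - t) * g t - \<psi> (x - t) * g t - ?D (x - t) (y - x) * g t)"
          using int intD by simp
        then show "integrable lborel (\<lambda>t. norm (?R t * g t))"
          by (intro integrable_norm) (simp add: algebra_simps)
        show "integrable lborel (\<lambda>t. e' * norm (y - x) * \<bar>g t\<bar>)"
          using g by simp
        show "norm (?R t * g t) \<le> e' * norm (y - x) * \<bar>g t\<bar>" for t
          using d(2)[OF y, of "x - t"] by (simp add: abs_mult mult_right_mono)
      qed
      also have "\<dots> = e' * I * norm (y - x)"
        by (simp add: I_def)
      also have "\<dots> \<le> e * norm (y - x)"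
        using e' by (intro mult_right_mono) auto
      finally show ?thesis unfolding eq .
    qed
    then show "\<exists>d>0. \<forall>y. norm (y - x) < d \<longrightarrow> norm (mollify \<psi> g y - mollify \<psi> g x - mollify (\<lambda>z. ?D z (y - x)) g x) \<le> e * norm (y - x)"
      using d(1) by blast
  qed
qed

text \<open>A directional derivative of the convolution is the convolution with the derivative of the kernel,
  which is again a smooth kernel.\<close>
lemma mollify_cont_diff:
  assumes g: "integrable lborel g"
  shows "\<psi> \<in> smooth_kernel r \<Longrightarrow> cont_diff k (mollify \<psi> g)"
proof (induction k arbitrary: \<psi>)
  case 0
  then show ?case
    using mollify_has_derivative[OF 0 g]
    by (auto intro: has_derivative_continuous continuous_at_imp_continuous_on)
next
  case (Suc k)
  note D = mollify_has_derivative[OF Suc.prems g]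
  have "frechet_derivative (mollify \<psi> g) (at x) = (\<lambda>v. mollify (\<lambda>x. frechet_derivative \<psi> (at x) v) g x)" for x
    using frechet_derivative_at[OF D] by simp
  then have "(\<lambda>x. frechet_derivative (mollify \<psi> g) (at x) v) = mollify (\<lambda>x. frechet_derivative \<psi> (at x) v) g" for v
    by (simp add: fun_eq_iff)
  with Suc.IH[OF smooth_kernel_directional_derivative[OF Suc.prems]] D show ?case
    by (auto simp: differentiable_def)
qed

text \<open>The bound on \<open>\<psi>\<close> has a constant independent of \<open>e\<close>: the bump is at most \<open>1\<close> and
  is at least \<open>exp (-4/3)\<close> on the ball of radius \<open>e/2\<close>, so its integral is comparable to \<open>e\<^sup>d\<close>.\<close>
lemma mollifier_exists:
  obtains C :: real where "0 < C"
    "\<And>e. 0 < e \<Longrightarrow> \<exists>\<psi>\<in>smooth_kernel e. (\<forall>x::'a::euclidean_space. 0 \<le> \<psi> x \<and> \<psi> x \<le> C / e powr real DIM('a)) \<and>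
       integrable lborel \<psi> \<and> (\<integral>x. \<psi> x \<partial>lborel) = 1"
proof -
  define V where "V = unit_ball_vol (real DIM('a))"
  have V: "0 < V" by (simp add: V_def)
  \<comment> \<open>The reciprocal of \<open>exp (-4/3)\<close> times the volume of the ball of radius \<open>1/2\<close>.\<close>
  define C where "C = exp (4 / 3) * 2 ^ DIM('a) / V"
  show ?thesis
  proof (rule that[of C])
    show "0 < C" using V by (simp add: C_def)
    fix e :: real assume e: "0 < e"
    define b where "b x = flat_exp 0 (1 - (1 / e\<^sup>2) * (x \<bullet> x))" for x :: 'a
    have b_alg: "b \<in> bump_algebra (1 / e\<^sup>2)"
      unfolding b_def by (rule bump_algebra.flat)
    have b01: "0 \<le> b x" "b x \<le> 1" for x
      by (auto simp: b_def flat_exp_def)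
    have b0: "b x = 0" if "e < norm x" for x
    proof -
      have "e\<^sup>2 < (norm x)\<^sup>2"
        using that e by (intro power_strict_mono) auto
      then show ?thesis
        using e by (simp add: b_def flat_exp_def power2_norm_eq_inner field_simps)
    qed
    have b_low: "exp (- (4 / 3)) \<le> b x" if "norm x < e / 2" for x
    proof -
      have "(norm x)\<^sup>2 \<le> (e / 2)\<^sup>2"
        using that by (intro power_mono) auto
      then have *: "3 / 4 \<le> 1 - (1 / e\<^sup>2) * (x \<bullet> x)"
        using e by (simp add: power2_norm_eq_inner field_simps)
      then have "1 / (1 - (1 / e\<^sup>2) * (x \<bullet> x)) \<le> 1 / (3 / 4)"
        by (intro divide_left_mono) auto
      moreover have "0 < 1 - (1 / e\<^sup>2) * (x \<bullet> x)"
        using * by linarith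
      ultimately show ?thesis
        unfolding b_def flat_exp_def by simp
    qed
    have [measurable]: "b \<in> borel_measurable borel"
      using bump_algebra_cont_diff[OF b_alg, of 0] by (simp add: borel_measurable_continuous_onI)
    have ball_int: "integrable lborel (indicator (cball (0 :: 'a) e) :: 'a \<Rightarrow> real)"
      by (simp add: emeasure_cball e less_imp_le)
    have b_int: "integrable lborel b"
    proof (rule Bochner_Integration.integrable_bound[OF ball_int])
      show "AE x in lborel. norm (b x) \<le> norm (indicator (cball 0 e) x :: real)"
        using b0 b01 by (intro AE_I2) (auto simp: indicator_def not_le)
    qed measurable
    define Z where "Z = (\<integral>x. b x \<partial>lborel)"
    have "(\<integral>x. exp (- (4 / 3)) * indicator (ball (0 :: 'a) (e / 2)) x \<partial>lborel) \<le> Z"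
      unfolding Z_def
    proof (rule integral_mono[OF _ b_int])
      show "integrable lborel (\<lambda>x. exp (- (4 / 3)) * indicator (ball (0 :: 'a) (e / 2)) x :: real)"
        using e by (simp add: emeasure_ball)
    qed (use b01 b_low in \<open>auto simp: indicator_def\<close>)
    moreover have "(\<integral>x. exp (- (4 / 3)) * indicator (ball (0 :: 'a) (e / 2)) x \<partial>lborel) = exp (- (4 / 3)) * (V * (e / 2) ^ DIM('a))"
      using e by (simp add: content_ball V_def)
    ultimately have Z_low: "exp (- (4 / 3)) * (V * (e / 2) ^ DIM('a)) \<le> Z" by simp
    have low_pos: "0 < exp (- (4 / 3)) * (V * (e / 2) ^ DIM('a))"
      using V e by simp
    have Z: "0 < Z" using Z_low low_pos by linarith
    define \<psi> where "\<psi> x = (1 / Z) * b x" for x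
    have "\<psi> \<in> bump_algebra (1 / e\<^sup>2)"
      unfolding \<psi>_def using b_alg by (intro bump_algebra.mult bump_algebra.const)
    then have "\<psi> \<in> smooth_kernel e"
      using bump_algebra_cont_diff b0 by (auto simp: smooth_kernel_def \<psi>_def)
    moreover have "\<psi> x \<le> C / e powr real DIM('a)" for x
    proof -
      have "\<psi> x \<le> 1 / Z"
        using b01 Z by (simp add: \<psi>_def divide_right_mono)
      also have "\<dots> \<le> 1 / (exp (- (4 / 3)) * (V * (e / 2) ^ DIM('a)))"
        using Z_low low_pos by (intro divide_left_mono) auto
      also have "\<dots> = C / e powr real DIM('a)"
        using V e by (simp add: C_def powr_realpow exp_minus power_divide field_simps)
      finally show ?thesis .
    qed
    moreover have "0 \<le> \<psi> x" for x
      using b01 Z by (simp add: \<psi>_def)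
    moreover have "integrable lborel \<psi>" "(\<integral>x. \<psi> x \<partial>lborel) = 1"
      using b_int Z by (simp_all add: \<psi>_def[abs_def] Z_def[symmetric])
    ultimately show "\<exists>\<psi>\<in>smooth_kernel e. (\<forall>x::'a. 0 \<le> \<psi> x \<and> \<psi> x \<le> C / e powr real DIM('a)) \<and>
       integrable lborel \<psi> \<and> (\<integral>x. \<psi> x \<partial>lborel) = 1"
      by blast
  qed
qed

section \<open>Mollification in the fractional seminorm\<close>

lemma lborel_eq_distr_isometry:
  fixes t :: "'a::euclidean_space"
  assumes "\<bar>c\<bar> = 1"
  shows "distr lborel borel (\<lambda>x. t + c *\<^sub>R x) = (lborel :: 'a measure)"
proof -
  have "c \<noteq> 0" using assms by auto
  from lborel_affine[OF this, of t] show ?thesis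
    using assms by (simp add: density_1)
qed

lemma nn_integral_lborel_isometry:
  fixes t :: "'a::euclidean_space"
  assumes "\<bar>c\<bar> = 1" and [measurable]: "F \<in> borel_measurable borel"
  shows "(\<integral>\<^sup>+ x. F (t + c *\<^sub>R x) \<partial>lborel) = (\<integral>\<^sup>+ x. F x \<partial>lborel)"
  by (subst (2) lborel_eq_distr_isometry[OF assms(1), of t, symmetric]) (simp add: nn_integral_distr)

lemma integral_lborel_isometry:
  fixes t :: "'a::euclidean_space" and F :: "'a \<Rightarrow> real"
  assumes "\<bar>c\<bar> = 1" and [measurable]: "F \<in> borel_measurable borel"
  shows "(\<integral>x. F (t + c *\<^sub>R x) \<partial>lborel) = (\<integral>x. F x \<partial>lborel)"
  by (subst (2) lborel_eq_distr_isometry[OF assms(1), of t, symmetric]) (simp add: integral_distr)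

lemma powr_above_tangent:
  fixes a t p :: real
  assumes p: "1 \<le> p" and a: "0 < a" and t: "0 \<le> t"
  shows "a powr p + p * a powr (p - 1) * (t - a) \<le> t powr p"
proof (cases "t = 0")
  case True
  have "a powr p = a powr (p - 1) * a"
    using a by (simp add: powr_diff)
  moreover have "a powr (p - 1) * a \<le> p * (a powr (p - 1) * a)"
    using p a by simp
  ultimately show ?thesis
    using True by (simp add: algebra_simps)
next
  case False
  have "t powr p - a powr p \<ge> p * a powr (p - 1) * (t - a)"
  proof (rule convex_on_imp_above_tangent[where A = "{0<..}"])
    show "convex_on {0<..} (\<lambda>x. x powr p)"
      using p by (rule powr_convex)
    show "((\<lambda>x. x powr p) has_field_derivative p * a powr (p - 1)) (at a within {0<..})"
      using a by (auto intro!: derivative_eq_intros)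
  qed (use a t False in \<open>auto simp: interior_open\<close>)
  then show ?thesis by simp
qed

text \<open>Jensen's inequality for \<open>t \<mapsto> t\<^sup>p\<close>, by integrating the tangent line at the mean of \<open>|u|\<close>. The right-hand
  side may be infinite.\<close>
lemma weighted_jensen_powr:
  fixes w u :: "'a::euclidean_space \<Rightarrow> real"
  assumes p: "1 \<le> p" and [measurable]: "w \<in> borel_measurable borel" "u \<in> borel_measurable borel"
    and w: "\<And>x. 0 \<le> w x" "integrable lborel w" "(\<integral>x. w x \<partial>lborel) = 1"
    and wu: "integrable lborel (\<lambda>x. w x * u x)"
  shows "ennreal (\<bar>\<integral>x. w x * u x \<partial>lborel\<bar> powr p) \<le> (\<integral>\<^sup>+ x. ennreal (w x * \<bar>u x\<bar> powr p) \<partial>lborel)"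
proof (cases "integrable lborel (\<lambda>x. w x * \<bar>u x\<bar> powr p)")
  case False
  then have "(\<integral>\<^sup>+ x. ennreal (w x * \<bar>u x\<bar> powr p) \<partial>lborel) = \<infinity>"
    using w(1) by (subst (asm) integrable_iff_bounded) (auto simp: less_top[symmetric])
  then show ?thesis by simp
next
  case True
  define A where "A = (\<integral>x. w x * \<bar>u x\<bar> \<partial>lborel)"
  have wu': "integrable lborel (\<lambda>x. w x * \<bar>u x\<bar>)"
    using integrable_abs[OF wu] w(1) by (simp add: abs_mult)
  have A: "0 \<le> A" using w(1) by (simp add: A_def)
  have "\<bar>\<integral>x. w x * u x \<partial>lborel\<bar> \<le> (\<integral>x. \<bar>w x * u x\<bar> \<partial>lborel)"
    by simp
  also have "\<dots> = A"
    using w(1) by (simp add: A_def abs_mult)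
  finally have "\<bar>\<integral>x. w x * u x \<partial>lborel\<bar> powr p \<le> A powr p"
    using p by (intro powr_mono2) auto
  also have "A powr p \<le> (\<integral>x. w x * \<bar>u x\<bar> powr p \<partial>lborel)"
  proof (cases "A = 0")
    case True
    then show ?thesis using w(1) p by (simp add: integral_nonneg_AE)
  next
    case False
    then have A: "0 < A" using A by simp
    have int: "integrable lborel (\<lambda>x. (A powr p - p * A powr (p - 1) * A) * w x + p * A powr (p - 1) * (w x * \<bar>u x\<bar>))"
      using w wu' by simp
    have "(\<integral>x. (A powr p - p * A powr (p - 1) * A) * w x + p * A powr (p - 1) * (w x * \<bar>u x\<bar>) \<partial>lborel)
      = (A powr p - p * A powr (p - 1) * A) * 1 + p * A powr (p - 1) * A"
      using w wu' by (simp add: A_def)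
    then have "A powr p = (\<integral>x. (A powr p - p * A powr (p - 1) * A) * w x + p * A powr (p - 1) * (w x * \<bar>u x\<bar>) \<partial>lborel)"
      by simp
    also have "\<dots> \<le> (\<integral>x. w x * \<bar>u x\<bar> powr p \<partial>lborel)"
    proof (rule integral_mono[OF int \<open>integrable lborel (\<lambda>x. w x * \<bar>u x\<bar> powr p)\<close>])
      fix x
      have "w x * (A powr p + p * A powr (p - 1) * (\<bar>u x\<bar> - A)) \<le> w x * \<bar>u x\<bar> powr p"
        using p A w(1) by (intro mult_left_mono powr_above_tangent) auto
      then show "(A powr p - p * A powr (p - 1) * A) * w x + p * A powr (p - 1) * (w x * \<bar>u x\<bar>) \<le> w x * \<bar>u x\<bar> powr p"
        by (simp add: algebra_simps)
    qed
    finally show ?thesis .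
  qed
  finally have "ennreal (\<bar>\<integral>x. w x * u x \<partial>lborel\<bar> powr p) \<le> ennreal (\<integral>x. w x * \<bar>u x\<bar> powr p \<partial>lborel)"
    by (rule ennreal_leI)
  also have "\<dots> = (\<integral>\<^sup>+ x. ennreal (w x * \<bar>u x\<bar> powr p) \<partial>lborel)"
    using True w(1) by (intro nn_integral_eq_integral[symmetric]) auto
  finally show ?thesis .
qed

text \<open>All estimates for mollification pass through this function of the displacement, because
  mollification averages displacements.\<close>
definition shift_energy :: "real \<Rightarrow> ('a::euclidean_space \<Rightarrow> real) \<Rightarrow> 'a \<Rightarrow> ennreal" where
  "shift_energy p g k = (\<integral>\<^sup>+ x. ennreal (\<bar>g (x + k) - g x\<bar> powr p) \<partial>lborel)"

text \<open>The part of the seminorm integral over the whole space that comes from pairs at distance less than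
  \<open>\<tau>\<close>, with the displacement as outer variable (see \<open>local_gagliardo_iterated\<close>).\<close>
definition local_gagliardo :: "real \<Rightarrow> real \<Rightarrow> real \<Rightarrow> ('a::euclidean_space \<Rightarrow> real) \<Rightarrow> ennreal" where
  "local_gagliardo \<alpha> p \<tau> g =
     (\<integral>\<^sup>+ k. (if norm k < \<tau> then ennreal (norm k powr - \<alpha>) else 0) * shift_energy p g k \<partial>lborel)"

lemma shift_energy_measurable:
  fixes g :: "'a::euclidean_space \<Rightarrow> real"
  assumes [measurable]: "g \<in> borel_measurable borel"
  shows "shift_energy p g \<in> borel_measurable borel"
proof -
  have "(\<lambda>k. \<integral>\<^sup>+ x. ennreal (\<bar>g (x + k) - g x\<bar> powr p) \<partial>lborel) \<in> borel_measurable lborel"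
    by (rule lborel.borel_measurable_nn_integral) measurable
  then show ?thesis
    by (simp add: shift_energy_def[abs_def])
qed

lemma shift_energy_zero: "shift_energy p g 0 = 0"
  by (simp add: shift_energy_def)

lemma shift_energy_shift:
  fixes g :: "'a::euclidean_space \<Rightarrow> real"
  assumes [measurable]: "g \<in> borel_measurable borel"
  shows "(\<integral>\<^sup>+ x. ennreal (\<bar>g (t + x + k) - g (t + x)\<bar> powr p) \<partial>lborel) = shift_energy p g k"
  unfolding shift_energy_def
  using nn_integral_lborel_isometry[of 1 "\<lambda>x. ennreal (\<bar>g (x + k) - g x\<bar> powr p)" t] by simp

lemma local_gagliardo_iterated:
  fixes g :: "'a::euclidean_space \<Rightarrow> real"
  assumes [measurable]: "g \<in> borel_measurable borel"
  shows "(\<integral>\<^sup>+ x. \<integral>\<^sup>+ y. (if norm (x - y) < \<tau> then ennreal (\<bar>g x - g y\<bar> powr p / norm (x - y) powr \<alpha>) else 0) \<partial>lborel \<partial>lborel)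
    = local_gagliardo \<alpha> p \<tau> g"
proof -
  let ?w = "\<lambda>k. if norm k < \<tau> then ennreal (norm k powr - \<alpha>) else 0"
  have "(\<integral>\<^sup>+ y. (if norm (x - y) < \<tau> then ennreal (\<bar>g x - g y\<bar> powr p / norm (x - y) powr \<alpha>) else 0) \<partial>lborel)
    = (\<integral>\<^sup>+ k. ?w k * ennreal (\<bar>g (x + k) - g x\<bar> powr p) \<partial>lborel)" for x
  proof -
    let ?F = "\<lambda>y. if norm (x - y) < \<tau> then ennreal (\<bar>g x - g y\<bar> powr p / norm (x - y) powr \<alpha>) else 0"
    have "(\<integral>\<^sup>+ y. ?F y \<partial>lborel) = (\<integral>\<^sup>+ k. ?F (x + 1 *\<^sub>R k) \<partial>lborel)"
      by (rule nn_integral_lborel_isometry[symmetric]) (simp, measurable)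
    also have "\<dots> = (\<integral>\<^sup>+ k. ?w k * ennreal (\<bar>g (x + k) - g x\<bar> powr p) \<partial>lborel)"
      by (intro nn_integral_cong) (simp add: ennreal_mult'[symmetric] powr_minus_divide abs_minus_commute)
    finally show ?thesis .
  qed
  then have "(\<integral>\<^sup>+ x. \<integral>\<^sup>+ y. (if norm (x - y) < \<tau> then ennreal (\<bar>g x - g y\<bar> powr p / norm (x - y) powr \<alpha>) else 0) \<partial>lborel \<partial>lborel)
    = (\<integral>\<^sup>+ x. \<integral>\<^sup>+ k. ?w k * ennreal (\<bar>g (x + k) - g x\<bar> powr p) \<partial>lborel \<partial>lborel)"
    by simp
  also have "\<dots> = (\<integral>\<^sup>+ k. \<integral>\<^sup>+ x. ?w k * ennreal (\<bar>g (x + k) - g x\<bar> powr p) \<partial>lborel \<partial>lborel)"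
    by (rule lborel_pair.Fubini'[symmetric]) measurable
  also have "\<dots> = local_gagliardo \<alpha> p \<tau> g"
    unfolding local_gagliardo_def shift_energy_def
    by (intro nn_integral_cong nn_integral_cmult) measurable
  finally show ?thesis .
qed

text \<open>The domains of integration shrink to \<open>{0}\<close>.\<close>
lemma local_gagliardo_tendsto_0:
  fixes g :: "'a::euclidean_space \<Rightarrow> real"
  assumes [measurable]: "g \<in> borel_measurable borel" and a: "0 < a"
    and fin: "local_gagliardo \<alpha> p a g < \<infinity>"
  shows "(\<lambda>n. local_gagliardo \<alpha> p (a / real (Suc n)) g) \<longlonglongrightarrow> 0"
proof -
  note [measurable] = shift_energy_measurable[OF assms(1)]
  let ?F = "\<lambda>\<tau> k :: 'a. (if norm k < \<tau> then ennreal (norm k powr - \<alpha>) else 0) * shift_energy p g k"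
  have "(\<lambda>n. \<integral>\<^sup>+ k. ?F (a / real (Suc n)) k \<partial>lborel) \<longlonglongrightarrow> (\<integral>\<^sup>+ (k :: 'a). 0 \<partial>lborel)"
  proof (rule nn_integral_dominated_convergence[where w = "?F a"])
    have "a / real (Suc n) \<le> a" for n
      using a by (simp add: field_simps)
    then show "AE k in lborel. ?F (a / real (Suc n)) k \<le> ?F a k" for n
      by (intro AE_I2 mult_right_mono) (auto dest: less_le_trans)
    show "(\<integral>\<^sup>+ k. ?F a k \<partial>lborel) < \<infinity>"
      using fin by (simp add: local_gagliardo_def)
    show "AE k in lborel. (\<lambda>n. ?F (a / real (Suc n)) k) \<longlonglongrightarrow> 0"
    proof (rule AE_I2)
      fix k :: 'a
      show "(\<lambda>n. ?F (a / real (Suc n)) k) \<longlonglongrightarrow> 0"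
      proof (cases "k = 0")
        case True
        then show ?thesis by (simp add: shift_energy_zero)
      next
        case False
        have "(\<lambda>n. a / real (Suc n)) \<longlonglongrightarrow> 0"
          using tendsto_mult[OF tendsto_const LIMSEQ_inverse_real_of_nat, of a] by (simp add: divide_inverse)
        then have "eventually (\<lambda>n. a / real (Suc n) < norm k) sequentially"
          using False by (intro order_tendstoD) auto
        then have "eventually (\<lambda>n. ?F (a / real (Suc n)) k = 0) sequentially"
          by eventually_elim simp
        then show ?thesis by (rule tendsto_eventually)
      qed
    qed
  qed measurable
  then show ?thesis by (simp add: local_gagliardo_def)
qed

locale mollifier =
  fixes \<psi> :: "'a::euclidean_space \<Rightarrow> real" and e :: real
  assumes kernel: "\<psi> \<in> smooth_kernel e" and nonneg: "\<And>x. 0 \<le> \<psi> x"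
    and integrable: "integrable lborel \<psi>" and total: "(\<integral>x. \<psi> x \<partial>lborel) = 1"
begin

lemma measurable_kernel [measurable]: "\<psi> \<in> borel_measurable borel"
  using smooth_kernel_continuous[OF kernel] by (rule borel_measurable_continuous_onI)

lemma nn_total: "(\<integral>\<^sup>+ x. ennreal (\<psi> x) \<partial>lborel) = 1"
  using nn_integral_eq_integral[OF integrable] nonneg total by simp

lemma mollify_reflect:
  assumes g[measurable]: "integrable lborel g"
  shows "mollify \<psi> g x = (\<integral>h. \<psi> h * g (x - h) \<partial>lborel)" "integrable lborel (\<lambda>h. \<psi> h * g (x - h))"
proof -
  have [measurable]: "g \<in> borel_measurable borel" using g by auto
  show "mollify \<psi> g x = (\<integral>h. \<psi> h * g (x - h) \<partial>lborel)"
    unfolding mollify_def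
    using integral_lborel_isometry[of "-1" "\<lambda>y. \<psi> (x - y) * g y" x] by simp
  have "(\<integral>\<^sup>+ h. ennreal (norm (\<psi> h * g (x - h))) \<partial>lborel) = (\<integral>\<^sup>+ y. ennreal (norm (\<psi> (x - y) * g y)) \<partial>lborel)"
    using nn_integral_lborel_isometry[of "-1" "\<lambda>y. ennreal (norm (\<psi> (x - y) * g y))" x] by simp
  also have "\<dots> < \<infinity>"
    using mollify_integrable[OF kernel g, of x] by (simp add: integrable_iff_bounded)
  finally show "integrable lborel (\<lambda>h. \<psi> h * g (x - h))"
    by (subst integrable_iff_bounded) auto
qed

text \<open>The difference of the mollification is the mollification of the difference, to which Jensen's
  inequality applies.\<close>
lemma mollify_shift_le:
  assumes p: "1 \<le> p" and g: "integrable lborel g"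
  shows "ennreal (\<bar>mollify \<psi> g (x + k) - mollify \<psi> g x\<bar> powr p)
    \<le> (\<integral>\<^sup>+ h. ennreal (\<psi> h * \<bar>g (x + k - h) - g (x - h)\<bar> powr p) \<partial>lborel)"
proof -
  have [measurable]: "g \<in> borel_measurable borel" using g by auto
  have int: "integrable lborel (\<lambda>h. \<psi> h * (g (x + k - h) - g (x - h)))"
    using mollify_reflect(2)[OF g] by (simp add: right_diff_distrib)
  have eq: "mollify \<psi> g (x + k) - mollify \<psi> g x = (\<integral>h. \<psi> h * (g (x + k - h) - g (x - h)) \<partial>lborel)"
    using mollify_reflect[OF g] by (simp add: right_diff_distrib)
  show ?thesis
    unfolding eq by (rule weighted_jensen_powr[OF p _ _ nonneg integrable total int]) measurable
qed

text \<open>Integrating the pointwise bound, each translate of \<open>g\<close> contributes the same energy, with total weight one.\<close>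
lemma shift_energy_mollify_le:
  assumes p: "1 \<le> p" and g: "integrable lborel g"
  shows "shift_energy p (mollify \<psi> g) k \<le> shift_energy p g k"
proof -
  have [measurable]: "g \<in> borel_measurable borel" using g by auto
  have "shift_energy p (mollify \<psi> g) k
    \<le> (\<integral>\<^sup>+ x. \<integral>\<^sup>+ h. ennreal (\<psi> h) * ennreal (\<bar>g (- h + x + k) - g (- h + x)\<bar> powr p) \<partial>lborel \<partial>lborel)"
    unfolding shift_energy_def
  proof (rule nn_integral_mono)
    fix x
    show "ennreal (\<bar>mollify \<psi> g (x + k) - mollify \<psi> g x\<bar> powr p)
      \<le> (\<integral>\<^sup>+ h. ennreal (\<psi> h) * ennreal (\<bar>g (- h + x + k) - g (- h + x)\<bar> powr p) \<partial>lborel)"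
      using mollify_shift_le[OF p g, of x k] by (simp add: ennreal_mult' nonneg algebra_simps)
  qed
  also have "\<dots> = (\<integral>\<^sup>+ h. \<integral>\<^sup>+ x. ennreal (\<psi> h) * ennreal (\<bar>g (- h + x + k) - g (- h + x)\<bar> powr p) \<partial>lborel \<partial>lborel)"
    by (rule lborel_pair.Fubini'[symmetric]) measurable
  also have "\<dots> = (\<integral>\<^sup>+ h. ennreal (\<psi> h) * shift_energy p g k \<partial>lborel)"
  proof (rule nn_integral_cong)
    fix h
    have "(\<integral>\<^sup>+ x. ennreal (\<psi> h) * ennreal (\<bar>g (- h + x + k) - g (- h + x)\<bar> powr p) \<partial>lborel)
      = ennreal (\<psi> h) * (\<integral>\<^sup>+ x. ennreal (\<bar>g (- h + x + k) - g (- h + x)\<bar> powr p) \<partial>lborel)"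
      by (rule nn_integral_cmult) measurable
    then show "(\<integral>\<^sup>+ x. ennreal (\<psi> h) * ennreal (\<bar>g (- h + x + k) - g (- h + x)\<bar> powr p) \<partial>lborel) = ennreal (\<psi> h) * shift_energy p g k"
      by (subst (asm) shift_energy_shift) simp_all
  qed
  also have "\<dots> = shift_energy p g k"
    by (simp add: nn_integral_multc nn_total)
  finally show ?thesis .
qed

lemma local_gagliardo_mollify_le:
  assumes p: "1 \<le> p" and g: "integrable lborel g"
  shows "local_gagliardo \<alpha> p \<tau> (mollify \<psi> g) \<le> local_gagliardo \<alpha> p \<tau> g"
  unfolding local_gagliardo_def
  by (intro nn_integral_mono mult_left_mono shift_energy_mollify_le assms) simp

text \<open>By Jensen's inequality the left-hand side is at most \<open>\<integral> \<psi>(h) D(h) dh\<close>, where \<open>D\<close> is the shift energy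
  of \<open>g\<close>. Since \<open>\<psi>\<close> vanishes outside the ball of radius \<open>e\<close>, its weight is at most \<open>b e\<^sup>\<alpha> |h|\<^sup>-\<^sup>\<alpha>\<close>.
  With \<open>b\<close> of order \<open>e\<^sup>-\<^sup>d\<close> and \<open>\<alpha> = d + sp\<close> the factor \<open>b e\<^sup>\<alpha>\<close> is of order \<open>e\<^sup>s\<^sup>p\<close>.\<close>
lemma mollify_lp_distance:
  assumes p: "1 \<le> p" and g: "integrable lborel g" and e: "0 < e" "e < \<tau>" and \<alpha>: "0 \<le> \<alpha>"
    and b: "\<And>x. \<psi> x \<le> b"
  shows "(\<integral>\<^sup>+ x. ennreal (\<bar>g x - mollify \<psi> g x\<bar> powr p) \<partial>lborel) \<le> ennreal (b * e powr \<alpha>) * local_gagliardo \<alpha> p \<tau> g"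
proof -
  have [measurable]: "g \<in> borel_measurable borel" using g by auto
  note [measurable] = shift_energy_measurable[of g p]
  have b0: "0 \<le> b" using b nonneg order_trans by blast
  have "(\<integral>\<^sup>+ x. ennreal (\<bar>g x - mollify \<psi> g x\<bar> powr p) \<partial>lborel)
    \<le> (\<integral>\<^sup>+ x. \<integral>\<^sup>+ h. ennreal (\<psi> h) * ennreal (\<bar>g (- h + x + h) - g (- h + x)\<bar> powr p) \<partial>lborel \<partial>lborel)"
  proof (rule nn_integral_mono)
    fix x
    have int: "integrable lborel (\<lambda>h. \<psi> h * (g x - g (x - h)))"
      using mollify_reflect(2)[OF g, of x] integrable by (simp add: right_diff_distrib)
    have eq: "g x - mollify \<psi> g x = (\<integral>h. \<psi> h * (g x - g (x - h)) \<partial>lborel)"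
      using mollify_reflect[OF g, of x] integrable total by (simp add: right_diff_distrib)
    have "ennreal (\<bar>g x - mollify \<psi> g x\<bar> powr p) \<le> (\<integral>\<^sup>+ h. ennreal (\<psi> h * \<bar>g x - g (x - h)\<bar> powr p) \<partial>lborel)"
      unfolding eq by (rule weighted_jensen_powr[OF p _ _ nonneg integrable total int]) measurable
    then show "ennreal (\<bar>g x - mollify \<psi> g x\<bar> powr p)
      \<le> (\<integral>\<^sup>+ h. ennreal (\<psi> h) * ennreal (\<bar>g (- h + x + h) - g (- h + x)\<bar> powr p) \<partial>lborel)"
      by (simp add: ennreal_mult' nonneg algebra_simps)
  qed
  also have "\<dots> = (\<integral>\<^sup>+ h. \<integral>\<^sup>+ x. ennreal (\<psi> h) * ennreal (\<bar>g (- h + x + h) - g (- h + x)\<bar> powr p) \<partial>lborel \<partial>lborel)"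
    by (rule lborel_pair.Fubini'[symmetric]) measurable
  also have "\<dots> = (\<integral>\<^sup>+ h. ennreal (\<psi> h) * shift_energy p g h \<partial>lborel)"
  proof (rule nn_integral_cong)
    fix h
    have "(\<integral>\<^sup>+ x. ennreal (\<psi> h) * ennreal (\<bar>g (- h + x + h) - g (- h + x)\<bar> powr p) \<partial>lborel)
      = ennreal (\<psi> h) * (\<integral>\<^sup>+ x. ennreal (\<bar>g (- h + x + h) - g (- h + x)\<bar> powr p) \<partial>lborel)"
      by (rule nn_integral_cmult) measurable
    then show "(\<integral>\<^sup>+ x. ennreal (\<psi> h) * ennreal (\<bar>g (- h + x + h) - g (- h + x)\<bar> powr p) \<partial>lborel) = ennreal (\<psi> h) * shift_energy p g h"
      by (subst (asm) shift_energy_shift) simp_all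
  qed
  also have "\<dots> \<le> (\<integral>\<^sup>+ h. ennreal (b * e powr \<alpha>) * ((if norm h < \<tau> then ennreal (norm h powr - \<alpha>) else 0) * shift_energy p g h) \<partial>lborel)"
  proof (rule nn_integral_mono)
    fix h :: 'a
    consider "h = 0" | "e < norm h" | "0 < norm h" "norm h \<le> e" by fastforce
    then show "ennreal (\<psi> h) * shift_energy p g h
      \<le> ennreal (b * e powr \<alpha>) * ((if norm h < \<tau> then ennreal (norm h powr - \<alpha>) else 0) * shift_energy p g h)"
    proof cases
      case 1
      then show ?thesis by (simp add: shift_energy_zero)
    next
      case 2
      then show ?thesis using kernel by (simp add: smooth_kernel_def)
    next
      case 3
      have "1 \<le> e powr \<alpha> * norm h powr - \<alpha>"
        using 3 e \<alpha> powr_mono2[of \<alpha> "norm h" e] by (simp add: powr_minus_divide field_simps)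
      then have "b * 1 \<le> b * (e powr \<alpha> * norm h powr - \<alpha>)"
        using b0 by (intro mult_left_mono)
      then have "\<psi> h \<le> b * (e powr \<alpha> * norm h powr - \<alpha>)"
        using b[of h] by linarith
      then have "ennreal (\<psi> h) \<le> ennreal (b * e powr \<alpha>) * ennreal (norm h powr - \<alpha>)"
        using b0 by (subst ennreal_mult'[symmetric]) (auto intro: ennreal_leI simp: mult.assoc)
      then show ?thesis
        using 3 e by (auto simp: mult.assoc[symmetric] intro: mult_right_mono)
    qed
  qed
  also have "\<dots> = ennreal (b * e powr \<alpha>) * local_gagliardo \<alpha> p \<tau> g"
    unfolding local_gagliardo_def by (rule nn_integral_cmult) measurable
  finally show ?thesis .
qed

lemma mollify_support:
  assumes "mollify \<psi> g x \<noteq> 0"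
  obtains y where "dist x y \<le> e" "g y \<noteq> 0"
proof -
  have "\<exists>y. \<psi> (x - y) * g y \<noteq> 0"
  proof (rule ccontr)
    assume "\<nexists>y. \<psi> (x - y) * g y \<noteq> 0"
    then have "(\<lambda>y. \<psi> (x - y) * g y) = (\<lambda>y. 0)"
      by (simp add: fun_eq_iff)
    with assms show False
      unfolding mollify_def by simp
  qed
  then obtain y where "\<psi> (x - y) \<noteq> 0" "g y \<noteq> 0"
    by auto
  moreover from this have "dist x y \<le> e"
    using kernel by (force simp: smooth_kernel_def dist_norm)
  ultimately show ?thesis using that by blast
qed

end

text \<open>Mollifying at scale \<open>e\<close> moves the support by at most \<open>e\<close>, which is less than its distance to the
  boundary.\<close>
lemma (in mollifier) mollify_test_function:
  fixes g :: "'a \<Rightarrow> real"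
  assumes \<Omega>: "bounded \<Omega>" "open \<Omega>" and g: "integrable lborel g" and e: "e < a"
    and supp: "\<And>x. g x \<noteq> 0 \<Longrightarrow> x \<in> \<Omega> \<and> a \<le> infdist x (frontier \<Omega>)"
  shows "mollify \<psi> g \<in> test_functions \<Omega>"
proof -
  let ?K = "{x\<in>\<Omega>. a - e \<le> infdist x (frontier \<Omega>)}"
  have K: "closed ?K" using \<Omega> e by (intro closed_inner_region) auto
  have "{x. mollify \<psi> g x \<noteq> 0} \<subseteq> ?K"
  proof
    fix x assume "x \<in> {x. mollify \<psi> g x \<noteq> 0}"
    then obtain y where y: "dist x y \<le> e" "g y \<noteq> 0"
      using mollify_support by blast
    then have "y \<in> \<Omega>" "a \<le> infdist y (frontier \<Omega>)"
      using supp by auto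
    moreover have "infdist y (frontier \<Omega>) \<le> infdist x (frontier \<Omega>) + dist y x"
      by (rule infdist_triangle)
    ultimately show "x \<in> ?K"
      using y e mem_of_infdist_frontier_gt[OF \<Omega>(2), of y x] by (auto simp: dist_commute)
  qed
  then have "closure {x. mollify \<psi> g x \<noteq> 0} \<subseteq> ?K"
    using K by (rule closure_minimal)
  moreover from this have "bounded (closure {x. mollify \<psi> g x \<noteq> 0})"
    using \<Omega>(1) by (elim bounded_subset[rotated]) (auto intro: bounded_subset)
  ultimately show ?thesis
    using mollify_cont_diff[OF g kernel] by (auto simp: test_functions_def compact_eq_bounded_closed)
qed

text \<open>Close pairs are estimated for \<open>g\<close> and \<open>m\<close> separately; for distant pairs the kernel is bounded, and only
  the \<open>L\<^sup>p\<close> norm of \<open>g - m\<close> and the finite measure of \<open>\<Omega>\<close> enter.\<close>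
lemma gagliardo_energy_diff_le_local:
  fixes g m :: "'a::euclidean_space \<Rightarrow> real"
  assumes \<Omega>: "bounded \<Omega>" "open \<Omega>" and [measurable]: "g \<in> borel_measurable borel" "m \<in> borel_measurable borel"
    and p: "0 \<le> p" and \<tau>: "0 < \<tau>" and \<alpha>: "\<alpha> = real DIM('a) + s * p" "0 \<le> \<alpha>"
  shows "gagliardo_energy s p \<Omega> (\<lambda>x. g x - m x)
    \<le> ennreal (2 powr p) * (local_gagliardo \<alpha> p \<tau> g + local_gagliardo \<alpha> p \<tau> m)
      + ennreal (2 powr p * \<tau> powr - \<alpha>) * (2 * emeasure lborel \<Omega>) * (\<integral>\<^sup>+ x. ennreal (\<bar>g x - m x\<bar> powr p) \<partial>lborel)"
proof -
  define W where "W x = ennreal (\<bar>g x - m x\<bar> powr p)" for x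
  define L where "L h x y = (if norm (x - y) < \<tau> then ennreal (\<bar>h x - h y\<bar> powr p / norm (x - y) powr \<alpha>) else 0)"
    for h :: "'a \<Rightarrow> real" and x y
  define N where "N x y = W x * indicator \<Omega> y" for x y
  define G where "G x y = ennreal (\<bar>(g x - m x) - (g y - m y)\<bar> powr p / norm (x - y) powr \<alpha>)" for x y
  have [measurable]: "\<Omega> \<in> sets borel" using \<Omega> by simp
  have W[measurable]: "W \<in> borel_measurable borel" unfolding W_def by measurable
  have L[measurable]: "case_prod (L h) \<in> borel_measurable (lborel \<Otimes>\<^sub>M lborel)" if [measurable]: "h \<in> borel_measurable borel" for h
    unfolding L_def by measurable
  have N: "case_prod N \<in> borel_measurable (lborel \<Otimes>\<^sub>M lborel)"
    unfolding N_def by measurable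
  have N': "case_prod (\<lambda>x y. N y x) \<in> borel_measurable (lborel \<Otimes>\<^sub>M lborel)"
    unfolding N_def by measurable
  let ?c = "ennreal (2 powr p)" and ?d = "ennreal (2 powr p * \<tau> powr - \<alpha>)"
  have bound: "G x y \<le> ?c * (L g x y + L m x y) + ?d * (W x + W y)" for x y
  proof (cases "norm (x - y) < \<tau>")
    case True
    let ?n = "norm (x - y) powr \<alpha>"
    have "\<bar>(g x - g y) + (m y - m x)\<bar> powr p / ?n \<le> 2 powr p * (\<bar>g x - g y\<bar> powr p + \<bar>m y - m x\<bar> powr p) / ?n"
      by (intro divide_right_mono abs_add_powr_le p) simp
    also have "\<dots> = 2 powr p * (\<bar>g x - g y\<bar> powr p / ?n + \<bar>m x - m y\<bar> powr p / ?n)"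
      by (simp only: add_divide_distrib times_divide_eq_right distrib_left abs_minus_commute[of "m y"])
    also have "(g x - g y) + (m y - m x) = (g x - m x) - (g y - m y)" by simp
    finally have "G x y \<le> ennreal (2 powr p * (\<bar>g x - g y\<bar> powr p / ?n + \<bar>m x - m y\<bar> powr p / ?n))"
      unfolding G_def by (rule ennreal_leI)
    also have "\<dots> = ?c * (L g x y + L m x y)"
      using True by (simp add: L_def ennreal_mult' ennreal_plus)
    finally show ?thesis by (rule order_trans) simp
  next
    case False
    have "norm (x - y) powr - \<alpha> \<le> \<tau> powr - \<alpha>"
      using False \<tau> \<alpha>(2) by (intro powr_mono2') auto
    moreover have "\<bar>(g x - m x) + (m y - g y)\<bar> powr p \<le> 2 powr p * (\<bar>g x - m x\<bar> powr p + \<bar>m y - g y\<bar> powr p)"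
      by (intro abs_add_powr_le p)
    moreover have "(g x - m x) + (m y - g y) = (g x - m x) - (g y - m y)" by simp
    ultimately have "\<bar>(g x - m x) - (g y - m y)\<bar> powr p * norm (x - y) powr - \<alpha>
      \<le> (2 powr p * (\<bar>g x - m x\<bar> powr p + \<bar>g y - m y\<bar> powr p)) * \<tau> powr - \<alpha>"
      by (intro mult_mono) (auto simp: abs_minus_commute)
    then have "G x y \<le> ennreal (2 powr p * \<tau> powr - \<alpha> * (\<bar>g x - m x\<bar> powr p + \<bar>g y - m y\<bar> powr p))"
      unfolding G_def by (intro ennreal_leI) (simp add: powr_minus_divide mult_ac)
    also have "\<dots> = ?d * (W x + W y)"
      by (simp add: W_def ennreal_mult' ennreal_plus)
    finally show ?thesis by (rule order_trans) simp
  qed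
  have "gagliardo_energy s p \<Omega> (\<lambda>x. g x - m x) = (\<integral>\<^sup>+ x. (\<integral>\<^sup>+ y. G x y * indicator \<Omega> y \<partial>lborel) * indicator \<Omega> x \<partial>lborel)"
    unfolding gagliardo_energy_def nn_integral_lebesgue_on[OF \<Omega>(2)] G_def \<alpha>(1) ..
  also have "\<dots> \<le> (\<integral>\<^sup>+ x. \<integral>\<^sup>+ y. 1 * (?c * (L g x y + L m x y) + ?d * (N x y + N y x)) \<partial>lborel \<partial>lborel)"
  proof (rule nn_integral_mono)
    fix x
    show "(\<integral>\<^sup>+ y. G x y * indicator \<Omega> y \<partial>lborel) * indicator \<Omega> x
      \<le> (\<integral>\<^sup>+ y. 1 * (?c * (L g x y + L m x y) + ?d * (N x y + N y x)) \<partial>lborel)"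
    proof (cases "x \<in> \<Omega>")
      case True
      have "(\<integral>\<^sup>+ y. G x y * indicator \<Omega> y \<partial>lborel) \<le> (\<integral>\<^sup>+ y. 1 * (?c * (L g x y + L m x y) + ?d * (N x y + N y x)) \<partial>lborel)"
        using bound True by (intro nn_integral_mono) (auto simp: indicator_def N_def)
      then show ?thesis using True by simp
    qed simp
  qed
  also have "\<dots> = (\<integral>\<^sup>+ x. \<integral>\<^sup>+ y. ?c * (L g x y + L m x y) \<partial>lborel \<partial>lborel) + (\<integral>\<^sup>+ x. \<integral>\<^sup>+ y. ?d * (N x y + N y x) \<partial>lborel \<partial>lborel)"
  proof (subst iterated_nn_integral_add[OF sigma_finite_lborel])
    show "(\<lambda>(x, y). ?c * (L g x y + L m x y)) \<in> borel_measurable (lborel \<Otimes>\<^sub>M lborel)"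
      using L[of g] L[of m] by (simp add: case_prod_beta)
    show "(\<lambda>(x, y). ?d * (N x y + N y x)) \<in> borel_measurable (lborel \<Otimes>\<^sub>M lborel)"
      using N N' by (simp add: case_prod_beta)
  qed simp
  also have "(\<integral>\<^sup>+ x. \<integral>\<^sup>+ y. ?c * (L g x y + L m x y) \<partial>lborel \<partial>lborel) = ?c * (local_gagliardo \<alpha> p \<tau> g + local_gagliardo \<alpha> p \<tau> m)"
  proof (subst iterated_nn_integral_add[OF sigma_finite_lborel L L])
    show "?c * ((\<integral>\<^sup>+ x. \<integral>\<^sup>+ y. L g x y \<partial>lborel \<partial>lborel) + (\<integral>\<^sup>+ x. \<integral>\<^sup>+ y. L m x y \<partial>lborel \<partial>lborel))
      = ?c * (local_gagliardo \<alpha> p \<tau> g + local_gagliardo \<alpha> p \<tau> m)"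
      unfolding L_def by (subst (1 2) local_gagliardo_iterated) simp_all
  qed measurable
  also have "(\<integral>\<^sup>+ x. \<integral>\<^sup>+ y. ?d * (N x y + N y x) \<partial>lborel \<partial>lborel) = ?d * (2 * emeasure lborel \<Omega>) * (\<integral>\<^sup>+ x. W x \<partial>lborel)"
  proof -
    have "(\<integral>\<^sup>+ y. N x y \<partial>lborel) = W x * emeasure lborel \<Omega>" for x
      unfolding N_def by (intro nn_integral_cmult_indicator) measurable
    then have N1: "(\<integral>\<^sup>+ x. \<integral>\<^sup>+ y. N x y \<partial>lborel \<partial>lborel) = emeasure lborel \<Omega> * (\<integral>\<^sup>+ x. W x \<partial>lborel)"
      by (simp add: nn_integral_multc mult.commute)
    have N2: "(\<integral>\<^sup>+ x. \<integral>\<^sup>+ y. N y x \<partial>lborel \<partial>lborel) = (\<integral>\<^sup>+ x. \<integral>\<^sup>+ y. N x y \<partial>lborel \<partial>lborel)"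
      by (rule lborel_pair.Fubini'[OF N])
    show ?thesis
      by (subst iterated_nn_integral_add[OF sigma_finite_lborel N N']) (simp add: N1 N2 mult_2 distrib_left distrib_right mult.assoc)
  qed
  finally show ?thesis by (simp add: W_def)
qed

lemma powr_integrable_imp_integrable:
  fixes g :: "'a::euclidean_space \<Rightarrow> real"
  assumes [measurable]: "g \<in> borel_measurable borel" and p: "1 \<le> p"
    and fin: "(\<integral>\<^sup>+ x. ennreal (\<bar>g x\<bar> powr p) \<partial>lborel) < \<infinity>"
    and \<Omega>: "bounded \<Omega>" "open \<Omega>" and supp: "\<And>x. g x \<noteq> 0 \<Longrightarrow> x \<in> \<Omega>"
  shows "integrable lborel g"
proof (rule integrableI_bounded)
  have [measurable]: "\<Omega> \<in> sets borel" using \<Omega> by simp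
  have "(\<integral>\<^sup>+ x. ennreal (norm (g x)) \<partial>lborel) \<le> (\<integral>\<^sup>+ x. (indicator \<Omega> x + ennreal (\<bar>g x\<bar> powr p)) \<partial>lborel)"
  proof (rule nn_integral_mono)
    fix x
    show "ennreal (norm (g x)) \<le> indicator \<Omega> x + ennreal (\<bar>g x\<bar> powr p)"
    proof (cases "\<bar>g x\<bar> \<le> 1")
      case True
      then have "ennreal (norm (g x)) \<le> indicator \<Omega> x"
        using supp[of x] by (cases "g x = 0") (auto simp: ennreal_le_1)
      then show ?thesis by (rule order_trans) simp
    next
      case False
      then have "\<bar>g x\<bar> powr 1 \<le> \<bar>g x\<bar> powr p"
        using p by (intro powr_mono) auto
      then have "ennreal (norm (g x)) \<le> ennreal (\<bar>g x\<bar> powr p)"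
        using False by (intro ennreal_leI) simp
      then show ?thesis by (rule order_trans) simp
    qed
  qed
  also have "\<dots> = emeasure lborel \<Omega> + (\<integral>\<^sup>+ x. ennreal (\<bar>g x\<bar> powr p) \<partial>lborel)"
    by (subst nn_integral_add) auto
  also have "\<dots> < \<infinity>"
    using fin emeasure_bounded_finite[OF \<Omega>(1)] by simp
  finally show "(\<integral>\<^sup>+ x. ennreal (norm (g x)) \<partial>lborel) < \<infinity>" .
qed simp

text \<open>The scale \<open>\<tau>\<close> separating close from distant pairs is fixed so that close pairs contribute
  little for \<open>g\<close>, and hence for all its mollifications; then the mollification scale is sent to zero to
  handle the distant pairs.\<close>
lemma mollification_approximates:
  fixes g :: "'a::euclidean_space \<Rightarrow> real"
  assumes \<Omega>: "bounded \<Omega>" "open \<Omega>" and g[measurable]: "g \<in> borel_measurable borel"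
    and p: "1 \<le> p" and s: "0 < s" and a: "0 < a"
    and supp: "\<And>x. g x \<noteq> 0 \<Longrightarrow> x \<in> \<Omega> \<and> a \<le> infdist x (frontier \<Omega>)"
    and lp: "(\<integral>\<^sup>+ x. ennreal (\<bar>g x\<bar> powr p) \<partial>lborel) < \<infinity>"
    and gag: "local_gagliardo (real DIM('a) + s * p) p a g < \<infinity>"
    and \<epsilon>: "0 < \<epsilon>"
  obtains \<phi> where "\<phi> \<in> test_functions \<Omega>" "lp_energy p \<Omega> (\<lambda>x. g x - \<phi> x) < ennreal \<epsilon>"
    "gagliardo_energy s p \<Omega> (\<lambda>x. g x - \<phi> x) < ennreal \<epsilon>"
proof -
  define \<alpha> where "\<alpha> = real DIM('a) + s * p"
  have sp: "0 < s * p" using s p by simp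
  have \<alpha>: "0 < \<alpha>" using sp by (simp add: \<alpha>_def add_pos_pos)
  have g_int: "integrable lborel g"
    using powr_integrable_imp_integrable[OF g p lp \<Omega>] supp by blast
  obtain C :: real where C: "0 < C"
    "\<And>e. 0 < e \<Longrightarrow> \<exists>\<psi>\<in>smooth_kernel e. (\<forall>x::'a. 0 \<le> \<psi> x \<and> \<psi> x \<le> C / e powr real DIM('a)) \<and>
       integrable lborel \<psi> \<and> (\<integral>x. \<psi> x \<partial>lborel) = 1"
    using mollifier_exists by blast
  have "(\<lambda>n. ennreal (2 powr p * 2) * local_gagliardo \<alpha> p (a / real (Suc n)) g) \<longlonglongrightarrow> ennreal (2 powr p * 2) * 0"
    using gag by (intro ennreal_tendsto_cmult local_gagliardo_tendsto_0 g a) (simp_all add: \<alpha>_def)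
  then have "eventually (\<lambda>n. ennreal (2 powr p * 2) * local_gagliardo \<alpha> p (a / real (Suc n)) g < ennreal (\<epsilon> / 2)) sequentially"
    using \<epsilon> by (intro order_tendstoD(2)) auto
  then obtain n where n: "ennreal (2 powr p * 2) * local_gagliardo \<alpha> p (a / real (Suc n)) g < ennreal (\<epsilon> / 2)"
    unfolding eventually_sequentially by blast
  define \<tau> where "\<tau> = a / real (Suc n)"
  have \<tau>: "0 < \<tau>" "\<tau> \<le> a" using a by (auto simp: \<tau>_def field_simps)
  let ?L = "local_gagliardo \<alpha> p \<tau>"
  note n = n[folded \<tau>_def]
  have L_fin: "?L g < \<infinity>"
  proof (rule ccontr)
    assume "\<not> ?L g < \<infinity>"
    then have "?L g = \<infinity>" by (simp add: less_top[symmetric])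
    then show False using n by (simp add: ennreal_mult_top)
  qed
  \<comment> \<open>The summand \<open>1\<close> lets the same bound control the \<open>L\<^sup>p\<close> part of the error.\<close>
  define D where "D = ennreal (2 powr p * \<tau> powr - \<alpha>) * (2 * emeasure lborel \<Omega>) + 1"
  have D: "D < \<infinity>"
    using emeasure_bounded_finite[OF \<Omega>(1)] by (simp add: D_def ennreal_mult_less_top)
  have "(\<lambda>m. D * (ennreal (C * (1 / real (Suc m)) powr (s * p)) * ?L g)) \<longlonglongrightarrow> D * (ennreal (C * 0) * ?L g)"
  proof (intro ennreal_tendsto_cmult D tendsto_mult_ennreal tendsto_const tendsto_ennrealI tendsto_mult)
    show "(\<lambda>m. (1 / real (Suc m)) powr (s * p)) \<longlonglongrightarrow> 0"
      using LIMSEQ_inverse_real_of_nat sp by (intro tendsto_zero_powrI[where b = "s * p"]) (auto simp: inverse_eq_divide)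
  qed (use L_fin D in auto)
  then have ev1: "eventually (\<lambda>m. D * (ennreal (C * (1 / real (Suc m)) powr (s * p)) * ?L g) < ennreal (\<epsilon> / 2)) sequentially"
    using \<epsilon> by (intro order_tendstoD(2)) auto
  have ev2: "eventually (\<lambda>m. 1 / real (Suc m) < \<tau>) sequentially"
    using LIMSEQ_inverse_real_of_nat \<tau>(1) by (intro order_tendstoD(2)) (auto simp: inverse_eq_divide)
  obtain m where m: "D * (ennreal (C * (1 / real (Suc m)) powr (s * p)) * ?L g) < ennreal (\<epsilon> / 2)" "1 / real (Suc m) < \<tau>"
    using eventually_conj[OF ev1 ev2] unfolding eventually_sequentially by blast
  define e where "e = 1 / real (Suc m)"
  have e: "0 < e" "e < \<tau>" using m by (auto simp: e_def)
  note m = m[folded e_def]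
  obtain \<psi> where \<psi>: "\<psi> \<in> smooth_kernel e" "\<And>x::'a. 0 \<le> \<psi> x" "\<And>x. \<psi> x \<le> C / e powr real DIM('a)"
    "integrable lborel \<psi>" "(\<integral>x. \<psi> x \<partial>lborel) = 1"
    using C(2)[OF e(1)] by blast
  interpret mollifier \<psi> e by standard (use \<psi> in auto)
  define \<phi> where "\<phi> = mollify \<psi> g"
  have \<phi>: "\<phi> \<in> test_functions \<Omega>"
    unfolding \<phi>_def using e \<tau> by (intro mollify_test_function[OF \<Omega> g_int _ supp]) auto
  have [measurable]: "\<phi> \<in> borel_measurable borel"
    using test_functions_continuous[OF \<phi>] by (rule borel_measurable_continuous_onI)
  let ?W = "\<integral>\<^sup>+ x. ennreal (\<bar>g x - \<phi> x\<bar> powr p) \<partial>lborel"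
  have "C / e powr real DIM('a) * e powr \<alpha> = C * e powr (s * p)"
    using e by (simp add: \<alpha>_def powr_add)
  then have W: "?W \<le> ennreal (C * e powr (s * p)) * ?L g"
    using mollify_lp_distance[OF p g_int e _ \<psi>(3), of \<alpha>] \<alpha> by (simp add: \<phi>_def)
  have DW: "D * ?W < ennreal (\<epsilon> / 2)"
    using mult_left_mono[OF W, of D] m(1) by (simp add: le_less_trans)
  have "lp_energy p \<Omega> (\<lambda>x. g x - \<phi> x) \<le> ?W"
    unfolding lp_energy_def nn_integral_lebesgue_on[OF \<Omega>(2)]
    by (intro nn_integral_mono) (auto simp: indicator_def)
  also have "\<dots> \<le> D * ?W"
    using mult_right_mono[of 1 D ?W] by (simp add: D_def)
  also note DW
  also have "ennreal (\<epsilon> / 2) \<le> ennreal \<epsilon>" using \<epsilon> by (intro ennreal_leI) simp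
  finally have lp': "lp_energy p \<Omega> (\<lambda>x. g x - \<phi> x) < ennreal \<epsilon>" .
  have "gagliardo_energy s p \<Omega> (\<lambda>x. g x - \<phi> x)
    \<le> ennreal (2 powr p) * (?L g + ?L \<phi>) + ennreal (2 powr p * \<tau> powr - \<alpha>) * (2 * emeasure lborel \<Omega>) * ?W"
    using p \<alpha> by (intro gagliardo_energy_diff_le_local[OF \<Omega>] \<tau> \<alpha>_def) auto
  also have "\<dots> \<le> ennreal (2 powr p * 2) * ?L g + D * ?W"
  proof (intro add_mono mult_right_mono)
    have "?L g + ?L \<phi> \<le> 2 * ?L g"
      using local_gagliardo_mollify_le[OF p g_int, of \<alpha> \<tau>] by (simp add: \<phi>_def mult_2 add_left_mono)
    then have "ennreal (2 powr p) * (?L g + ?L \<phi>) \<le> ennreal (2 powr p) * (2 * ?L g)"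
      by (intro mult_left_mono) auto
    then show "ennreal (2 powr p) * (?L g + ?L \<phi>) \<le> ennreal (2 powr p * 2) * ?L g"
      by (simp add: ennreal_mult' mult.assoc)
  qed (simp_all add: D_def)
  also have "\<dots> < ennreal (\<epsilon> / 2) + ennreal (\<epsilon> / 2)"
    using n DW by (rule add_strict_mono)
  also have "\<dots> = ennreal \<epsilon>"
    using \<epsilon> by (subst ennreal_plus[symmetric]) auto
  finally show ?thesis using that \<phi> lp' by blast
qed

section \<open>The truncated kernel\<close>

lemma ex_dyadic_bracket:
  fixes x :: real
  assumes "1 \<le> x"
  obtains n :: nat where "2 ^ n \<le> x" "x < 2 ^ Suc n"
proof -
  have ex: "\<exists>n. x < 2 ^ Suc n"
  proof -
    obtain n where "x < 2 ^ n" using real_arch_pow[of 2 x] by auto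
    also have "(2::real) ^ n \<le> 2 ^ Suc n" by simp
    finally show ?thesis by blast
  qed
  define n where "n = (LEAST n. x < 2 ^ Suc n)"
  have "x < 2 ^ Suc n"
    unfolding n_def using ex by (rule LeastI_ex)
  moreover have "2 ^ n \<le> x"
  proof (cases n)
    case (Suc m)
    then have "\<not> x < 2 ^ Suc m"
      unfolding n_def using not_less_Least[of m "\<lambda>n. x < 2 ^ Suc n"] by simp
    then show ?thesis using Suc by simp
  qed (use assms in simp)
  ultimately show ?thesis using that by blast
qed

text \<open>An integral bound from a pointwise one by multiples of indicators of balls, one of which may be
  chosen freely at each point; for radial kernels, dyadic balls make the sum geometric.\<close>
lemma nn_integral_le_sum_of_balls:
  fixes w :: "'a::euclidean_space \<Rightarrow> ennreal"
  assumes cover: "\<And>h. \<exists>n. w h \<le> ennreal (c n) * indicator (cball 0 (r n)) h"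
    and nonneg: "\<And>n::nat. 0 \<le> c n" "\<And>n. 0 \<le> r n"
    and sums: "(\<lambda>n. c n * (unit_ball_vol (real DIM('a)) * r n ^ DIM('a))) sums S"
  shows "(\<integral>\<^sup>+ h. w h \<partial>lborel) \<le> ennreal S"
proof -
  have [measurable]: "cball (0 :: 'a) (r n) \<in> sets borel" for n by simp
  have "(\<integral>\<^sup>+ h. w h \<partial>lborel) \<le> (\<integral>\<^sup>+ (h :: 'a). (\<Sum>n. ennreal (c n) * indicator (cball 0 (r n)) h) \<partial>lborel)"
  proof (rule nn_integral_mono)
    fix h
    obtain n where "w h \<le> ennreal (c n) * indicator (cball 0 (r n)) h"
      using cover by blast
    also have "\<dots> \<le> (\<Sum>n. ennreal (c n) * indicator (cball 0 (r n)) h)"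
    proof -
      define t where "t k = ennreal (c k) * indicator (cball 0 (r k)) h" for k
      have "sum t {n} \<le> suminf t" by (rule sum_le_suminf) auto
      then have "t n \<le> suminf t" by simp
      then show ?thesis unfolding t_def .
    qed
    finally show "w h \<le> (\<Sum>n. ennreal (c n) * indicator (cball 0 (r n)) h)" .
  qed
  also have "\<dots> = (\<Sum>n. \<integral>\<^sup>+ (h :: 'a). ennreal (c n) * indicator (cball 0 (r n)) h \<partial>lborel)"
    by (rule nn_integral_suminf) measurable
  also have "\<dots> = (\<Sum>n. ennreal (c n * (unit_ball_vol (real DIM('a)) * r n ^ DIM('a))))"
    using nonneg by (intro suminf_cong) (simp add: nn_integral_cmult_indicator emeasure_cball ennreal_mult')
  also have "\<dots> = ennreal S"
    using nonneg sums by (intro suminf_ennreal_eq) auto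
  finally show ?thesis .
qed

text \<open>Near the origin the integrand is of order \<open>|h|\<close> to the power \<open>p - sp - d\<close>, integrable as \<open>s < 1\<close>; far away it is
  of order \<open>|h|\<^sup>-\<^sup>d\<^sup>-\<^sup>s\<^sup>p\<close>, integrable as \<open>s > 0\<close>. Dyadic balls centred at \<open>0\<close>, of radii
  proportional to \<open>a\<close>, give two geometric series and the dependence on \<open>a\<close> at once.\<close>
lemma truncated_kernel_integral:
  fixes s p :: real
  assumes s: "0 < s" "s < 1" and p: "0 < p"
  obtains K where "0 \<le> K"
    "\<And>a. 0 < a \<Longrightarrow> (\<integral>\<^sup>+ h. ennreal (min 1 (norm h / a) powr p / norm (h :: 'a::euclidean_space) powr (real DIM('a) + s * p)) \<partial>lborel)
       \<le> ennreal (K * a powr - (s * p))"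
proof -
  define d where "d = real DIM('a)"
  define \<alpha> where "\<alpha> = d + s * p"
  define V where "V = unit_ball_vol d"
  have sp: "0 < s * p" "s * p < p" using s p by auto
  have \<alpha>: "0 < \<alpha>" using sp by (simp add: \<alpha>_def d_def add_nonneg_pos)
  have V: "0 < V" by (simp add: V_def d_def)
  define u where "u = (2::real) powr - (p - s * p)"
  define v where "v = (2::real) powr - (s * p)"
  have u: "0 < u" "u < 1" using sp by (auto simp: u_def powr_less_one)
  have v: "0 < v" "v < 1" using sp by (auto simp: v_def powr_less_one)
  define K where "K = V * 2 powr \<alpha> * (1 / (1 - u)) + V * 2 powr d * (1 / (1 - v))"
  show ?thesis
  proof (rule that[of K])
    show "0 \<le> K" using u v V by (simp add: K_def)
    fix a :: real assume a: "0 < a"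
    let ?w = "\<lambda>h :: 'a. ennreal (min 1 (norm h / a) powr p / norm h powr \<alpha>)"
    have near: "(\<integral>\<^sup>+ h. ?w h * indicator (ball 0 a) h \<partial>lborel) \<le> ennreal (V * 2 powr \<alpha> * (1 / (1 - u)) * a powr - (s * p))"
    proof (rule nn_integral_le_sum_of_balls)
      define c where "c n = (1 / 2 ^ n) powr p * (a / 2 ^ Suc n) powr - \<alpha>" for n :: nat
      show "\<exists>n. ?w h * indicator (ball 0 a) h \<le> ennreal (c n) * indicator (cball 0 (a / 2 ^ n)) h" for h
      proof (cases "h \<noteq> 0 \<and> norm h < a")
        case True
        then obtain n where n: "2 ^ n \<le> a / norm h" "a / norm h < 2 ^ Suc n"
          using ex_dyadic_bracket[of "a / norm h"] by auto
        have h: "norm h \<le> a / 2 ^ n" "a / 2 ^ Suc n < norm h"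
          using n True by (auto simp: field_simps)
        have "norm h / a \<le> 1 / 2 ^ n"
          using h a by (simp add: field_simps)
        then have "min 1 (norm h / a) powr p \<le> (1 / 2 ^ n) powr p"
          using a p by (intro powr_mono2) auto
        moreover have "norm h powr - \<alpha> \<le> (a / 2 ^ Suc n) powr - \<alpha>"
          using h a \<alpha> by (intro powr_mono2') auto
        ultimately have "min 1 (norm h / a) powr p * norm h powr - \<alpha> \<le> c n"
          unfolding c_def by (intro mult_mono) auto
        then have "?w h \<le> ennreal (c n)"
          by (intro ennreal_leI) (simp add: powr_minus_divide)
        then show ?thesis
          using h True by (intro exI[of _ n]) (simp add: indicator_def)
      qed (auto simp: indicator_def intro!: exI[of _ 0])
      show "0 \<le> c n" for n by (simp add: c_def)
      show "0 \<le> a / 2 ^ n" for n :: nat using a by simp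
      have eq: "c n * (V * (a / 2 ^ n) ^ DIM('a)) = V * 2 powr \<alpha> * a powr - (s * p) * u ^ n" for n
      proof -
        have two: "a / 2 ^ n = a * 2 powr (- real n)" "1 / 2 ^ n = 2 powr (- real n)" "a / 2 ^ Suc n = a * 2 powr (- real n - 1)"
          by (simp_all add: powr_minus_divide powr_realpow powr_diff)
        have c: "c n = 2 powr (- real n * p) * (a powr - \<alpha> * 2 powr ((- real n - 1) * - \<alpha>))"
          unfolding c_def two using a by (simp add: powr_mult powr_powr)
        have r: "(a / 2 ^ n) ^ DIM('a) = a powr d * 2 powr (- real n * d)"
          unfolding two using a by (simp add: d_def powr_realpow[symmetric] powr_mult powr_powr)
        have "c n * (V * (a / 2 ^ n) ^ DIM('a)) = V * (2 powr (- real n * p) * 2 powr ((- real n - 1) * - \<alpha>) * 2 powr (- real n * d)) * (a powr - \<alpha> * a powr d)"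
          unfolding c r by (simp only: mult_ac)
        also have "2 powr (- real n * p) * 2 powr ((- real n - 1) * - \<alpha>) * 2 powr (- real n * d) = (2::real) powr \<alpha> * 2 powr (- (p - s * p) * real n)"
          unfolding powr_add[symmetric] by (rule arg_cong[where f = "(powr) 2"]) (simp add: \<alpha>_def algebra_simps)
        also have "2 powr (- (p - s * p) * real n) = u ^ n"
          unfolding u_def powr_powr[symmetric] by (rule powr_realpow) simp
        also have "a powr - \<alpha> * a powr d = a powr - (s * p)"
          by (simp add: powr_add[symmetric] \<alpha>_def)
        finally show ?thesis by (simp only: mult_ac)
      qed
      have "(\<lambda>n. c n * (V * (a / 2 ^ n) ^ DIM('a))) sums (V * 2 powr \<alpha> * a powr - (s * p) * (1 / (1 - u)))"
        unfolding eq using u by (intro sums_mult geometric_sums) auto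
      then show "(\<lambda>n. c n * (unit_ball_vol (real DIM('a)) * (a / 2 ^ n) ^ DIM('a))) sums (V * 2 powr \<alpha> * (1 / (1 - u)) * a powr - (s * p))"
        unfolding V_def d_def by (simp only: mult_ac)
    qed
    have far: "(\<integral>\<^sup>+ h. ?w h * indicator (- ball 0 a) h \<partial>lborel) \<le> ennreal (V * 2 powr d * (1 / (1 - v)) * a powr - (s * p))"
    proof (rule nn_integral_le_sum_of_balls)
      define c where "c n = (a * 2 ^ n) powr - \<alpha>" for n :: nat
      show "\<exists>n. ?w h * indicator (- ball 0 a) h \<le> ennreal (c n) * indicator (cball 0 (a * 2 ^ Suc n)) h" for h
      proof (cases "a \<le> norm h")
        case True
        then obtain n where n: "2 ^ n \<le> norm h / a" "norm h / a < 2 ^ Suc n"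
          using ex_dyadic_bracket[of "norm h / a"] a by auto
        have h: "a * 2 ^ n \<le> norm h" "norm h < a * 2 ^ Suc n"
          using n a by (auto simp: field_simps)
        have "min 1 (norm h / a) powr p \<le> 1"
          using a p by (intro powr_le1) auto
        moreover have "norm h powr - \<alpha> \<le> (a * 2 ^ n) powr - \<alpha>"
          using h a \<alpha> by (intro powr_mono2') auto
        ultimately have "min 1 (norm h / a) powr p * norm h powr - \<alpha> \<le> 1 * c n"
          unfolding c_def by (intro mult_mono) auto
        then have "?w h \<le> ennreal (c n)"
          by (intro ennreal_leI) (simp add: powr_minus_divide)
        then show ?thesis
          using h True by (intro exI[of _ n]) (simp add: indicator_def)
      qed (auto simp: indicator_def intro!: exI[of _ 0])
      show "0 \<le> c n" for n by (simp add: c_def)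
      show "0 \<le> a * 2 ^ Suc n" for n :: nat using a by simp
      have eq: "c n * (V * (a * 2 ^ Suc n) ^ DIM('a)) = V * 2 powr d * a powr - (s * p) * v ^ n" for n
      proof -
        have two: "a * 2 ^ n = a * 2 powr real n" "a * 2 ^ Suc n = a * 2 powr (real n + 1)"
          by (simp_all add: powr_realpow powr_add)
        have c: "c n = a powr - \<alpha> * 2 powr (real n * - \<alpha>)"
          unfolding c_def two using a by (simp add: powr_mult powr_powr)
        have r: "(a * 2 ^ Suc n) ^ DIM('a) = a powr d * 2 powr ((real n + 1) * d)"
          unfolding two using a by (simp add: d_def powr_realpow[symmetric] powr_mult powr_powr)
        have "c n * (V * (a * 2 ^ Suc n) ^ DIM('a)) = V * (2 powr (real n * - \<alpha>) * 2 powr ((real n + 1) * d)) * (a powr - \<alpha> * a powr d)"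
          unfolding c r by (simp only: mult_ac)
        also have "2 powr (real n * - \<alpha>) * 2 powr ((real n + 1) * d) = (2::real) powr d * 2 powr (- (s * p) * real n)"
          unfolding powr_add[symmetric] by (rule arg_cong[where f = "(powr) 2"]) (simp add: \<alpha>_def algebra_simps)
        also have "2 powr (- (s * p) * real n) = v ^ n"
          unfolding v_def powr_powr[symmetric] by (rule powr_realpow) simp
        also have "a powr - \<alpha> * a powr d = a powr - (s * p)"
          by (simp add: powr_add[symmetric] \<alpha>_def)
        finally show ?thesis by (simp only: mult_ac)
      qed
      have "(\<lambda>n. c n * (V * (a * 2 ^ Suc n) ^ DIM('a))) sums (V * 2 powr d * a powr - (s * p) * (1 / (1 - v)))"
        unfolding eq using v by (intro sums_mult geometric_sums) auto
      then show "(\<lambda>n. c n * (unit_ball_vol (real DIM('a)) * (a * 2 ^ Suc n) ^ DIM('a))) sums (V * 2 powr d * (1 / (1 - v)) * a powr - (s * p))"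
        unfolding V_def d_def by (simp only: mult_ac)
    qed
    have [measurable]: "ball (0 :: 'a) a \<in> sets borel" by simp
    have "(\<integral>\<^sup>+ h. ?w h \<partial>lborel) = (\<integral>\<^sup>+ h. ?w h * indicator (ball 0 a) h + ?w h * indicator (- ball 0 a) h \<partial>lborel)"
      by (intro nn_integral_cong) (auto simp: indicator_def)
    also have "\<dots> = (\<integral>\<^sup>+ h. ?w h * indicator (ball 0 a) h \<partial>lborel) + (\<integral>\<^sup>+ h. ?w h * indicator (- ball 0 a) h \<partial>lborel)"
      by (rule nn_integral_add) measurable
    also have "\<dots> \<le> ennreal (V * 2 powr \<alpha> * (1 / (1 - u)) * a powr - (s * p)) + ennreal (V * 2 powr d * (1 / (1 - v)) * a powr - (s * p))"
      using near far by (rule add_mono)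
    also have "\<dots> = ennreal (K * a powr - (s * p))"
      using u v V by (subst ennreal_plus[symmetric]) (auto simp: K_def distrib_right)
    finally show "(\<integral>\<^sup>+ h. ennreal (min 1 (norm h / a) powr p / norm (h :: 'a) powr (real DIM('a) + s * p)) \<partial>lborel) \<le> ennreal (K * a powr - (s * p))"
      by (simp add: \<alpha>_def d_def)
  qed
qed

section \<open>Cutting off near the boundary\<close>

definition boundary_cutoff :: "'a::euclidean_space set \<Rightarrow> nat \<Rightarrow> 'a \<Rightarrow> real" where
  "boundary_cutoff \<Omega> n x = max 0 (min 1 (real n * infdist x (frontier \<Omega>) - 1))"

lemma boundary_cutoff_range: "0 \<le> boundary_cutoff \<Omega> n x" "boundary_cutoff \<Omega> n x \<le> 1"
  by (auto simp: boundary_cutoff_def)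

lemma continuous_on_boundary_cutoff: "continuous_on UNIV (boundary_cutoff \<Omega> n)"
  unfolding boundary_cutoff_def[abs_def] by (intro continuous_intros)

text \<open>The Lipschitz constant \<open>n\<close> of the cutoff is invisible here: if \<open>n\<close> is large compared with \<open>1 / \<delta>(y)\<close>, then
  the cutoff is constant near \<open>y\<close>, and otherwise \<open>n\<close> itself is at most \<open>4 / \<delta>(y)\<close>. Uniformity in \<open>n\<close> is what makes dominated convergence possible.\<close>
lemma boundary_cutoff_lipschitz:
  assumes y: "0 < infdist y (frontier \<Omega>)"
  shows "\<bar>boundary_cutoff \<Omega> n x - boundary_cutoff \<Omega> n y\<bar> \<le> min 1 (norm (x - y) / (infdist y (frontier \<Omega>) / 4))"
proof -
  let ?\<delta> = "\<lambda>x. infdist x (frontier \<Omega>)" and ?\<eta> = "boundary_cutoff \<Omega> n"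
  have d: "\<bar>?\<delta> x - ?\<delta> y\<bar> \<le> norm (x - y)"
    using infdist_triangle_abs[of x "frontier \<Omega>" y] by (simp add: dist_norm)
  have "\<bar>?\<eta> x - ?\<eta> y\<bar> \<le> 1"
    using boundary_cutoff_range[of \<Omega> n x] boundary_cutoff_range[of \<Omega> n y] by linarith
  moreover have "\<bar>?\<eta> x - ?\<eta> y\<bar> \<le> 4 * norm (x - y) / ?\<delta> y"
  proof (cases "norm (x - y) < ?\<delta> y / 2")
    case False
    then have "1 \<le> 4 * norm (x - y) / ?\<delta> y"
      using y by (simp add: field_simps)
    then show ?thesis
      using \<open>\<bar>?\<eta> x - ?\<eta> y\<bar> \<le> 1\<close> by linarith
  next
    case True
    then have \<delta>x: "?\<delta> y / 2 \<le> ?\<delta> x" using d by linarith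
    \<comment> \<open>In the first case both points are so far from the boundary that the cutoff equals one.\<close>
    show ?thesis
    proof (cases "4 \<le> real n * ?\<delta> y")
      case True
      have "real n * (?\<delta> y / 2) \<le> real n * ?\<delta> x"
        using \<delta>x by (intro mult_left_mono) auto
      then have "?\<eta> x = 1" "?\<eta> y = 1"
        using True by (auto simp: boundary_cutoff_def)
      then show ?thesis using y by simp
    next
      case False
      have "\<bar>?\<eta> x - ?\<eta> y\<bar> \<le> \<bar>real n * ?\<delta> x - real n * ?\<delta> y\<bar>"
        by (auto simp: boundary_cutoff_def)
      also have "\<dots> = real n * \<bar>?\<delta> x - ?\<delta> y\<bar>"
        by (simp add: abs_mult flip: right_diff_distrib)
      also have "\<dots> \<le> 4 / ?\<delta> y * norm (x - y)"
        using False d y by (intro mult_mono) (auto simp: field_simps)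
      finally show ?thesis by simp
    qed
  qed
  ultimately show ?thesis by (simp add: mult.commute)
qed

lemma boundary_cutoff_eventually_1:
  assumes "0 < infdist x (frontier \<Omega>)"
  shows "eventually (\<lambda>n. boundary_cutoff \<Omega> n x = 1) sequentially"
proof -
  obtain N where N: "2 / infdist x (frontier \<Omega>) < real N"
    using reals_Archimedean2 by blast
  have "boundary_cutoff \<Omega> n x = 1" if "N \<le> n" for n
  proof -
    have "2 < real N * infdist x (frontier \<Omega>)"
      using N assms by (simp add: field_simps)
    also have "\<dots> \<le> real n * infdist x (frontier \<Omega>)"
      using that assms by (intro mult_right_mono) auto
    finally show ?thesis by (simp add: boundary_cutoff_def)
  qed
  then show ?thesis unfolding eventually_sequentially by blast
qed

lemma cutoff_lp_tendsto_0:
  assumes \<Omega>: "bounded \<Omega>" "open \<Omega>" and [measurable]: "f \<in> borel_measurable (lebesgue_on \<Omega>)"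
    and p: "0 < p" and lp: "lp_energy p \<Omega> f < \<infinity>"
  shows "(\<lambda>n. lp_energy p \<Omega> (\<lambda>x. f x - f x * boundary_cutoff \<Omega> n x)) \<longlonglongrightarrow> 0"
proof -
  let ?M = "lebesgue_on \<Omega>" and ?u = "\<lambda>n x. f x - f x * boundary_cutoff \<Omega> n x"
  have [measurable]: "boundary_cutoff \<Omega> n \<in> borel_measurable ?M" for n
    by (intro measurable_lebesgue_on_continuous continuous_on_boundary_cutoff)
  have "(\<lambda>n. \<integral>\<^sup>+ x. ennreal (\<bar>?u n x\<bar> powr p) \<partial>?M) \<longlonglongrightarrow> (\<integral>\<^sup>+ x. 0 \<partial>?M)"
  proof (rule nn_integral_dominated_convergence[where w = "\<lambda>x. ennreal (\<bar>f x\<bar> powr p)"])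
    show "AE x in ?M. ennreal (\<bar>?u n x\<bar> powr p) \<le> ennreal (\<bar>f x\<bar> powr p)" for n
    proof (intro AE_I2 ennreal_leI powr_mono2)
      fix x
      have "\<bar>?u n x\<bar> = \<bar>f x\<bar> * \<bar>1 - boundary_cutoff \<Omega> n x\<bar>"
        by (simp add: abs_mult[symmetric] right_diff_distrib)
      then show "\<bar>?u n x\<bar> \<le> \<bar>f x\<bar>"
        using boundary_cutoff_range[of \<Omega> n x] by (simp add: mult_left_le)
    qed (use p in auto)
    show "(\<integral>\<^sup>+ x. ennreal (\<bar>f x\<bar> powr p) \<partial>?M) < \<infinity>"
      using lp by (simp add: lp_energy_def)
    show "AE x in ?M. (\<lambda>n. ennreal (\<bar>?u n x\<bar> powr p)) \<longlonglongrightarrow> 0"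
    proof (rule AE_I2)
      fix x assume "x \<in> space ?M"
      then have "0 < infdist x (frontier \<Omega>)"
        using infdist_frontier_pos[OF \<Omega>] by simp
      from boundary_cutoff_eventually_1[OF this]
      have "eventually (\<lambda>n. ennreal (\<bar>?u n x\<bar> powr p) = 0) sequentially"
        by eventually_elim simp
      then show "(\<lambda>n. ennreal (\<bar>?u n x\<bar> powr p)) \<longlonglongrightarrow> 0"
        by (rule tendsto_eventually)
    qed
  qed measurable
  then show ?thesis by (simp add: lp_energy_def)
qed

text \<open>Split \<open>f(x) (1 - \<eta>(x)) - f(y) (1 - \<eta>(y))\<close> into \<open>(f(x) - f(y)) (1 - \<eta>(x))\<close> and \<open>f(y) (\<eta>(y) - \<eta>(x))\<close>.
  The first part is dominated by the seminorm of \<open>f\<close>, the second, after integration in \<open>x\<close>, by its Hardy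
  integral.\<close>
lemma cutoff_gagliardo_tendsto_0:
  fixes f :: "'a::euclidean_space \<Rightarrow> real"
  assumes \<Omega>: "bounded \<Omega>" "open \<Omega>" and f[measurable]: "f \<in> borel_measurable (lebesgue_on \<Omega>)"
    and s: "0 < s" "s < 1" and p: "0 < p"
    and gag: "gagliardo_energy s p \<Omega> f < \<infinity>" and hardy: "hardy_energy s p \<Omega> f < \<infinity>"
  shows "(\<lambda>n. gagliardo_energy s p \<Omega> (\<lambda>x. f x - f x * boundary_cutoff \<Omega> n x)) \<longlonglongrightarrow> 0"
proof -
  let ?M = "lebesgue_on \<Omega>" and ?u = "\<lambda>n x. f x - f x * boundary_cutoff \<Omega> n x"
  let ?\<delta> = "\<lambda>x. infdist x (frontier \<Omega>)"
  define \<alpha> where "\<alpha> = real DIM('a) + s * p"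
  interpret M: sigma_finite_measure ?M by (rule sigma_finite_lebesgue_on[OF \<Omega>])
  interpret MM: pair_sigma_finite ?M ?M ..
  have \<eta>_meas[measurable]: "boundary_cutoff \<Omega> n \<in> borel_measurable ?M" for n
    by (intro measurable_lebesgue_on_continuous continuous_on_boundary_cutoff)
  define G where "G h z = ennreal (\<bar>h (fst z) - h (snd z)\<bar> powr p / norm (fst z - snd z) powr \<alpha>)" for h :: "'a \<Rightarrow> real" and z
  have G_meas: "G h \<in> borel_measurable (?M \<Otimes>\<^sub>M ?M)" if "h \<in> borel_measurable ?M" for h
    unfolding G_def by (rule gagliardo_integrand_measurable[OF that])
  have energy: "gagliardo_energy s p \<Omega> h = (\<integral>\<^sup>+ z. G h z \<partial>(?M \<Otimes>\<^sub>M ?M))" if "h \<in> borel_measurable ?M" for h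
    unfolding M.nn_integral_fst[OF G_meas[OF that], symmetric] by (simp add: gagliardo_energy_def G_def \<alpha>_def)
  define m where "m z = min 1 (norm (fst z - snd z) / (?\<delta> (snd z) / 4)) powr p / norm (fst z - snd z) powr \<alpha>" for z :: "'a \<times> 'a"
  define H where "H z = ennreal (\<bar>f (snd z)\<bar> powr p) * ennreal (m z)" for z
  have m_meas: "m \<in> borel_measurable (?M \<Otimes>\<^sub>M ?M)"
  proof (rule measurable_pair_lebesgue_on)
    have [measurable]: "(\<lambda>z :: 'a \<times> 'a. ?\<delta> (snd z)) \<in> borel_measurable borel"
      by (intro borel_measurable_continuous_onI continuous_intros)
    have [measurable]: "(\<lambda>z :: 'a \<times> 'a. norm (fst z - snd z)) \<in> borel_measurable borel"
      by (intro borel_measurable_continuous_onI continuous_intros)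
    show "m \<in> borel_measurable borel"
      unfolding m_def[abs_def] by measurable
  qed
  have H_meas: "H \<in> borel_measurable (?M \<Otimes>\<^sub>M ?M)"
    unfolding H_def[abs_def] using m_meas by measurable
  obtain K where K: "0 \<le> K"
    "\<And>a. 0 < a \<Longrightarrow> (\<integral>\<^sup>+ h. ennreal (min 1 (norm h / a) powr p / norm (h :: 'a) powr (real DIM('a) + s * p)) \<partial>lborel) \<le> ennreal (K * a powr - (s * p))"
    by (rule truncated_kernel_integral[OF s p, where 'a = 'a]) blast
  note K = K[folded \<alpha>_def]
  have H_fin: "(\<integral>\<^sup>+ z. H z \<partial>(?M \<Otimes>\<^sub>M ?M)) < \<infinity>"
  proof -
    have inner: "(\<integral>\<^sup>+ x. H (x, y) \<partial>?M) \<le> ennreal (K * 4 powr (s * p)) * ennreal (\<bar>f y\<bar> powr p / ?\<delta> y powr (s * p))"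
      if y: "y \<in> \<Omega>" for y
    proof -
      have \<delta>y: "0 < ?\<delta> y" using infdist_frontier_pos[OF \<Omega> y] .
      let ?k = "\<lambda>h :: 'a. ennreal (min 1 (norm h / (?\<delta> y / 4)) powr p / norm h powr \<alpha>)"
      have "(\<integral>\<^sup>+ x. H (x, y) \<partial>?M) \<le> (\<integral>\<^sup>+ x. ennreal (\<bar>f y\<bar> powr p) * ?k (- y + 1 *\<^sub>R x) \<partial>lborel)"
        unfolding nn_integral_lebesgue_on[OF \<Omega>(2)]
        by (intro nn_integral_mono) (auto simp: H_def m_def indicator_def)
      also have "\<dots> = ennreal (\<bar>f y\<bar> powr p) * (\<integral>\<^sup>+ x. ?k (- y + 1 *\<^sub>R x) \<partial>lborel)"
        by (rule nn_integral_cmult) measurable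
      also have "(\<integral>\<^sup>+ x. ?k (- y + 1 *\<^sub>R x) \<partial>lborel) = (\<integral>\<^sup>+ h. ?k h \<partial>lborel)"
        by (rule nn_integral_lborel_isometry) (simp, measurable)
      also have "ennreal (\<bar>f y\<bar> powr p) * (\<integral>\<^sup>+ h. ?k h \<partial>lborel) \<le> ennreal (\<bar>f y\<bar> powr p) * ennreal (K * (?\<delta> y / 4) powr - (s * p))"
        using \<delta>y by (intro mult_left_mono K(2)) auto
      also have "\<dots> = ennreal (K * 4 powr (s * p) * (\<bar>f y\<bar> powr p / ?\<delta> y powr (s * p)))"
        using K(1) \<delta>y by (subst ennreal_mult'[symmetric]) (auto simp: powr_minus_divide powr_divide)
      also have "\<dots> = ennreal (K * 4 powr (s * p)) * ennreal (\<bar>f y\<bar> powr p / ?\<delta> y powr (s * p))"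
        using K(1) by (subst ennreal_mult'[symmetric]) auto
      finally show ?thesis .
    qed
    have "(\<integral>\<^sup>+ z. H z \<partial>(?M \<Otimes>\<^sub>M ?M)) = (\<integral>\<^sup>+ y. \<integral>\<^sup>+ x. H (x, y) \<partial>?M \<partial>?M)"
      by (rule MM.nn_integral_snd[OF H_meas, symmetric])
    also have "\<dots> \<le> (\<integral>\<^sup>+ y. ennreal (K * 4 powr (s * p)) * ennreal (\<bar>f y\<bar> powr p / ?\<delta> y powr (s * p)) \<partial>?M)"
      by (intro nn_integral_mono inner) simp
    also have "\<dots> = ennreal (K * 4 powr (s * p)) * hardy_energy s p \<Omega> f"
      unfolding hardy_energy_def
    proof (rule nn_integral_cmult)
      have [measurable]: "?\<delta> \<in> borel_measurable ?M"
        by (intro measurable_lebesgue_on_continuous continuous_intros)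
      show "(\<lambda>y. ennreal (\<bar>f y\<bar> powr p / ?\<delta> y powr (s * p))) \<in> borel_measurable ?M" by measurable
    qed
    also have "\<dots> < \<infinity>"
      using hardy by (simp add: ennreal_mult_less_top)
    finally show ?thesis .
  qed
  have u_meas: "?u n \<in> borel_measurable ?M" for n by measurable
  have "(\<lambda>n. \<integral>\<^sup>+ z. G (?u n) z \<partial>(?M \<Otimes>\<^sub>M ?M)) \<longlonglongrightarrow> (\<integral>\<^sup>+ (z :: 'a \<times> 'a). 0 \<partial>(?M \<Otimes>\<^sub>M ?M))"
  proof (rule nn_integral_dominated_convergence[where w = "\<lambda>z. ennreal (2 powr p) * (G f z + H z)"])
    show "G (?u n) \<in> borel_measurable (?M \<Otimes>\<^sub>M ?M)" for n
      by (rule G_meas[OF u_meas])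
    show "(\<lambda>z. ennreal (2 powr p) * (G f z + H z)) \<in> borel_measurable (?M \<Otimes>\<^sub>M ?M)"
      using G_meas[OF f] H_meas by simp
    have "(\<integral>\<^sup>+ z. ennreal (2 powr p) * (G f z + H z) \<partial>(?M \<Otimes>\<^sub>M ?M))
        = ennreal (2 powr p) * ((\<integral>\<^sup>+ z. G f z \<partial>(?M \<Otimes>\<^sub>M ?M)) + (\<integral>\<^sup>+ z. H z \<partial>(?M \<Otimes>\<^sub>M ?M)))"
      using G_meas[OF f] H_meas by (simp add: nn_integral_cmult nn_integral_add)
    also have "\<dots> < \<infinity>"
      using gag H_fin energy[OF f] by (simp add: ennreal_mult_less_top)
    finally show "(\<integral>\<^sup>+ z. ennreal (2 powr p) * (G f z + H z) \<partial>(?M \<Otimes>\<^sub>M ?M)) < \<infinity>" .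
    show "AE z in ?M \<Otimes>\<^sub>M ?M. G (?u n) z \<le> ennreal (2 powr p) * (G f z + H z)" for n
    proof (rule AE_I2)
      fix z assume "z \<in> space (?M \<Otimes>\<^sub>M ?M)"
      then obtain x y where z: "z = (x, y)" "x \<in> \<Omega>" "y \<in> \<Omega>"
        by (auto simp: space_pair_measure)
      let ?\<eta> = "boundary_cutoff \<Omega> n" and ?q = "norm (x - y) powr \<alpha>"
      let ?m = "min 1 (norm (x - y) / (?\<delta> y / 4))"
      have "\<bar>?u n x - ?u n y\<bar> powr p = \<bar>(f x - f y) * (1 - ?\<eta> x) + f y * (?\<eta> y - ?\<eta> x)\<bar> powr p"
        by (simp add: algebra_simps)
      also have "\<dots> \<le> 2 powr p * (\<bar>(f x - f y) * (1 - ?\<eta> x)\<bar> powr p + \<bar>f y * (?\<eta> y - ?\<eta> x)\<bar> powr p)"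
        using p by (intro abs_add_powr_le) simp
      also have "\<dots> \<le> 2 powr p * (\<bar>f x - f y\<bar> powr p + (\<bar>f y\<bar> * ?m) powr p)"
      proof (intro mult_left_mono add_mono powr_mono2)
        show "\<bar>(f x - f y) * (1 - ?\<eta> x)\<bar> \<le> \<bar>f x - f y\<bar>"
          using boundary_cutoff_range[of \<Omega> n x] by (simp add: abs_mult mult_left_le)
        show "\<bar>f y * (?\<eta> y - ?\<eta> x)\<bar> \<le> \<bar>f y\<bar> * ?m"
          using boundary_cutoff_lipschitz[OF infdist_frontier_pos[OF \<Omega> z(3)], of n x]
          by (simp only: abs_mult abs_minus_commute[of "?\<eta> y"] mult_left_mono abs_ge_zero)
      qed (use p in auto)
      also have "\<dots> = 2 powr p * (\<bar>f x - f y\<bar> powr p + \<bar>f y\<bar> powr p * ?m powr p)"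
        using infdist_frontier_pos[OF \<Omega> z(3)] by (subst powr_mult) auto
      finally have "\<bar>?u n x - ?u n y\<bar> powr p / ?q \<le> 2 powr p * (\<bar>f x - f y\<bar> powr p + \<bar>f y\<bar> powr p * ?m powr p) / ?q"
        by (rule divide_right_mono) simp
      also have "\<dots> = 2 powr p * (\<bar>f x - f y\<bar> powr p / ?q + \<bar>f y\<bar> powr p * (?m powr p / ?q))"
        by (simp only: add_divide_distrib times_divide_eq_right distrib_left)
      finally have "G (?u n) z \<le> ennreal (2 powr p * (\<bar>f x - f y\<bar> powr p / ?q + \<bar>f y\<bar> powr p * (?m powr p / ?q)))"
        unfolding G_def z fst_conv snd_conv by (rule ennreal_leI)
      also have "\<dots> = ennreal (2 powr p) * (G f z + H z)"
        by (simp only: G_def H_def m_def z fst_conv snd_conv ennreal_mult' ennreal_plus powr_ge_zero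
            divide_nonneg_nonneg mult_nonneg_nonneg)
      finally show "G (?u n) z \<le> ennreal (2 powr p) * (G f z + H z)" .
    qed
    show "AE z in ?M \<Otimes>\<^sub>M ?M. (\<lambda>n. G (?u n) z) \<longlonglongrightarrow> 0"
    proof (rule AE_I2)
      fix z assume "z \<in> space (?M \<Otimes>\<^sub>M ?M)"
      then have "fst z \<in> \<Omega>" "snd z \<in> \<Omega>"
        by (auto simp: space_pair_measure)
      then have "eventually (\<lambda>n. boundary_cutoff \<Omega> n (fst z) = 1 \<and> boundary_cutoff \<Omega> n (snd z) = 1) sequentially"
        by (intro eventually_conj boundary_cutoff_eventually_1 infdist_frontier_pos[OF \<Omega>])
      then have "eventually (\<lambda>n. G (?u n) z = 0) sequentially"
        by eventually_elim (simp add: G_def)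
      then show "(\<lambda>n. G (?u n) z) \<longlonglongrightarrow> 0"
        by (rule tendsto_eventually)
    qed
  qed simp
  then show ?thesis by (simp add: energy[OF u_meas])
qed

section \<open>Density of test functions and the characterization\<close>

text \<open>Convolution and the translation arguments work with Borel functions on the whole space. Restoring the support
  exactly, not only up to a null set, keeps the mollifications compactly supported in \<open>\<Omega>\<close>.\<close>
lemma borel_representative:
  fixes f :: "'a::euclidean_space \<Rightarrow> real"
  assumes \<Omega>: "open \<Omega>" and f: "f \<in> borel_measurable (lebesgue_on \<Omega>)"
    and K: "closed K" "K \<subseteq> \<Omega>" and supp: "\<And>x. x \<in> \<Omega> \<Longrightarrow> f x \<noteq> 0 \<Longrightarrow> x \<in> K"
  obtains g where "g \<in> borel_measurable borel" "\<And>x. g x \<noteq> 0 \<Longrightarrow> x \<in> K"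
    "AE x in lborel. x \<in> \<Omega> \<longrightarrow> f x = g x"
proof -
  have "(\<lambda>x. if x \<in> \<Omega> then f x else 0) \<in> borel_measurable lebesgue"
    using \<Omega> f by (intro borel_measurable_if_I) auto
  from completion_ex_borel_measurable_real[OF this] obtain g' where
    g': "g' \<in> borel_measurable lborel" "AE x in lborel. (if x \<in> \<Omega> then f x else 0) = g' x"
    by blast
  have [measurable]: "K \<in> sets borel" "g' \<in> borel_measurable borel" using K g' by auto
  show ?thesis
  proof (rule that[of "\<lambda>x. if x \<in> K then g' x else 0"])
    show "(\<lambda>x. if x \<in> K then g' x else 0) \<in> borel_measurable borel" by measurable
    show "AE x in lborel. x \<in> \<Omega> \<longrightarrow> f x = (if x \<in> K then g' x else 0)"
      using g'(2) by eventually_elim (use supp in auto)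
  qed (auto split: if_splits)
qed

text \<open>If \<open>g\<close> does not vanish at one of two points closer than \<open>a\<close>, then both lie in \<open>\<Omega>\<close>; so extension by zero creates no
  new contributions from close pairs.\<close>
lemma local_gagliardo_le_gagliardo_energy:
  fixes g :: "'a::euclidean_space \<Rightarrow> real"
  assumes \<Omega>: "open \<Omega>" and g: "g \<in> borel_measurable borel"
    and supp: "\<And>x. g x \<noteq> 0 \<Longrightarrow> x \<in> \<Omega> \<and> a \<le> infdist x (frontier \<Omega>)"
  shows "local_gagliardo (real DIM('a) + s * p) p a g \<le> gagliardo_energy s p \<Omega> g"
proof -
  let ?\<alpha> = "real DIM('a) + s * p"
  let ?G = "\<lambda>x y. ennreal (\<bar>g x - g y\<bar> powr p / norm (x - y) powr ?\<alpha>)"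
  have *: "(if norm (x - y) < a then ?G x y else 0) \<le> ?G x y * indicator \<Omega> y * indicator \<Omega> x" for x y
  proof (cases "norm (x - y) < a \<and> (g x \<noteq> 0 \<or> g y \<noteq> 0)")
    case True
    then have "dist x y < a" "dist y x < a" by (auto simp: dist_norm norm_minus_commute)
    then have "x \<in> \<Omega> \<and> y \<in> \<Omega>"
      using True supp[of x] supp[of y] mem_of_infdist_frontier_gt[OF \<Omega>, of y x] mem_of_infdist_frontier_gt[OF \<Omega>, of x y]
      by fastforce
    then show ?thesis by simp
  qed auto
  have "local_gagliardo ?\<alpha> p a g = (\<integral>\<^sup>+ x. \<integral>\<^sup>+ y. (if norm (x - y) < a then ?G x y else 0) \<partial>lborel \<partial>lborel)"
    by (rule local_gagliardo_iterated[OF g, symmetric])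
  also have "\<dots> \<le> (\<integral>\<^sup>+ x. (\<integral>\<^sup>+ y. ?G x y * indicator \<Omega> y \<partial>lborel) * indicator \<Omega> x \<partial>lborel)"
  proof (rule nn_integral_mono)
    fix x
    have "(\<integral>\<^sup>+ y. (if norm (x - y) < a then ?G x y else 0) \<partial>lborel) \<le> (\<integral>\<^sup>+ y. ?G x y * indicator \<Omega> y * indicator \<Omega> x \<partial>lborel)"
      by (intro nn_integral_mono *)
    also have "\<dots> \<le> (\<integral>\<^sup>+ y. ?G x y * indicator \<Omega> y \<partial>lborel) * indicator \<Omega> x"
      by (cases "x \<in> \<Omega>") auto
    finally show "(\<integral>\<^sup>+ y. (if norm (x - y) < a then ?G x y else 0) \<partial>lborel) \<le> (\<integral>\<^sup>+ y. ?G x y * indicator \<Omega> y \<partial>lborel) * indicator \<Omega> x" .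
  qed
  also have "\<dots> = gagliardo_energy s p \<Omega> g"
    unfolding gagliardo_energy_def nn_integral_lebesgue_on[OF \<Omega>] ..
  finally show ?thesis .
qed

text \<open>Cut off near the boundary, pass to a Borel representative, and mollify.\<close>
lemma test_functions_dense:
  fixes \<Omega> :: "'a::euclidean_space set"
  assumes \<Omega>: "bounded \<Omega>" "open \<Omega>" and s: "0 < s" "s < 1" and p: "1 \<le> p"
    and f: "f \<in> frac_sobolev s p \<Omega>" and hardy: "hardy_energy s p \<Omega> f < \<infinity>" and \<epsilon>: "0 < \<epsilon>"
  obtains \<phi> where "\<phi> \<in> test_functions \<Omega>" "frac_sobolev_norm s p \<Omega> (\<lambda>x. f x - \<phi> x) < ennreal \<epsilon>"
proof -
  let ?M = "lebesgue_on \<Omega>"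
  have f_meas[measurable]: "f \<in> borel_measurable ?M" and lp: "lp_energy p \<Omega> f < \<infinity>" and gag: "gagliardo_energy s p \<Omega> f < \<infinity>"
    using f by (auto simp: frac_sobolev_iff)
  have p0: "0 < p" using p by simp
  \<comment> \<open>Two errors of energy \<open>t\<close>, with the factor \<open>2\<^sup>p\<close>, give half of the admissible energy \<open>(\<epsilon> / 2)\<^sup>p\<close>.\<close>
  define t where "t = (\<epsilon> / 2) powr p / (2 powr p * 4)"
  have t: "0 < t" using \<epsilon> by (simp add: t_def)
  have "eventually (\<lambda>n. lp_energy p \<Omega> (\<lambda>x. f x - f x * boundary_cutoff \<Omega> n x) < ennreal t) sequentially"
    using t by (intro order_tendstoD(2)[OF cutoff_lp_tendsto_0[OF \<Omega> f_meas p0 lp]]) simp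
  moreover have "eventually (\<lambda>n. gagliardo_energy s p \<Omega> (\<lambda>x. f x - f x * boundary_cutoff \<Omega> n x) < ennreal t) sequentially"
    using t by (intro order_tendstoD(2)[OF cutoff_gagliardo_tendsto_0[OF \<Omega> f_meas s p0 gag hardy]]) simp
  ultimately have "eventually (\<lambda>n. lp_energy p \<Omega> (\<lambda>x. f x - f x * boundary_cutoff \<Omega> n x) < ennreal t \<and>
      gagliardo_energy s p \<Omega> (\<lambda>x. f x - f x * boundary_cutoff \<Omega> n x) < ennreal t \<and> 0 < n) sequentially"
    using eventually_gt_at_top[of 0] by eventually_elim simp
  then obtain n where n: "lp_energy p \<Omega> (\<lambda>x. f x - f x * boundary_cutoff \<Omega> n x) < ennreal t"
      "gagliardo_energy s p \<Omega> (\<lambda>x. f x - f x * boundary_cutoff \<Omega> n x) < ennreal t" "0 < n"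
    unfolding eventually_sequentially by blast
  define h where "h x = f x * boundary_cutoff \<Omega> n x" for x
  note n = n[folded h_def]
  have [measurable]: "boundary_cutoff \<Omega> n \<in> borel_measurable ?M"
    by (intro measurable_lebesgue_on_continuous continuous_on_boundary_cutoff)
  have h_meas[measurable]: "h \<in> borel_measurable ?M"
    unfolding h_def[abs_def] by measurable
  define a where "a = 1 / real n"
  have a: "0 < a" using n by (simp add: a_def)
  let ?K = "{x\<in>\<Omega>. a \<le> infdist x (frontier \<Omega>)}"
  have supp: "x \<in> ?K" if "x \<in> \<Omega>" "h x \<noteq> 0" for x
  proof -
    have "0 < real n * infdist x (frontier \<Omega>) - 1"
      using that by (auto simp: h_def boundary_cutoff_def)
    then show ?thesis
      using that n by (simp add: a_def field_simps)
  qed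
  obtain g where g: "g \<in> borel_measurable borel" "\<And>x. g x \<noteq> 0 \<Longrightarrow> x \<in> ?K" "AE x in lborel. x \<in> \<Omega> \<longrightarrow> h x = g x"
    by (rule borel_representative[OF \<Omega>(2) h_meas closed_inner_region[OF \<Omega>(2) a] _ supp]) auto
  have g_supp: "x \<in> \<Omega> \<and> a \<le> infdist x (frontier \<Omega>)" if "g x \<noteq> 0" for x
    using g(2)[OF that] by simp
  have lp_h: "lp_energy p \<Omega> h < \<infinity>"
  proof -
    have "lp_energy p \<Omega> h \<le> lp_energy p \<Omega> f"
      unfolding lp_energy_def
    proof (intro nn_integral_mono ennreal_leI powr_mono2)
      show "\<bar>h x\<bar> \<le> \<bar>f x\<bar>" for x
        using boundary_cutoff_range[of \<Omega> n x] by (simp add: h_def abs_mult mult_left_le)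
    qed (use p in auto)
    then show ?thesis using lp by (rule le_less_trans)
  qed
  have "gagliardo_energy s p \<Omega> (\<lambda>x. f x + (h x - f x)) \<le> ennreal (2 powr p) * (gagliardo_energy s p \<Omega> f + gagliardo_energy s p \<Omega> (\<lambda>x. h x - f x))"
    using p by (intro gagliardo_energy_add_le \<Omega>) auto
  also have "\<dots> < \<infinity>"
    using gag n(2) by (simp add: gagliardo_energy_minus_commute[of s p \<Omega> h f] ennreal_mult_less_top less_trans[OF _ ennreal_less_top])
  finally have gag_h: "gagliardo_energy s p \<Omega> h < \<infinity>" by simp
  have "(\<integral>\<^sup>+ x. ennreal (\<bar>g x\<bar> powr p) \<partial>lborel) \<le> lp_energy p \<Omega> g"
    unfolding lp_energy_def nn_integral_lebesgue_on[OF \<Omega>(2)]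
    by (intro nn_integral_mono) (use g_supp in \<open>auto simp: indicator_def\<close>)
  also have "\<dots> < \<infinity>"
    using lp_h energy_cong_AE(1)[OF \<Omega>(2) g(3)] by simp
  finally have lp_g: "(\<integral>\<^sup>+ x. ennreal (\<bar>g x\<bar> powr p) \<partial>lborel) < \<infinity>" .
  have "local_gagliardo (real DIM('a) + s * p) p a g \<le> gagliardo_energy s p \<Omega> g"
    by (rule local_gagliardo_le_gagliardo_energy[OF \<Omega>(2) g(1) g_supp])
  also have "\<dots> < \<infinity>"
    using gag_h energy_cong_AE(2)[OF \<Omega>(2) g(3)] by simp
  finally have gag_g: "local_gagliardo (real DIM('a) + s * p) p a g < \<infinity>" .
  obtain \<phi> where \<phi>: "\<phi> \<in> test_functions \<Omega>" "lp_energy p \<Omega> (\<lambda>x. g x - \<phi> x) < ennreal t"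
    "gagliardo_energy s p \<Omega> (\<lambda>x. g x - \<phi> x) < ennreal t"
    using mollification_approximates[OF \<Omega> g(1) p s(1) a g_supp lp_g gag_g t] by blast
  have \<phi>_meas[measurable]: "\<phi> \<in> borel_measurable ?M"
    using test_functions_continuous[OF \<phi>(1)] by (rule measurable_lebesgue_on_continuous)
  have eq: "AE x in lborel. x \<in> \<Omega> \<longrightarrow> h x - \<phi> x = g x - \<phi> x"
    using g(3) by eventually_elim simp
  have \<phi>h: "lp_energy p \<Omega> (\<lambda>x. h x - \<phi> x) < ennreal t" "gagliardo_energy s p \<Omega> (\<lambda>x. h x - \<phi> x) < ennreal t"
    using \<phi> energy_cong_AE[OF \<Omega>(2) eq] by simp_all
  have small: "ennreal (2 powr p) * (A + B) < ennreal ((\<epsilon> / 2) powr p)" if "A < ennreal t" "B < ennreal t" for A B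
  proof -
    have "ennreal (2 powr p) * (A + B) \<le> ennreal (2 powr p) * (ennreal t + ennreal t)"
      using that by (intro mult_left_mono add_mono) auto
    also have "\<dots> = ennreal (2 powr p * (t + t))"
      using t by (simp only: ennreal_mult'[OF powr_ge_zero] ennreal_plus less_imp_le)
    also have "\<dots> < ennreal ((\<epsilon> / 2) powr p)"
      using \<epsilon> by (intro ennreal_lessI) (auto simp: t_def)
    finally show ?thesis .
  qed
  have "lp_energy p \<Omega> (\<lambda>x. (f x - h x) + (h x - \<phi> x)) \<le> ennreal (2 powr p) * (lp_energy p \<Omega> (\<lambda>x. f x - h x) + lp_energy p \<Omega> (\<lambda>x. h x - \<phi> x))"
    using p by (intro lp_energy_add_le) auto
  also have "\<dots> < ennreal ((\<epsilon> / 2) powr p)"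
    using n(1) \<phi>h(1) by (rule small)
  finally have 1: "lp_energy p \<Omega> (\<lambda>x. f x - \<phi> x) < ennreal ((\<epsilon> / 2) powr p)" by simp
  have "gagliardo_energy s p \<Omega> (\<lambda>x. (f x - h x) + (h x - \<phi> x)) \<le> ennreal (2 powr p) * (gagliardo_energy s p \<Omega> (\<lambda>x. f x - h x) + gagliardo_energy s p \<Omega> (\<lambda>x. h x - \<phi> x))"
    using p by (intro gagliardo_energy_add_le \<Omega>) auto
  also have "\<dots> < ennreal ((\<epsilon> / 2) powr p)"
    using n(2) \<phi>h(2) by (rule small)
  finally have 2: "gagliardo_energy s p \<Omega> (\<lambda>x. f x - \<phi> x) < ennreal ((\<epsilon> / 2) powr p)" by simp
  show ?thesis
    using frac_sobolev_norm_less[OF p0 \<epsilon> 1 2] by (rule that[OF \<phi>(1)])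
qed

theorem theorem3:
  fixes s p \<kappa> :: real and \<Omega> :: "'a::euclidean_space set"
  assumes "0 < s" and "s < 1" and "1 \<le> p"
    and "\<Omega> \<noteq> {}" and "bounded \<Omega>" and "open \<Omega>"
    and "plump \<kappa> \<Omega>"
    and "upper_assouad_codim (frontier \<Omega>) < ereal (s * p)"
  shows "frac_sobolev_0 s p \<Omega> =
    {f \<in> frac_sobolev s p \<Omega>.
       (\<integral>\<^sup>+ x. ennreal (\<bar>f x\<bar> powr p / infdist x (frontier \<Omega>) powr (s * p)) \<partial>lebesgue_on \<Omega>) < \<infinity>}"
  unfolding hardy_energy_def[symmetric]
proof (intro equalityI subsetI)
  fix f assume f: "f \<in> frac_sobolev_0 s p \<Omega>"
  have p: "0 < p" using \<open>1 \<le> p\<close> by simp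
  obtain c q where cq: "0 < c" "q < s * p" "thick c q (frontier \<Omega>)"
    using thick_of_upper_assouad_codim_less[OF assms(8)] by blast
  obtain C where C: "\<And>u. u \<in> borel_measurable (lebesgue_on \<Omega>) \<Longrightarrow> hardy_energy s p \<Omega> u < \<infinity> \<Longrightarrow>
       hardy_energy s p \<Omega> u \<le> ennreal C * gagliardo_energy s p \<Omega> u"
    using hardy_inequality[OF assms(5-7) cq(3,1) assms(1) p cq(2)] by blast
  have "hardy_energy s p \<Omega> \<phi> \<le> ennreal C * gagliardo_energy s p \<Omega> \<phi>" if "\<phi> \<in> test_functions \<Omega>" for \<phi>
    using that assms(1) p
    by (intro C measurable_lebesgue_on_continuous test_functions_continuous[OF that]
        hardy_energy_test_function_finite[OF assms(5,6)])
  then have "hardy_energy s p \<Omega> f < \<infinity>"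
    by (rule hardy_energy_finite_of_approximable[OF assms(5,6,1) p _ f])
  then show "f \<in> {f \<in> frac_sobolev s p \<Omega>. hardy_energy s p \<Omega> f < \<infinity>}"
    using f by (simp add: frac_sobolev_0_def)
next
  fix f assume "f \<in> {f \<in> frac_sobolev s p \<Omega>. hardy_energy s p \<Omega> f < \<infinity>}"
  then have f: "f \<in> frac_sobolev s p \<Omega>" "hardy_energy s p \<Omega> f < \<infinity>" by auto
  then have "\<exists>\<phi>\<in>test_functions \<Omega>. frac_sobolev_norm s p \<Omega> (\<lambda>x. f x - \<phi> x) < ennreal \<epsilon>" if "0 < \<epsilon>" for \<epsilon>
    using test_functions_dense[OF assms(5,6,1-3) f that] by blast
  then show "f \<in> frac_sobolev_0 s p \<Omega>"
    using f by (simp add: frac_sobolev_0_def)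
qed

end
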